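(* Let $d\ge1$, $k>0$, and let $J:[0,\infty)\to[0,\infty)$ be a decreasing Lipschitz function with ${\rm spt}(J)\subset[0,1]$ such that \[ \int_{\mathbb R^d}J(|x|)\,{\rm d}x=1,\qquad -J'(r)\ge\frac rk\ \text{ for a.e. } r\in[0,3/4],\qquad \sup J\le k . \] There is a constant $C(d,k)$ depending only on $d$ and $k$ such that: if $E\subset F\subset\mathbb R^d$ are Lebesgue measurable sets of finite measure with \[ \frac14\le\Big(\frac{|F|}{|B|}\Big)^{1/d}-\Big(\frac{|E|}{|B|}\Big)^{1/d}\le\frac34,\qquad |E|\ge 2|B|, \] then \[ |E|^{1-1/d}\,\alpha(E;B)^{8(d+2)}\le C(d,k)\,\delta_J(E,F). \]
   Context: $B$ is the open unit ball of $\mathbb R^d$ and $|\cdot|$ Lebesgue measure. For a measurable set $G$ of finite measure, $G^*$ denotes the open ball centered at $0$ with $|G^*|=|G|$. For $E,F\subset\mathbb R^d$, \[ \mathcal E_J(E,F)=\int_F\int_E J(|x-y|)\,{\rm d}x\,{\rm d}y,\qquad \delta_J(E,F)=\mathcal E_J(E^*,F^* )-\mathcal E_J(E,F). \] The asymmetry is $\alpha(E;B)=\frac12\inf\{|E\Delta(x_0+rB)|/|E|:x_0\in\mathbb R^d,\ r^d=|E|/|B|\}$. *)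

theory Defs
  imports "HOL-Analysis.Analysis"
begin

abbreviation leb :: "'a::euclidean_space set \<Rightarrow> real" where
  "leb G \<equiv> measure lebesgue G"

text \<open>Symmetric rearrangement G*: open ball centred at 0 with the same measure as G.\<close>
definition sym_ball :: "'a::euclidean_space set \<Rightarrow> 'a set" where
  "sym_ball G = ball 0 ((leb G / leb (ball (0::'a) 1)) powr (1 / real DIM('a)))"

definition energy :: "(real \<Rightarrow> real) \<Rightarrow> 'a::euclidean_space set \<Rightarrow> 'a set \<Rightarrow> real" where
  "energy J E F = (LINT y:F|lebesgue. (LINT x:E|lebesgue. J (norm (x - y))))"

definition deficit :: "(real \<Rightarrow> real) \<Rightarrow> 'a::euclidean_space set \<Rightarrow> 'a set \<Rightarrow> real" where
  "deficit J E F = energy J (sym_ball E) (sym_ball F) - energy J E F"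

definition asymmetry :: "'a::euclidean_space set \<Rightarrow> real" where
  "asymmetry E = (1/2) * Inf {leb ((E - ball x0 r) \<union> (ball x0 r - E)) / leb E | x0 r.
      r ^ DIM('a) = leb E / leb (ball (0::'a) 1) \<and> r \<ge> 0}"

end

theory Submission
  imports Defs "HOL-Analysis.Analysis"
begin

text \<open>
  Let e and e + rho be the radii of the balls E* and F*. The derivative bound on J makes J(r) minus the
  truncated paraboloid (rho^2 - r^2)^+ / 2k decreasing, so Riesz rearrangement applies to this
  remainder and the whole deficit controls the interaction D of E with the complement of F through the
  paraboloid, which vanishes for concentric balls of radii e and e + rho. Put D = eta^(d+3) e^(d-1).
  By Markov's inequality E has a core, missing only a set of relative measure O(eta), whose points see
  little of the complement of F; after averaging over balls of radius eta, the neighbourhood of the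
  core of radius rho - 4 eta fits into F up to a small error. The core is therefore almost optimal in
  the Brunn-Minkowski inequality.
  Cutting by hyperplanes and comparing quantiles with those of a ball bounds the second moment of the
  core about a suitable centre, and the bathtub principle turns this into closeness to a ball:
  alpha^6 = O(eta). Hence alpha^(6(d+3)) is O(D / e^(d-1)), and 6(d+3) does not exceed 8(d+2).
  The Riesz inequality itself is proved by polarization towards the centre.
\<close>

section \<open>The Brunn-Minkowski inequality\<close>

text \<open>Let d be the dimension. The radius \<open>e\<close> of \<open>E\<close> is unbounded
  while \<open>r\<close> stays below 3/4, so every error has to be of surface size, a multiple of
  \<eta> times e^(d-1), never of volume size. This is why the points of \<open>nbhd\<close> outside
  \<open>F\<close> are charged to \<open>F - E\<close>, whose measure is of surface size, and why
  the Brunn-Minkowski deficit \<beta> is measured relative to \<open>r * (a + r) ^ (d - 1)\<close>.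
  The exponent d + 3 adds up as follows: near its rim the paraboloid has height of order \<eta>, the
  piece of the complement to be detected has volume of order \<eta>^(d+1), and one more power makes
  the part of \<open>E\<close> lost in Markov's inequality small. The exponent 6 is 2 times 3: a
  square because volume moved across a sphere changes the second moment only to second order, a cube
  because quantiles are followed with relative error \<open>s\<close>, tails of mass
  \<open>s\<close> are discarded, and \<beta> has to stay below \<open>s ^ 3\<close>. Minkowski sums
  of measurable sets may fail to be measurable; Brunn-Minkowski is therefore stated for any
  measurable \<open>Z\<close> that contains the sum.\<close>

lemma box_sum_subset:
  fixes a b c d :: "'a::euclidean_space"
  assumes "box a b \<noteq> {}" "box c d \<noteq> {}"
  shows "box (a + c) (b + d) \<subseteq> box a b + box c d"
proof
  fix z assume z: "z \<in> box (a + c) (b + d)"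
  have ab: "a \<bullet> i < b \<bullet> i" "c \<bullet> i < d \<bullet> i" if "i \<in> Basis" for i
    using assms that by (auto simp: box_ne_empty)
  define l where "l i = (z \<bullet> i - a \<bullet> i - c \<bullet> i) / ((b \<bullet> i - a \<bullet> i) + (d \<bullet> i - c \<bullet> i))" for i
  have l: "0 < l i" "l i < 1" if "i \<in> Basis" for i
    using z ab[OF that] that by (auto simp: l_def mem_box field_simps inner_simps)
  define x where "x = (\<Sum>i\<in>Basis. (a \<bullet> i + l i * (b \<bullet> i - a \<bullet> i)) *\<^sub>R i)"
  define y where "y = (\<Sum>i\<in>Basis. (c \<bullet> i + l i * (d \<bullet> i - c \<bullet> i)) *\<^sub>R i)"
  have "z = x + y"
  proof (rule euclidean_eqI)
    fix i :: 'a assume i: "i \<in> Basis"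
    have "l i * ((b \<bullet> i - a \<bullet> i) + (d \<bullet> i - c \<bullet> i)) = z \<bullet> i - a \<bullet> i - c \<bullet> i"
      using ab[OF i] by (simp add: l_def)
    then show "z \<bullet> i = (x + y) \<bullet> i"
      using i by (simp add: x_def y_def inner_add_left) (simp add: algebra_simps)
  qed
  moreover have "x \<in> box a b"
    using ab l by (auto simp: mem_box x_def) (smt (verit) mult_less_cancel_right2)
  moreover have "y \<in> box c d"
    using ab l by (auto simp: mem_box y_def) (smt (verit) mult_less_cancel_right2)
  ultimately show "z \<in> box a b + box c d"
    by (auto simp: set_plus_def)
qed

text \<open>Brunn-Minkowski for two boxes with side lengths \<alpha> and \<beta>: AM-GM is applied
  to the ratios \<open>\<alpha> i / (\<alpha> i + \<beta> i)\<close> and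
  \<open>\<beta> i / (\<alpha> i + \<beta> i)\<close>, whose means add up to 1. The common factor
  \<open>w\<close> is what the cuts below will shrink while \<open>x\<close> and \<open>y\<close>
  stay fixed.\<close>

lemma prod_add_power_ge:
  fixes \<alpha> \<beta> :: "'a \<Rightarrow> real"
  assumes "finite S" "S \<noteq> {}" and pos: "\<And>i. i \<in> S \<Longrightarrow> 0 < \<alpha> i" "\<And>i. i \<in> S \<Longrightarrow> 0 < \<beta> i"
    and "0 < w" "0 < x" "0 < y"
    and \<alpha>: "(\<Prod>i\<in>S. \<alpha> i) = w * x ^ card S" and \<beta>: "(\<Prod>i\<in>S. \<beta> i) = w * y ^ card S"
  shows "w * (x + y) ^ card S \<le> (\<Prod>i\<in>S. \<alpha> i + \<beta> i)"
proof -
  let ?n = "card S"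
  let ?P = "\<Prod>i\<in>S. \<alpha> i + \<beta> i"
  have n: "?n > 0" using assms by (simp add: card_gt_0_iff)
  have P: "?P > 0" using pos by (intro prod_pos) (simp add: add_pos_pos)
  define r where "r = (w / ?P) powr (1 / ?n)"
  have wP: "w / ?P > 0" using P \<open>w > 0\<close> by simp
  have am: "(w * u ^ ?n / ?P) powr (1 / ?n) = r * u" if "u > 0" for u :: real
  proof -
    have "(w * u ^ ?n / ?P) powr (1 / ?n) = (w / ?P) powr (1 / ?n) * (u ^ ?n) powr (1 / ?n)"
      using that wP by (simp add: powr_mult[symmetric])
    also have "(u ^ ?n) powr (1 / ?n) = u"
      using that n by (simp add: powr_realpow[symmetric] powr_powr)
    finally show ?thesis by (simp add: r_def)
  qed
  have "r * x \<le> (\<Sum>i\<in>S. (\<alpha> i / (\<alpha> i + \<beta> i)) / ?n)"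
  proof -
    have "(\<Prod>i\<in>S. \<alpha> i / (\<alpha> i + \<beta> i)) powr (1 / ?n) \<le> (\<Sum>i\<in>S. (\<alpha> i / (\<alpha> i + \<beta> i)) / ?n)"
      using assms pos by (intro arith_geom_mean) (auto simp: less_imp_le add_nonneg_nonneg intro!: divide_nonneg_nonneg)
    then show ?thesis using am[OF \<open>x > 0\<close>] by (simp add: prod_dividef \<alpha>)
  qed
  moreover have "r * y \<le> (\<Sum>i\<in>S. (\<beta> i / (\<alpha> i + \<beta> i)) / ?n)"
  proof -
    have "(\<Prod>i\<in>S. \<beta> i / (\<alpha> i + \<beta> i)) powr (1 / ?n) \<le> (\<Sum>i\<in>S. (\<beta> i / (\<alpha> i + \<beta> i)) / ?n)"
      using assms pos by (intro arith_geom_mean) (auto simp: less_imp_le add_nonneg_nonneg intro!: divide_nonneg_nonneg)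
    then show ?thesis using am[OF \<open>y > 0\<close>] by (simp add: prod_dividef \<beta>)
  qed
  moreover have "(\<Sum>i\<in>S. (\<alpha> i / (\<alpha> i + \<beta> i)) / ?n) + (\<Sum>i\<in>S. (\<beta> i / (\<alpha> i + \<beta> i)) / ?n) = 1"
  proof -
    have "(\<alpha> i / (\<alpha> i + \<beta> i)) / ?n + (\<beta> i / (\<alpha> i + \<beta> i)) / ?n = 1 / ?n" if "i \<in> S" for i
      using pos[OF that] by (simp add: add_divide_distrib[symmetric])
    then have "(\<Sum>i\<in>S. (\<alpha> i / (\<alpha> i + \<beta> i)) / ?n + (\<beta> i / (\<alpha> i + \<beta> i)) / ?n) = (\<Sum>i\<in>S. 1 / ?n)"
      by (intro sum.cong) auto
    then show ?thesis using n by (simp add: sum.distrib)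
  qed
  ultimately have "r * (x + y) \<le> 1" by (simp add: algebra_simps)
  moreover have r: "r > 0" unfolding r_def powr_gt_zero using wP by linarith
  ultimately have "(r * (x + y)) ^ ?n \<le> 1"
    using assms by (intro power_le_one) auto
  moreover have "r ^ ?n = w / ?P"
  proof -
    have "r ^ ?n = r powr ?n" using r by (simp add: powr_realpow)
    also have "\<dots> = (w / ?P) powr 1" using n by (simp only: r_def powr_powr) simp
    finally show ?thesis using wP by (simp only: powr_one less_imp_le)
  qed
  ultimately have "(w / ?P) * (x + y) ^ ?n \<le> 1" by (simp only: power_mult_distrib)
  then show ?thesis using P by (simp add: pos_divide_le_eq)
qed

lemma ex_scaled_power:
  fixes w u m :: real
  assumes "0 < w" "0 \<le> u" "w * u ^ n < m" "0 < n"
  shows "\<exists>v>u. m = w * v ^ n"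
proof (intro exI[of _ "root n (m / w)"] conjI)
  have lt: "u ^ n < m / w" using assms by (simp add: field_simps)
  then have "root n (u ^ n) < root n (m / w)" using \<open>0 < n\<close> by simp
  then show "u < root n (m / w)" using assms by (simp add: real_root_power_cancel)
  have "0 \<le> u ^ n" using assms by simp
  then have "0 \<le> m / w" using lt by linarith
  then show "m = w * root n (m / w) ^ n" using assms by (simp add: real_root_pow_pos2)
qed

lemma box_Int_halfspace:
  fixes b :: "'a::euclidean_space"
  assumes "b \<in> Basis"
  shows "\<exists>c d. box u v \<inter> {x. x \<bullet> b < t} = box c d" "\<exists>c d. box u v \<inter> {x. t < x \<bullet> b} = box c d"
proof -
  let ?v = "\<Sum>i\<in>Basis. (if i = b then min (v \<bullet> i) t else v \<bullet> i) *\<^sub>R i"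
  let ?u = "\<Sum>i\<in>Basis. (if i = b then max (u \<bullet> i) t else u \<bullet> i) *\<^sub>R i"
  have "box u v \<inter> {x. x \<bullet> b < t} = box u ?v"
    using assms by (auto simp: mem_box split: if_splits)
  moreover have "box u v \<inter> {x. t < x \<bullet> b} = box ?u v"
    using assms by (auto simp: mem_box split: if_splits)
  ultimately show "\<exists>c d. box u v \<inter> {x. x \<bullet> b < t} = box c d" "\<exists>c d. box u v \<inter> {x. t < x \<bullet> b} = box c d"
    by blast+
qed

section \<open>Finite disjoint families of boxes, cut by coordinate hyperplanes\<close>

definition boxes :: "'a::euclidean_space set set \<Rightarrow> bool" where
  "boxes \<X> \<longleftrightarrow> finite \<X> \<and> disjoint \<X> \<and> (\<forall>B\<in>\<X>. B \<noteq> {} \<and> (\<exists>c d. B = box c d))"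

lemma boxes_Union:
  assumes "boxes \<X>"
  shows "open (\<Union>\<X>)" "\<Union>\<X> \<in> fmeasurable lborel"
proof -
  show op: "open (\<Union>\<X>)" using assms unfolding boxes_def by (intro open_Union ballI) (metis open_box)
  have "bounded (\<Union>\<X>)" using assms unfolding boxes_def by (intro bounded_Union ballI) (metis bounded_box)+
  then have "emeasure lborel (\<Union>\<X>) < \<infinity>"
    by (rule emeasure_bounded_finite)
  then show "\<Union>\<X> \<in> fmeasurable lborel" using op by (intro fmeasurableI) auto
qed

lemma measure_boxes_pos:
  assumes "boxes \<X>" "\<X> \<noteq> {}"
  shows "0 < measure lborel (\<Union>\<X>)"
proof -
  have "\<Union>\<X> \<noteq> {}" using assms by (auto simp: boxes_def)
  then have "emeasure lborel (\<Union>\<X>) \<noteq> 0"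
    using boxes_Union(1)[OF assms(1)] open_not_negligible
    by (metis AE_iff_null_sets boxes_Union(2) assms(1) fmeasurableD negligible_iff_null_sets null_sets_completionI null_setsI)
  then show ?thesis
    using boxes_Union(2)[OF assms(1)] by (simp add: measure_def enn2real_positive_iff fmeasurable_def zero_less_iff_neq_zero)
qed

text \<open>The last claim makes the induction decrease: a box on the wrong side of the hyperplane
  disappears from the cut family, and cutting never creates additional boxes.\<close>

lemma boxes_Int:
  assumes "boxes \<X>" and H: "\<And>u v. \<exists>c d. box u v \<inter> H = box c d"
  shows "boxes ((\<lambda>B. B \<inter> H) ` \<X> - {{}})" "\<Union>((\<lambda>B. B \<inter> H) ` \<X> - {{}}) = \<Union>\<X> \<inter> H"
    "card ((\<lambda>B. B \<inter> H) ` \<X> - {{}}) \<le> card \<X>"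
    "B \<in> \<X> \<Longrightarrow> B \<inter> H = {} \<Longrightarrow> card ((\<lambda>B. B \<inter> H) ` \<X> - {{}}) < card \<X>"
proof -
  have fin: "finite \<X>" using assms by (simp add: boxes_def)
  have ex: "\<exists>c d. B \<inter> H = box c d" if "B \<in> \<X>" for B
    using assms(1) that H unfolding boxes_def by metis
  have "disjoint ((\<lambda>B. B \<inter> H) ` \<X> - {{}})"
    using assms(1) unfolding boxes_def pairwise_def disjnt_def by blast
  then show "boxes ((\<lambda>B. B \<inter> H) ` \<X> - {{}})"
    using fin ex by (auto simp: boxes_def)
  show "\<Union>((\<lambda>B. B \<inter> H) ` \<X> - {{}}) = \<Union>\<X> \<inter> H" by auto
  show "card ((\<lambda>B. B \<inter> H) ` \<X> - {{}}) \<le> card \<X>"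
    by (meson Diff_subset card_image_le card_mono fin finite_imageI le_trans)
  show "card ((\<lambda>B. B \<inter> H) ` \<X> - {{}}) < card \<X>" if "B \<in> \<X>" "B \<inter> H = {}"
  proof -
    have "(\<lambda>B. B \<inter> H) ` \<X> - {{}} \<subseteq> (\<lambda>B. B \<inter> H) ` (\<X> - {B})" using that by auto
    then have "card ((\<lambda>B. B \<inter> H) ` \<X> - {{}}) \<le> card (\<X> - {B})"
      by (meson card_image_le card_mono fin finite_Diff finite_imageI le_trans)
    then show ?thesis using that fin by (metis card_Diff1_less le_less_trans)
  qed
qed

lemma null_set_hyperplane:
  fixes b :: "'a::euclidean_space"
  assumes "b \<noteq> 0"
  shows "{x. x \<bullet> b = t} \<in> null_sets lborel"
proof -
  have eq: "{x. x \<bullet> b = t} = {x. b \<bullet> x = t}" by (simp add: inner_commute)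
  have "{x. b \<bullet> x = t} \<in> null_sets lebesgue"
    using negligible_hyperplane[of b t] assms by (simp add: negligible_iff_null_sets)
  moreover have "{x. b \<bullet> x = t} \<in> sets lborel"
    using closed_hyperplane[of b t] by auto
  ultimately show ?thesis
    by (simp add: eq null_sets_completion_iff)
qed

lemma isCont_measure_halfspace:
  fixes b :: "'a::euclidean_space"
  assumes A: "A \<in> fmeasurable lborel" and b: "b \<noteq> 0"
  shows "isCont (\<lambda>t. measure lborel (A \<inter> {x. x \<bullet> b < t})) t"
proof (rule continuous_at_sequentiallyI)
  fix u assume u: "u \<longlonglongrightarrow> t"
  have [measurable]: "A \<in> sets borel" using A by (simp add: fmeasurable_def)
  have lim: "(\<lambda>n. \<integral>x. indicator (A \<inter> {x. x \<bullet> b < u n}) x \<partial>lborel) \<longlonglongrightarrow> (\<integral>x. indicator (A \<inter> {x. x \<bullet> b < t}) x \<partial>lborel :: real)"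
  proof (rule integral_dominated_convergence)
    show "integrable lborel (indicator A :: 'a \<Rightarrow> real)"
      using A by (simp add: fmeasurable_def)
    have "AE x in lborel. x \<bullet> b \<noteq> t"
      using null_set_hyperplane[OF b, of t] by (rule AE_I') auto
    then show "AE x in lborel. (\<lambda>n. indicator (A \<inter> {x. x \<bullet> b < u n}) x) \<longlonglongrightarrow> (indicator (A \<inter> {x. x \<bullet> b < t}) x :: real)"
    proof eventually_elim
      case (elim x)
      have "eventually (\<lambda>n. (x \<bullet> b < u n) = (x \<bullet> b < t)) sequentially"
      proof (cases "x \<bullet> b < t")
        case True
        then show ?thesis using order_tendstoD(1)[OF u, of "x \<bullet> b"] by (auto elim: eventually_mono)
      next
        case False
        then have "t < x \<bullet> b" using elim by simp
        from order_tendstoD(2)[OF u this] show ?thesis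
          using False by (auto elim: eventually_mono)
      qed
      then have "eventually (\<lambda>n. indicator (A \<inter> {x. x \<bullet> b < u n}) x = (indicator (A \<inter> {x. x \<bullet> b < t}) x :: real)) sequentially"
        by (auto elim!: eventually_mono simp: indicator_def)
      then show ?case by (rule tendsto_eventually)
    qed
  qed (auto simp: indicator_def)
  then show "(\<lambda>n. measure lborel (A \<inter> {x. x \<bullet> b < u n})) \<longlonglongrightarrow> measure lborel (A \<inter> {x. x \<bullet> b < t})"
    by simp
qed

lemma measure_halfspace_quantile:
  fixes b :: "'a::euclidean_space"
  assumes A: "A \<in> fmeasurable lborel" and b: "b \<noteq> 0" and m: "0 < m" "m < measure lborel A"
  shows "\<exists>t. measure lborel (A \<inter> {x. x \<bullet> b < t}) = m"
proof -
  have [measurable]: "A \<in> sets borel" using A by (simp add: fmeasurable_def)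
  let ?g = "\<lambda>t. measure lborel (A \<inter> {x. x \<bullet> b < t})"
  have "(\<lambda>n. ?g (real n)) \<longlonglongrightarrow> measure lborel (\<Union>n. A \<inter> {x. x \<bullet> b < real n})"
  proof (rule Lim_measure_incseq)
    have "emeasure lborel (\<Union>n. A \<inter> {x. x \<bullet> b < real n}) \<le> emeasure lborel A"
      by (rule emeasure_mono) auto
    also have "\<dots> < \<infinity>" using A by (simp add: fmeasurable_def)
    finally show "emeasure lborel (\<Union>n. A \<inter> {x. x \<bullet> b < real n}) \<noteq> \<infinity>" by simp
  qed (auto simp: incseq_def)
  moreover have "(\<Union>n. A \<inter> {x. x \<bullet> b < real n}) = A"
    using reals_Archimedean2 by auto
  ultimately have "(\<lambda>n. ?g (real n)) \<longlonglongrightarrow> measure lborel A" by simp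
  from order_tendstoD(1)[OF this m(2)] obtain n1 where n1: "m < ?g (real n1)"
    by (auto simp: eventually_sequentially)
  have "(\<lambda>n. ?g (- real n)) \<longlonglongrightarrow> measure lborel (\<Inter>n. A \<inter> {x. x \<bullet> b < - real n})"
  proof (rule Lim_measure_decseq)
    fix n show "emeasure lborel (A \<inter> {x. x \<bullet> b < - real n}) \<noteq> \<infinity>"
      using A emeasure_mono[of "A \<inter> {x. x \<bullet> b < - real n}" A lborel] by (auto simp: fmeasurable_def top_unique)
  qed (auto simp: decseq_def)
  moreover have "(\<Inter>n. A \<inter> {x. x \<bullet> b < - real n}) = {}"
  proof -
    have "\<exists>n. \<not> x \<bullet> b < - real n" for x
      using reals_Archimedean2[of "- (x \<bullet> b)"] by (metis minus_less_iff not_less_iff_gr_or_eq)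
    then show ?thesis by blast
  qed
  ultimately have "(\<lambda>n. ?g (- real n)) \<longlonglongrightarrow> 0" by simp
  from order_tendstoD(2)[OF this m(1)] obtain n2 where n2: "?g (- real n2) < m"
    by (auto simp: eventually_sequentially)
  have "\<exists>t\<ge>- real n2. t \<le> real n1 \<and> ?g t = m"
    using n1 n2 isCont_measure_halfspace[OF A b] by (intro IVT) auto
  then show ?thesis by blast
qed

lemma measure_halfspace_split:
  fixes b :: "'a::euclidean_space"
  assumes A: "A \<in> fmeasurable lborel" and b: "b \<noteq> 0"
  shows "measure lborel (A \<inter> {x. x \<bullet> b < t}) + measure lborel (A \<inter> {x. t < x \<bullet> b}) = measure lborel A"
proof -
  have [measurable]: "A \<in> sets borel" using A by (simp add: fmeasurable_def)
  have "measure lborel A = measure lborel ((A \<inter> {x. x \<bullet> b < t}) \<union> (A \<inter> {x. t < x \<bullet> b}))"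
  proof -
    have ae: "AE x in lborel. x \<bullet> b \<noteq> t"
      using null_set_hyperplane[OF b, of t] by (rule AE_I') auto
    show ?thesis
    proof (rule measure_eq_AE)
      show "AE x in lborel. (x \<in> A) = (x \<in> (A \<inter> {x. x \<bullet> b < t}) \<union> (A \<inter> {x. t < x \<bullet> b}))"
        using ae by eventually_elim auto
    qed auto
  qed
  also have "\<dots> = measure lborel (A \<inter> {x. x \<bullet> b < t}) + measure lborel (A \<inter> {x. t < x \<bullet> b})"
    by (intro measure_Un_AE) (auto intro!: fmeasurable_Int_fmeasurable[OF A])
  finally show ?thesis by simp
qed

text \<open>Hadwiger-Ohmann induction on the total number of boxes. Since both measures carry the
  same factor \<open>w\<close>, a cut of both families in equal proportions changes \<open>w\<close>
  alone, and the bounds for the two halves add up without a further inequality.\<close>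

lemma Brunn_Minkowski_boxes:
  fixes \<X> \<Y> :: "'a::euclidean_space set set"
  assumes "boxes \<X>" "boxes \<Y>" "\<X> \<noteq> {}" "\<Y> \<noteq> {}" "0 < w" "0 < x" "0 < y"
    and "measure lborel (\<Union>\<X>) = w * x ^ DIM('a)" "measure lborel (\<Union>\<Y>) = w * y ^ DIM('a)"
    and "Z \<in> fmeasurable lborel" "\<Union>\<X> + \<Union>\<Y> \<subseteq> Z"
  shows "w * (x + y) ^ DIM('a) \<le> measure lborel Z"
  using assms
proof (induction "card \<X> + card \<Y>" arbitrary: \<X> \<Y> w x y Z rule: less_induct)
  case less
  let ?D = "DIM('a)"
  have step: "w * (x + y) ^ ?D \<le> measure lborel Z"
    if cd: "card \<X> + card \<Y> = n" "2 \<le> card \<X>"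
      and IH: "\<And>(\<X>' :: 'a set set) \<Y>' w Z. card \<X>' + card \<Y>' < n \<Longrightarrow> boxes \<X>' \<Longrightarrow> boxes \<Y>' \<Longrightarrow> \<X>' \<noteq> {} \<Longrightarrow> \<Y>' \<noteq> {} \<Longrightarrow> 0 < w
        \<Longrightarrow> measure lborel (\<Union>\<X>') = w * x ^ ?D \<Longrightarrow> measure lborel (\<Union>\<Y>') = w * y ^ ?D \<Longrightarrow> Z \<in> fmeasurable lborel
        \<Longrightarrow> \<Union>\<X>' + \<Union>\<Y>' \<subseteq> Z \<Longrightarrow> w * (x + y) ^ ?D \<le> measure lborel Z"
      and X: "boxes \<X>" and Y: "boxes \<Y>" and ne: "\<X> \<noteq> {}" "\<Y> \<noteq> {}" and w: "0 < w" "0 < x" "0 < y"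
      and mX: "measure lborel (\<Union>\<X>) = w * x ^ ?D" and mY: "measure lborel (\<Union>\<Y>) = w * y ^ ?D"
      and Z: "Z \<in> fmeasurable lborel" "\<Union>\<X> + \<Union>\<Y> \<subseteq> Z"
    for \<X> \<Y> :: "'a set set" and w x y :: real and Z n
  proof -
    obtain B1 B2 where B: "B1 \<in> \<X>" "B2 \<in> \<X>" "B1 \<noteq> B2"
      using cd(2) by (metis One_nat_def Suc_1 card_le_Suc0_iff_eq card.infinite not_less_eq_eq not_numeral_le_zero)
    \<comment> \<open>Two disjoint open boxes are separated along some coordinate; this hyperplane
      leaves a whole box of the family on either side.\<close>
    have "\<exists>b t C1 C2. b \<in> Basis \<and> C1 \<in> \<X> \<and> C2 \<in> \<X> \<and> C1 \<noteq> {} \<and> C2 \<noteq> {} \<and> C1 \<subseteq> {x. x \<bullet> b < t} \<and> C2 \<subseteq> {x. t < x \<bullet> b}"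
    proof -
      have bb: "B1 \<noteq> {}" "B2 \<noteq> {}" "B1 \<inter> B2 = {}"
        using X B unfolding boxes_def disjoint_def by auto
      obtain p q u v where pq: "B1 = box p q" "B2 = box u v" using X B unfolding boxes_def by metis
      have nn: "p \<bullet> i < q \<bullet> i" "u \<bullet> i < v \<bullet> i" if "i \<in> Basis" for i
        using bb pq that by (auto simp: box_ne_empty)
      obtain i where i: "i \<in> Basis" "q \<bullet> i \<le> u \<bullet> i \<or> v \<bullet> i \<le> p \<bullet> i"
        using bb(3) nn unfolding pq disjoint_interval(4) by (metis not_less)
      from i(2) show ?thesis
      proof
        assume "q \<bullet> i \<le> u \<bullet> i"
        then have "B1 \<subseteq> {x. x \<bullet> i < u \<bullet> i}" "B2 \<subseteq> {x. u \<bullet> i < x \<bullet> i}"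
          using i(1) pq by (force simp: mem_box)+
        then show ?thesis using B bb i(1) by blast
      next
        assume "v \<bullet> i \<le> p \<bullet> i"
        then have "B2 \<subseteq> {x. x \<bullet> i < p \<bullet> i}" "B1 \<subseteq> {x. p \<bullet> i < x \<bullet> i}"
          using i(1) pq by (force simp: mem_box)+
        then show ?thesis using B bb i(1) by blast
      qed
    qed
    then obtain b t C1 C2 where b: "b \<in> Basis" and C: "C1 \<in> \<X>" "C2 \<in> \<X>" "C1 \<noteq> {}" "C2 \<noteq> {}"
      "C1 \<subseteq> {x. x \<bullet> b < t}" "C2 \<subseteq> {x. t < x \<bullet> b}" by blast
    have b0: "b \<noteq> 0" using b by auto
    note fX = boxes_Union(2)[OF X] and fY = boxes_Union(2)[OF Y]
    define XL where "XL = (\<lambda>B. B \<inter> {x. x \<bullet> b < t}) ` \<X> - {{}}"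
    define XR where "XR = (\<lambda>B. B \<inter> {x. t < x \<bullet> b}) ` \<X> - {{}}"
    note L = boxes_Int[OF X box_Int_halfspace(1)[OF b, of _ _ t], folded XL_def]
    note R = boxes_Int[OF X box_Int_halfspace(2)[OF b, of _ _ t], folded XR_def]
    have cL: "card XL < card \<X>" by (rule L(4)[OF C(2)]) (use C(6) in auto)
    have cR: "card XR < card \<X>" by (rule R(4)[OF C(1)]) (use C(5) in auto)
    have neL: "XL \<noteq> {}" using C by (auto simp: XL_def)
    have neR: "XR \<noteq> {}" using C by (auto simp: XR_def)
    define m where "m = measure lborel (\<Union>XL) / measure lborel (\<Union>\<X>)"
    note sX = measure_halfspace_split[OF fX b0, of t]
    have pL: "measure lborel (\<Union>XL) > 0" "measure lborel (\<Union>XR) > 0"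
      using measure_boxes_pos L(1) R(1) neL neR by auto
    have pX: "measure lborel (\<Union>\<X>) > 0" using w mX by simp
    have m: "0 < m" "m < 1" using pL pX sX by (auto simp: m_def L(2) R(2))
    have mL: "measure lborel (\<Union>XL) = (w * m) * x ^ ?D"
    proof -
      have "measure lborel (\<Union>XL) = m * measure lborel (\<Union>\<X>)" using pX by (simp add: m_def)
      then show ?thesis by (simp add: mX)
    qed
    have mR: "measure lborel (\<Union>XR) = (w * (1 - m)) * x ^ ?D"
      using sX mL by (simp add: L(2) R(2) mX algebra_simps)
    have pY: "measure lborel (\<Union>\<Y>) > 0" using w mY by simp
    \<comment> \<open>The second family is cut parallel to the first and in the same ratio
      \<open>m\<close>. It may keep all its boxes, the decrease comes from the first family.\<close>
    have "\<exists>s. measure lborel (\<Union>\<Y> \<inter> {x. x \<bullet> b < s}) = m * measure lborel (\<Union>\<Y>)"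
      using m pY by (intro measure_halfspace_quantile[OF fY b0]) auto
    then obtain s where s: "measure lborel (\<Union>\<Y> \<inter> {x. x \<bullet> b < s}) = m * measure lborel (\<Union>\<Y>)" by blast
    define YL where "YL = (\<lambda>B. B \<inter> {x. x \<bullet> b < s}) ` \<Y> - {{}}"
    define YR where "YR = (\<lambda>B. B \<inter> {x. s < x \<bullet> b}) ` \<Y> - {{}}"
    note L' = boxes_Int[OF Y box_Int_halfspace(1)[OF b, of _ _ s], folded YL_def]
    note R' = boxes_Int[OF Y box_Int_halfspace(2)[OF b, of _ _ s], folded YR_def]
    have mL': "measure lborel (\<Union>YL) = (w * m) * y ^ ?D"
      using s by (simp add: L'(2) mY)
    have mR': "measure lborel (\<Union>YR) = (w * (1 - m)) * y ^ ?D"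
      using measure_halfspace_split[OF fY b0, of s] s by (simp add: R'(2) mY algebra_simps)
    have neL': "YL \<noteq> {}" using mL' m w by force
    have neR': "YR \<noteq> {}" using mR' m w by force
    \<comment> \<open>Sums of lower halves lie below \<open>t + s\<close>, sums of upper halves
      above it, so the two induction hypotheses bound disjoint parts of \<open>Z\<close>.\<close>
    let ?ZL = "Z \<inter> {x. x \<bullet> b < t + s}" and ?ZR = "Z \<inter> {x. t + s < x \<bullet> b}"
    have fZ: "?ZL \<in> fmeasurable lborel" "?ZR \<in> fmeasurable lborel"
      using Z(1) by (auto intro!: fmeasurable_Int_fmeasurable)
    have "(w * m) * (x + y) ^ ?D \<le> measure lborel ?ZL"
    proof (rule IH[OF _ L(1) L'(1) neL neL' _ mL mL' fZ(1)])
      show "card XL + card YL < n" using cL L'(3) cd by linarith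
      show "\<Union>XL + \<Union>YL \<subseteq> ?ZL"
      proof (rule subsetI, elim set_plus_elim)
        fix z p q assume "z = p + q" "p \<in> \<Union>XL" "q \<in> \<Union>YL"
        then have "z \<in> \<Union>\<X> + \<Union>\<Y>" "z \<bullet> b < t + s"
          unfolding L(2) L'(2) by (auto simp: inner_add_left simp del: Union_iff intro: add_strict_mono)
        then show "z \<in> ?ZL" using Z(2) by auto
      qed
    qed (use m w in auto)
    moreover have "(w * (1 - m)) * (x + y) ^ ?D \<le> measure lborel ?ZR"
    proof (rule IH[OF _ R(1) R'(1) neR neR' _ mR mR' fZ(2)])
      show "card XR + card YR < n" using cR R'(3) cd by linarith
      show "\<Union>XR + \<Union>YR \<subseteq> ?ZR"
      proof (rule subsetI, elim set_plus_elim)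
        fix z p q assume "z = p + q" "p \<in> \<Union>XR" "q \<in> \<Union>YR"
        then have "z \<in> \<Union>\<X> + \<Union>\<Y>" "t + s < z \<bullet> b"
          unfolding R(2) R'(2) by (auto simp: inner_add_left simp del: Union_iff intro: add_strict_mono)
        then show "z \<in> ?ZR" using Z(2) by auto
      qed
    qed (use m w in auto)
    ultimately show ?thesis
      using measure_halfspace_split[OF Z(1) b0, of "t + s"] by (simp add: algebra_simps)
  qed
  have cpos: "card \<X> \<ge> 1" "card \<Y> \<ge> 1"
    using less.prems by (auto simp: boxes_def Suc_le_eq card_gt_0_iff)
  consider "card \<X> \<ge> 2" | "card \<Y> \<ge> 2" | "card \<X> = 1" "card \<Y> = 1"
    using cpos by linarith
  then show ?case
  proof cases
    case 1
    show ?thesis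
    proof (rule step[OF refl 1 _ less.prems])
      fix \<X>' \<Y>' :: "'a set set" and w' :: real and Z'
      assume a: "card \<X>' + card \<Y>' < card \<X> + card \<Y>" "boxes \<X>'" "boxes \<Y>'" "\<X>' \<noteq> {}" "\<Y>' \<noteq> {}" "0 < w'"
        "measure lborel (\<Union>\<X>') = w' * x ^ ?D" "measure lborel (\<Union>\<Y>') = w' * y ^ ?D" "Z' \<in> fmeasurable lborel"
        "\<Union>\<X>' + \<Union>\<Y>' \<subseteq> Z'"
      show "w' * (x + y) ^ ?D \<le> measure lborel Z'"
        by (rule less.hyps[OF a(1-6) less.prems(6,7) a(7-10)])
    qed
  next
    case 2
    \<comment> \<open>The sum is symmetric, so the cutting argument applies with the families
      exchanged.\<close>
    have "w * (y + x) ^ ?D \<le> measure lborel Z"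
    proof (rule step[OF refl 2, of \<X>])
      fix \<X>' \<Y>' :: "'a set set" and w' :: real and Z'
      assume a: "card \<X>' + card \<Y>' < card \<Y> + card \<X>" "boxes \<X>'" "boxes \<Y>'" "\<X>' \<noteq> {}" "\<Y>' \<noteq> {}" "0 < w'"
        "measure lborel (\<Union>\<X>') = w' * y ^ ?D" "measure lborel (\<Union>\<Y>') = w' * x ^ ?D" "Z' \<in> fmeasurable lborel"
        "\<Union>\<X>' + \<Union>\<Y>' \<subseteq> Z'"
      have "w' * (x + y) ^ ?D \<le> measure lborel Z'"
        by (rule less.hyps[OF _ a(3,2,5,4,6) less.prems(6,7) a(8,7,9)])
          (use a(1,10) in \<open>simp_all add: add.commute\<close>)
      then show "w' * (y + x) ^ ?D \<le> measure lborel Z'" by (simp add: add.commute)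
    qed (use less.prems in \<open>simp_all add: add.commute\<close>)
    then show ?thesis by (simp add: add.commute)
  next
    case 3
    then obtain B C where BC: "\<X> = {B}" "\<Y> = {C}" by (meson card_1_singletonE)
    obtain a b where B: "B = box a b" "box a b \<noteq> {}" using less.prems(1) BC unfolding boxes_def by (metis singletonI)
    obtain c d where C: "C = box c d" "box c d \<noteq> {}" using less.prems(2) BC unfolding boxes_def by (metis singletonI)
    have lt: "a \<bullet> i < b \<bullet> i" "c \<bullet> i < d \<bullet> i" if "i \<in> Basis" for i
      using B C that by (auto simp: box_ne_empty)
    have "w * (x + y) ^ ?D \<le> (\<Prod>i\<in>Basis. (b - a) \<bullet> i + (d - c) \<bullet> i)"
      by (rule prod_add_power_ge)
         (use less.prems B C BC lt in \<open>auto simp: measure_lborel_box_eq inner_diff_left less_imp_le\<close>)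
    also have "\<dots> = measure lborel (box (a + c) (b + d))"
      using lt by (simp add: measure_lborel_box_eq inner_simps add_mono less_imp_le algebra_simps)
    also have "\<dots> \<le> measure lborel Z"
    proof (rule measure_mono_fmeasurable)
      show "box (a + c) (b + d) \<subseteq> Z"
        using box_sum_subset[OF B(2) C(2)] less.prems BC B C by auto
    qed (use less.prems in auto)
    finally show ?thesis .
  qed
qed

section \<open>From boxes to open sets and then to measurable sets\<close>

lemma open_approx_boxes:
  fixes U :: "'a::euclidean_space set"
  assumes "open U" and U: "U \<in> fmeasurable lborel" and c: "c < measure lborel U"
  shows "\<exists>\<X>. boxes \<X> \<and> \<Union>\<X> \<subseteq> U \<and> c < measure lborel (\<Union>\<X>)"
proof -
  obtain \<D> where D: "countable \<D>" "\<D> \<subseteq> Pow U" "\<And>X. X \<in> \<D> \<Longrightarrow> \<exists>a b. X = cbox a b" "\<Union>\<D> = U"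
    using open_countable_Union_open_cbox[OF \<open>open U\<close>] by blast
  show ?thesis
  proof (cases "\<D> = {}")
    case True
    then have "measure lborel U = 0" using D by auto
    then show ?thesis using c by (intro exI[of _ "{}"]) (auto simp: boxes_def)
  next
    case False
    define g where "g = from_nat_into \<D>"
    have g: "range g = \<D>" using D(1) False by (simp add: g_def range_from_nat_into)
    have cb: "\<exists>a b. g n = cbox a b" for n using D(3) g by blast
    have [measurable]: "g n \<in> sets borel" for n using cb[of n] by auto
    have "(\<lambda>n. measure lborel (\<Union>i\<le>n. g i)) \<longlonglongrightarrow> measure lborel (\<Union>n. \<Union>i\<le>n. g i)"
    proof (rule Lim_measure_incseq)
      have "(\<Union>n. \<Union>i\<le>n. g i) = U" using g D(4) by blast
      then show "emeasure lborel (\<Union>n. \<Union>i\<le>n. g i) \<noteq> \<infinity>"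
        using U by (auto simp: fmeasurable_def)
      show "range (\<lambda>n. \<Union>i\<le>n. g i) \<subseteq> sets lborel" by auto
      show "incseq (\<lambda>n. \<Union>i\<le>n. g i)" unfolding incseq_def by (intro allI impI UN_mono) auto
    qed
    moreover have "(\<Union>n. \<Union>i\<le>n. g i) = U" using g D(4) by blast
    ultimately have "(\<lambda>n. measure lborel (\<Union>i\<le>n. g i)) \<longlonglongrightarrow> measure lborel U" by simp
    from order_tendstoD(1)[OF this c] obtain n where n: "c < measure lborel (\<Union>i\<le>n. g i)"
      by (auto simp: eventually_sequentially)
    \<comment> \<open>Overlapping closed boxes are recut into a division; passing to interiors makes
      its cells disjoint and loses only null sets.\<close>
    obtain p where p: "p division_of (\<Union>(g ` {..n}))"
      using elementary_unions_intervals[of "g ` {..n}"] cb by blast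
    define \<X> where "\<X> = interior ` p - {{}}"
    have cbp: "\<exists>a b. K = cbox a b" if "K \<in> p" for K using division_ofD(4)[OF p that] by blast
    have "boxes \<X>"
      unfolding boxes_def
    proof (intro conjI)
      show "finite \<X>" using division_ofD(1)[OF p] by (simp add: \<X>_def)
      show "disjoint \<X>"
        using division_ofD(5)[OF p] by (auto simp: \<X>_def pairwise_def disjnt_def)
      show "\<forall>B\<in>\<X>. B \<noteq> {} \<and> (\<exists>c d. B = box c d)"
        using cbp by (force simp: \<X>_def)
    qed
    moreover have "\<Union>\<X> \<subseteq> U"
    proof -
      have "\<Union>\<X> \<subseteq> \<Union>p" using interior_subset by (auto simp: \<X>_def)
      also have "\<dots> \<subseteq> U" using division_ofD(6)[OF p] g D(4) by auto
      finally show ?thesis .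
    qed
    moreover have "measure lborel (\<Union>i\<le>n. g i) \<le> measure lborel (\<Union>\<X>)"
    proof -
      have N: "(\<Union>K\<in>p. K - interior K) \<in> null_sets lborel"
      proof (intro null_sets_UN' countable_finite)
        show "finite p" using division_ofD(1)[OF p] .
        fix K assume "K \<in> p"
        then obtain a b where "K = cbox a b" using cbp by blast
        then show "K - interior K \<in> null_sets lborel" using null_sets_cbox_Diff_box[of a b] by simp
      qed
      have "(\<Union>i\<le>n. g i) \<subseteq> \<Union>\<X> \<union> (\<Union>K\<in>p. K - interior K)"
        unfolding division_ofD(6)[OF p, symmetric] \<X>_def by blast
      then have "measure lborel (\<Union>i\<le>n. g i) \<le> measure lborel (\<Union>\<X> \<union> (\<Union>K\<in>p. K - interior K))"
        using boxes_Union(2)[OF \<open>boxes \<X>\<close>] N by (intro measure_mono_fmeasurable fmeasurable.Un) (auto intro: fmeasurableI_null_sets)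
      also have "\<dots> = measure lborel (\<Union>\<X>)"
        using N boxes_Union(2)[OF \<open>boxes \<X>\<close>] by (intro measure_Un_null_set) (auto simp: fmeasurable_def)
      finally show ?thesis .
    qed
    ultimately show ?thesis using n by (intro exI[of _ \<X>]) auto
  qed
qed

lemma Brunn_Minkowski_open:
  fixes X Y :: "'a::euclidean_space set"
  assumes X: "open X" "X \<in> fmeasurable lborel" "measure lborel X = w * x ^ DIM('a)"
    and Y: "open Y" "Y \<in> fmeasurable lborel" "measure lborel Y = w * y ^ DIM('a)"
    and w: "0 < w" "0 < x" "0 < y"
    and Z: "Z \<in> fmeasurable lborel" "X + Y \<subseteq> Z"
  shows "w * (x + y) ^ DIM('a) \<le> measure lborel Z"
proof -
  let ?d = "DIM('a)"
  have d: "?d > 0" by simp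
  have *: "w * (\<theta> * (x + y)) ^ ?d \<le> measure lborel Z" if \<theta>: "0 < \<theta>" "\<theta> < 1" for \<theta> :: real
  proof -
    have lt: "w * (\<theta> * u) ^ ?d < w * u ^ ?d" if "0 < u" for u
      using \<theta> that w by (intro mult_strict_left_mono power_strict_mono) auto
    obtain \<X> where bX: "boxes \<X>" "\<Union>\<X> \<subseteq> X" "w * (\<theta> * x) ^ ?d < measure lborel (\<Union>\<X>)"
      using open_approx_boxes[OF X(1,2), of "w * (\<theta> * x) ^ ?d"] lt[OF w(2)] X(3) by auto
    obtain \<Y> where bY: "boxes \<Y>" "\<Union>\<Y> \<subseteq> Y" "w * (\<theta> * y) ^ ?d < measure lborel (\<Union>\<Y>)"
      using open_approx_boxes[OF Y(1,2), of "w * (\<theta> * y) ^ ?d"] lt[OF w(3)] Y(3) by auto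
    have pos: "0 < \<theta> * x" "0 < \<theta> * y" using \<theta> w by auto
    obtain x' where x': "\<theta> * x < x'" "measure lborel (\<Union>\<X>) = w * x' ^ ?d" using ex_scaled_power[OF w(1) _ bX(3) d] pos by auto
    obtain y' where y': "\<theta> * y < y'" "measure lborel (\<Union>\<Y>) = w * y' ^ ?d" using ex_scaled_power[OF w(1) _ bY(3) d] pos by auto
    have "\<X> \<noteq> {}" "\<Y> \<noteq> {}" using x' y' pos w d by force+
    moreover have "\<Union>\<X> + \<Union>\<Y> \<subseteq> Z" using Z(2) set_plus_mono2[OF bX(2) bY(2)] by blast
    ultimately have "w * (x' + y') ^ ?d \<le> measure lborel Z"
      using bX bY x' y' w pos Z by (intro Brunn_Minkowski_boxes) auto
    moreover have "w * (\<theta> * (x + y)) ^ ?d \<le> w * (x' + y') ^ ?d"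
      using pos x' y' w by (intro mult_left_mono power_mono) (auto simp: algebra_simps)
    ultimately show ?thesis by linarith
  qed
  have "((\<lambda>\<theta>. w * (\<theta> * (x + y)) ^ ?d) \<longlongrightarrow> w * (1 * (x + y)) ^ ?d) (at_left 1)"
    by (intro tendsto_intros)
  moreover have "eventually (\<lambda>\<theta>. w * (\<theta> * (x + y)) ^ ?d \<le> measure lborel Z) (at_left 1)"
    using * by (auto simp: eventually_at_left_field intro!: exI[of _ 0])
  ultimately have "w * (1 * (x + y)) ^ ?d \<le> measure lborel Z"
    by (intro tendsto_upperbound) auto
  then show ?thesis by simp
qed

lemma open_plus_ball:
  fixes X :: "'a::real_normed_vector set"
  shows "open (X + ball 0 r)"
proof -
  have "X + ball 0 r = (\<Union>x\<in>X. ball x r)"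
    by (auto simp: set_plus_def dist_norm) (metis add_diff_cancel_left' add_diff_cancel_right' dist_norm mem_ball_0 minus_diff_eq norm_minus_cancel diff_add_cancel norm_minus_commute add.commute)
  then show ?thesis by auto
qed

text \<open>The asymmetric hypotheses fit the applications, where \<open>Y\<close> is a cap of a
  ball and \<open>X\<close> a piece of a merely measurable set. The factor \<theta> below 1 pays for
  the volume given up when \<open>Y\<close> is replaced by a compact part.\<close>

theorem Brunn_Minkowski:
  fixes X Y :: "'a::euclidean_space set"
  assumes X: "X \<in> fmeasurable lborel" "measure lborel X = w * x ^ DIM('a)"
    and Y: "open Y" "Y \<in> fmeasurable lborel" "measure lborel Y = w * y ^ DIM('a)"
    and w: "0 < w" "0 < x" "0 < y"
    and Z: "Z \<in> fmeasurable lborel" "X + Y \<subseteq> Z"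
  shows "w * (x + y) ^ DIM('a) \<le> measure lborel Z"
proof -
  let ?d = "DIM('a)"
  have root_le: "\<exists>v\<ge>u. m = w * v ^ ?d" if "w * u ^ ?d \<le> m" "0 \<le> u" for u m
    using ex_scaled_power[OF w(1) that(2), of ?d m] that by (cases "w * u ^ ?d = m") (auto intro: less_imp_le)
  have *: "w * (x + \<theta> * y) ^ ?d \<le> measure lborel Z" if \<theta>: "0 < \<theta>" "\<theta> < 1" for \<theta> :: real
  proof -
    have "w * (\<theta> * y) ^ ?d < w * y ^ ?d"
      using \<theta> w by (intro mult_strict_left_mono power_strict_mono) auto
    then obtain \<Y> where bY: "boxes \<Y>" "\<Union>\<Y> \<subseteq> Y" "w * (\<theta> * y) ^ ?d < measure lborel (\<Union>\<Y>)"
      using open_approx_boxes[OF Y(1,2), of "w * (\<theta> * y) ^ ?d"] Y(3) by auto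
    \<comment> \<open>Shrinking the boxes leaves room for a ball, which turns X into an open set.\<close>
    obtain T where T: "closed T" "T \<subseteq> \<Union>\<Y>" "\<Union>\<Y> - T \<in> lmeasurable"
      "emeasure lebesgue (\<Union>\<Y> - T) < ennreal (measure lborel (\<Union>\<Y>) - w * (\<theta> * y) ^ ?d)"
      by (rule sets_lebesgue_inner_closed[of "\<Union>\<Y>" "measure lborel (\<Union>\<Y>) - w * (\<theta> * y) ^ ?d"])
         (use boxes_Union[OF bY(1)] bY(3) in auto)
    have bdd: "bounded (\<Union>\<Y>)"
      using bY(1) unfolding boxes_def by (intro bounded_Union ballI) (metis bounded_box)+
    then have cT: "compact T" using T(1,2) bounded_subset compact_eq_bounded_closed by blast
    obtain \<epsilon> where e: "0 < \<epsilon>" "(\<Union>v\<in>T. cball v \<epsilon>) \<subseteq> \<Union>\<Y>"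
      by (rule compact_subset_open_imp_cball_epsilon_subset[OF cT boxes_Union(1)[OF bY(1)] T(2)])
    have mT: "w * (\<theta> * y) ^ ?d < measure lborel T"
    proof -
      have bT: "T \<in> sets borel" using T(1) by auto
      have bU: "\<Union>\<Y> \<in> sets borel" using boxes_Union(1)[OF bY(1)] by auto
      have UT: "\<Union>\<Y> - T \<in> fmeasurable lborel" using boxes_Union(2)[OF bY(1)] bT by (intro fmeasurable_Diff) auto
      have "emeasure lborel (\<Union>\<Y> - T) < ennreal (measure lborel (\<Union>\<Y>) - w * (\<theta> * y) ^ ?d)"
        using T(4) bT bU by simp
      then have "measure lborel (\<Union>\<Y> - T) < measure lborel (\<Union>\<Y>) - w * (\<theta> * y) ^ ?d"
        using UT bY(3) by (simp add: emeasure_eq_measure2 ennreal_less_iff)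
      then show ?thesis
        using measurable_measure_Diff[of "\<Union>\<Y>" lborel T] boxes_Union(2)[OF bY(1)] bT T(2) by auto
    qed
    let ?X = "X + ball 0 (\<epsilon>/2)" and ?Y = "T + ball 0 (\<epsilon>/2)"
    have sub: "?X + ?Y \<subseteq> Z"
    proof -
      have "?Y + ball 0 (\<epsilon>/2) \<subseteq> \<Union>\<Y>"
      proof (rule subsetI, elim set_plus_elim)
        fix z p c a b :: 'a
        assume z: "z = p + c" "c \<in> ball 0 (\<epsilon>/2)" "p = a + b" "a \<in> T" "b \<in> ball 0 (\<epsilon>/2)"
        then have a: "a \<in> T" "norm b * 2 < \<epsilon>" "norm c * 2 < \<epsilon>" by auto
        have "norm (b + c) \<le> norm b + norm c" by (rule norm_triangle_ineq)
        then have "a + b + c \<in> cball a \<epsilon>" using a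
          by (simp only: mem_cball dist_commute[of a]) (simp add: dist_norm add.assoc)
        then show "z \<in> \<Union>\<Y>" using a e z by blast
      qed
      then have "X + (?Y + ball 0 (\<epsilon>/2)) \<subseteq> X + Y" using bY(2) by (intro set_plus_mono2) auto
      then show ?thesis using Z(2) by (simp add: add_ac)
    qed
    have half: "0 < \<epsilon> / 2" using e by simp
    have "0 \<le> w * (\<theta> * y) ^ ?d" using w \<theta> by simp
    then have ne: "X \<noteq> {}" "T \<noteq> {}" using X(2) mT w by auto
    \<comment> \<open>A translate of \<open>?X\<close> by a point of \<open>?Y\<close> lies in
      \<open>Z\<close>, and this is where finiteness of its measure comes from.\<close>
    have fin: "?X \<in> fmeasurable lborel"
    proof -
      obtain t where t: "t \<in> ?Y" using ne half by (metis set_plus_intro centre_in_ball ex_in_conv)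
      have "(\<lambda>z. z + t) ` ?X \<subseteq> Z" using sub t by (auto intro: set_plus_intro)
      then have "?X \<subseteq> (\<lambda>z. z + t) -` Z" by auto
      moreover have "(\<lambda>z. z + t) -` Z \<in> fmeasurable lborel"
      proof -
        have Zb[measurable]: "Z \<in> sets borel" using Z by (simp add: fmeasurable_def)
        have "emeasure lborel ((\<lambda>z. z + t) -` Z) = emeasure (distr lborel borel ((+) t)) Z"
          by (subst emeasure_distr) (auto simp: vimage_def add.commute)
        moreover have "(\<lambda>z. z + t) -` Z \<in> sets borel"
          using measurable_sets[of "\<lambda>z. z + t" borel borel Z] by simp
        ultimately show ?thesis using Z by (auto simp: fmeasurable_def lborel_distr_plus)
      qed
      moreover have "?X \<in> sets lborel" by (simp add: open_plus_ball borel_open)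
      ultimately show ?thesis by (metis fmeasurableI2)
    qed
    have fin': "?Y \<in> fmeasurable lborel"
    proof -
      have "?Y \<subseteq> \<Union>\<Y>"
      proof (rule subsetI, elim set_plus_elim)
        fix z a b :: 'a
        assume z: "z = a + b" "a \<in> T" "b \<in> ball 0 (\<epsilon>/2)"
        then have "z \<in> cball a \<epsilon>" using half by (simp add: dist_norm)
        then show "z \<in> \<Union>\<Y>" using z e by blast
      qed
      moreover have "?Y \<in> sets lborel" by (simp add: open_plus_ball borel_open)
      ultimately show ?thesis by (rule fmeasurableI2[OF boxes_Union(2)[OF bY(1)]])
    qed
    have "X \<subseteq> ?X"
    proof
      fix z assume "z \<in> X"
      then have "z + 0 \<in> ?X" using half by (intro set_plus_intro) auto
      then show "z \<in> ?X" by simp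
    qed
    then have "w * x ^ ?d \<le> measure lborel ?X"
      using X fin by (metis fmeasurableD measure_mono_fmeasurable)
    then obtain x' where x': "x \<le> x'" "measure lborel ?X = w * x' ^ ?d" using root_le w by (metis less_imp_le)
    have "T \<subseteq> ?Y"
    proof
      fix z assume "z \<in> T"
      then have "z + 0 \<in> ?Y" using half by (intro set_plus_intro) auto
      then show "z \<in> ?Y" by simp
    qed
    then have "w * (\<theta> * y) ^ ?d \<le> measure lborel ?Y"
      using mT fin' fmeasurable_compact[OF cT] by (meson fmeasurableD less_imp_le measure_mono_fmeasurable order_trans)
    moreover have "0 \<le> \<theta> * y" using w \<theta> by simp
    ultimately obtain y' where y': "\<theta> * y \<le> y'" "measure lborel ?Y = w * y' ^ ?d" using root_le by metis
    have "0 < \<theta> * y" using w \<theta> by simp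
    then have "w * (x' + y') ^ ?d \<le> measure lborel Z"
      using x' y' w by (intro Brunn_Minkowski_open[OF open_plus_ball fin x'(2) open_plus_ball fin' y'(2) _ _ _ Z(1) sub]) auto
    moreover have "w * (x + \<theta> * y) ^ ?d \<le> w * (x' + y') ^ ?d"
      using x' y' w \<theta> by (intro mult_left_mono power_mono) auto
    ultimately show ?thesis by linarith
  qed
  have "((\<lambda>\<theta>. w * (x + \<theta> * y) ^ ?d) \<longlongrightarrow> w * (x + 1 * y) ^ ?d) (at_left 1)"
    by (intro tendsto_intros)
  moreover have "eventually (\<lambda>\<theta>. w * (x + \<theta> * y) ^ ?d \<le> measure lborel Z) (at_left 1)"
    using * by (auto simp: eventually_at_left_field intro!: exI[of _ 0])
  ultimately have "w * (x + 1 * y) ^ ?d \<le> measure lborel Z"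
    by (intro tendsto_upperbound) auto
  then show ?thesis by simp
qed

section \<open>Lipschitz images and isometries\<close>

text \<open>Vitali's covering theorem recast as a sequence; spare indices get radius 0, hence an
  empty ball. Balls are the right pieces for transporting measure, since Lipschitz maps and
  isometries are easy to control on them.\<close>

lemma open_Vitali_balls:
  fixes U :: "'a::euclidean_space set"
  assumes "open U"
  obtains c :: "nat \<Rightarrow> 'a" and r :: "nat \<Rightarrow> real"
  where "\<forall>n. 0 \<le> r n" "\<forall>n. ball (c n) (r n) \<subseteq> U" "disjoint_family (\<lambda>n. ball (c n) (r n))"
    "U - (\<Union>n. ball (c n) (r n)) \<in> null_sets lborel"
proof -
  define K where "K = {i :: 'a \<times> real. 0 < snd i \<and> ball (fst i) (snd i) \<subseteq> U}"
  obtain C where C: "countable C" "C \<subseteq> K" "pairwise (\<lambda>i j. disjnt (ball (fst i) (snd i)) (ball (fst j) (snd j))) C"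
    "negligible (U - (\<Union>i\<in>C. ball (fst i) (snd i)))"
  proof (rule Vitali_covering_theorem_balls[of U K fst snd])
    fix x and e :: real assume x: "x \<in> U" "0 < e"
    then obtain r where r: "0 < r" "ball x r \<subseteq> U" using assms openE by blast
    then have "(x, min r (e / 2)) \<in> K" using x by (auto simp: K_def)
    then show "\<exists>i. i \<in> K \<and> x \<in> ball (fst i) (snd i) \<and> snd i < e"
      using r x by (intro exI[of _ "(x, min r (e / 2))"]) auto
  qed
  let ?I = "to_nat_on C ` C"
  define c where "c n = fst (from_nat_into C n)" for n
  define r where "r n = (if n \<in> ?I then snd (from_nat_into C n) else 0)" for n
  have mem: "from_nat_into C n \<in> C" if "n \<in> ?I" for n using that C(1) by auto
  have inj: "from_nat_into C m \<noteq> from_nat_into C n" if "m \<in> ?I" "n \<in> ?I" "m \<noteq> n" for m n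
    using that C(1) by auto
  have UN: "(\<Union>n. ball (c n) (r n)) = (\<Union>i\<in>C. ball (fst i) (snd i))"
  proof
    show "(\<Union>n. ball (c n) (r n)) \<subseteq> (\<Union>i\<in>C. ball (fst i) (snd i))"
    proof (rule UN_least)
      fix n show "ball (c n) (r n) \<subseteq> (\<Union>i\<in>C. ball (fst i) (snd i))"
      proof (cases "n \<in> ?I")
        case True
        then have "ball (c n) (r n) = ball (fst (from_nat_into C n)) (snd (from_nat_into C n))" by (simp add: c_def r_def)
        then show ?thesis using mem[OF True] by blast
      qed (simp add: r_def)
    qed
    show "(\<Union>i\<in>C. ball (fst i) (snd i)) \<subseteq> (\<Union>n. ball (c n) (r n))"
    proof (rule UN_least)
      fix i assume i: "i \<in> C"
      then have "ball (c (to_nat_on C i)) (r (to_nat_on C i)) = ball (fst i) (snd i)"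
        using C(1) by (simp add: c_def r_def)
      then show "ball (fst i) (snd i) \<subseteq> (\<Union>n. ball (c n) (r n))" by blast
    qed
  qed
  show thesis
  proof
    have "0 \<le> r n" for n
    proof (cases "n \<in> ?I")
      case True
      then have "from_nat_into C n \<in> K" using mem C(2) by blast
      then show ?thesis using True by (simp add: r_def K_def)
    qed (simp add: r_def)
    then show "\<forall>n. 0 \<le> r n" ..
    have "ball (fst i) (snd i) \<subseteq> U" if "i \<in> C" for i using that C(2) by (auto simp: K_def)
    then have "(\<Union>n. ball (c n) (r n)) \<subseteq> U" unfolding UN by blast
    then show "\<forall>n. ball (c n) (r n) \<subseteq> U" by blast
    show "disjoint_family (\<lambda>n. ball (c n) (r n))"
      unfolding disjoint_family_on_def
    proof (intro ballI impI)
      fix m n :: nat assume "m \<noteq> n"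
      show "ball (c m) (r m) \<inter> ball (c n) (r n) = {}"
      proof (cases "m \<in> ?I \<and> n \<in> ?I")
        case True
        then show ?thesis
          using pairwiseD[OF C(3) mem[of m] mem[of n]] inj[of m n] \<open>m \<noteq> n\<close> unfolding c_def r_def disjnt_def by simp
      qed (auto simp: r_def)
    qed
    have "open (\<Union>i\<in>C. ball (fst i) (snd i))" by auto
    then have "U - (\<Union>i\<in>C. ball (fst i) (snd i)) \<in> sets lborel"
      using assms by (intro sets.Diff) auto
    then show "U - (\<Union>n. ball (c n) (r n)) \<in> null_sets lborel"
      using C(4) by (simp add: UN negligible_iff_null_sets null_sets_completion_iff)
  qed
qed

lemma emeasure_ball_scale:
  fixes c d :: "'a::euclidean_space"
  assumes "0 \<le> r" "0 \<le> s"
  shows "emeasure lborel (ball c (s * r)) = ennreal (s ^ DIM('a)) * emeasure lborel (ball d r)"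
  using assms by (simp add: emeasure_ball power_mult_distrib ennreal_mult'[symmetric] mult_ac)

text \<open>Two points in a ball of radius \<open>r\<close> are less than \<open>2 * r\<close>
  apart, so the part of \<open>T\<close> in it is mapped into a ball of radius
  \<open>(2 * L + 1) * r\<close> about the image of one of its points; the extra 1 gives the strict
  inequality an open ball asks for. The Borel set \<open>Q\<close> stands in for the image of
  \<open>T\<close>, which need not be Borel.\<close>

lemma emeasure_Lipschitz_image_le:
  fixes f :: "'a::euclidean_space \<Rightarrow> 'a"
  assumes T: "T \<in> sets borel" and Q: "Q \<in> sets borel" "Q \<subseteq> f ` T"
    and L: "0 \<le> L" "\<And>x y. x \<in> T \<Longrightarrow> y \<in> T \<Longrightarrow> dist (f x) (f y) \<le> L * dist x y"
  shows "emeasure lborel Q \<le> ennreal ((2 * L + 1) ^ DIM('a)) * emeasure lborel T"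
proof -
  let ?c = "ennreal ((2 * L + 1) ^ DIM('a))"
  have *: "emeasure lborel Q \<le> ?c * emeasure lborel U" if U: "open U" "T \<subseteq> U" for U
  proof -
    obtain c :: "nat \<Rightarrow> 'a" and r where C: "\<forall>n. 0 \<le> r n" "\<forall>n. ball (c n) (r n) \<subseteq> U" "disjoint_family (\<lambda>n. ball (c n) (r n))"
      "U - (\<Union>n. ball (c n) (r n)) \<in> null_sets lborel"
      by (rule open_Vitali_balls[OF U(1)])
    let ?N = "U - (\<Union>n. ball (c n) (r n))"
    have "negligible (f ` (T \<inter> ?N))"
    proof (rule negligible_locally_Lipschitz_image)
      show "negligible (T \<inter> ?N)"
        using C(4) by (intro negligible_Int) (auto simp: negligible_iff_null_sets null_sets_completionI)
      fix x assume "x \<in> T \<inter> ?N"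
      then show "\<exists>V B. open V \<and> x \<in> V \<and> (\<forall>y\<in>T \<inter> ?N \<inter> V. norm (f y - f x) \<le> B * norm (y - x))"
        using L(2) by (intro exI[of _ UNIV] exI[of _ L]) (auto simp: dist_norm)
    qed simp
    then obtain N where N: "N \<in> null_sets lborel" "f ` (T \<inter> ?N) \<subseteq> N"
      by (auto simp: negligible_iff_null_sets null_sets_completion_iff2)
    define B where "B n = (if T \<inter> ball (c n) (r n) = {} then {}
      else ball (f (SOME x. x \<in> T \<inter> ball (c n) (r n))) ((2 * L + 1) * r n))" for n
    have B: "f ` (T \<inter> ball (c n) (r n)) \<subseteq> B n" for n
    proof
      fix z assume "z \<in> f ` (T \<inter> ball (c n) (r n))"
      then obtain y where y: "y \<in> T" "y \<in> ball (c n) (r n)" "z = f y" by auto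
      let ?x = "SOME x. x \<in> T \<inter> ball (c n) (r n)"
      have x: "?x \<in> T \<inter> ball (c n) (r n)" by (rule someI[of _ y]) (use y in auto)
      have "0 < r n" using y(2) by (auto intro: le_less_trans[OF zero_le_dist])
      have "dist (f ?x) (f y) \<le> L * dist ?x y" using x y by (intro L) auto
      also have "dist ?x y < 2 * r n"
        using x y(2) dist_triangle2[of ?x y "c n"] by (auto simp: dist_commute)
      then have "L * dist ?x y \<le> L * (2 * r n)" using L(1) by (intro mult_left_mono) auto
      also have "\<dots> < (2 * L + 1) * r n" using \<open>0 < r n\<close> by (simp add: algebra_simps)
      finally show "z \<in> B n" using x y by (auto simp: B_def)
    qed
    have Bm: "range B \<subseteq> sets lborel" by (auto simp: B_def)
    have UB: "(\<Union>n. B n) \<in> sets lborel" using Bm by auto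
    have "Q \<subseteq> (\<Union>n. B n) \<union> N"
    proof
      fix z assume "z \<in> Q"
      then obtain x where x: "x \<in> T" "z = f x" using Q(2) by auto
      show "z \<in> (\<Union>n. B n) \<union> N"
      proof (cases "x \<in> ?N")
        case True then show ?thesis using x N(2) by blast
      next
        case False
        then obtain n where "x \<in> ball (c n) (r n)" using x U(2) by auto
        then show ?thesis using B[of n] x by blast
      qed
    qed
    then have "emeasure lborel Q \<le> emeasure lborel ((\<Union>n. B n) \<union> N)"
      using N(1) UB by (intro emeasure_mono sets.Un) auto
    also have "\<dots> = emeasure lborel (\<Union>n. B n)"
      using N(1) UB by (intro emeasure_Un_null_set)
    also have "\<dots> \<le> (\<Sum>n. emeasure lborel (B n))"
      using Bm by (rule emeasure_subadditive_countably)
    also have "\<dots> \<le> (\<Sum>n. ?c * emeasure lborel (ball (c n) (r n)))"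
    proof (rule suminf_le)
      fix n
      show "emeasure lborel (B n) \<le> ?c * emeasure lborel (ball (c n) (r n))"
        using L(1) C(1) emeasure_ball_scale[of "r n" "2 * L + 1" _ "c n"] by (auto simp: B_def)
    qed auto
    also have "\<dots> = ?c * (\<Sum>n. emeasure lborel (ball (c n) (r n)))" by simp
    also have "(\<Sum>n. emeasure lborel (ball (c n) (r n))) = emeasure lborel (\<Union>n. ball (c n) (r n))"
      using C(3) by (intro suminf_emeasure) auto
    also have "\<dots> \<le> emeasure lborel U" using C U by (intro emeasure_mono) auto
    finally show ?thesis by (simp add: mult_left_mono)
  qed
  show ?thesis
  proof (cases "emeasure lborel T = \<infinity>")
    case True
    then show ?thesis using L(1) by (simp add: ennreal_mult_top)
  next
    case False
    have eps: "emeasure lborel Q \<le> ?c * emeasure lborel T + ?c * ennreal e" if e: "e > 0" for e :: real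
    proof -
      obtain U where U: "open U" "T \<subseteq> U" "emeasure lborel (U - T) < e"
        using outer_regular_lborel[of T e] T e by auto
      have "emeasure lborel U \<le> emeasure lborel (T \<union> (U - T))"
        using T U by (intro emeasure_mono) auto
      also have "\<dots> \<le> emeasure lborel T + emeasure lborel (U - T)"
        using T U by (intro emeasure_subadditive) auto
      also have "\<dots> \<le> emeasure lborel T + e" using U by (intro add_left_mono) auto
      finally have "?c * emeasure lborel U \<le> ?c * (emeasure lborel T + e)" by (rule mult_left_mono) auto
      then show ?thesis using *[OF U(1,2)] by (simp add: distrib_left)
    qed
    have "emeasure lborel Q \<le> ?c * emeasure lborel T + e" if "e > 0" for e :: real
    proof -
      let ?k = "(2 * L + 1) ^ DIM('a)"
      have k: "?k > 0" using L(1) by simp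
      have "emeasure lborel Q \<le> ?c * emeasure lborel T + ?c * ennreal (e / ?k)"
        using that k by (intro eps) auto
      also have "?c * ennreal (e / ?k) = ennreal e"
        using k that L(1) by (simp add: ennreal_mult[symmetric])
      finally show ?thesis .
    qed
    then show ?thesis by (rule ennreal_le_epsilon)
  qed
qed

text \<open>Linearity of \<open>f\<close> is never derived: a box is a disjoint union of balls up to
  a null set, balls go to balls of the same radius, and null sets to null sets by the Lipschitz
  bound. Being an involution identifies preimages with images; both reflections and
  \<open>uminus\<close> are of this kind.\<close>

lemma distr_lborel_isometry:
  fixes f :: "'a::euclidean_space \<Rightarrow> 'a"
  assumes iso: "\<And>x y. dist (f x) (f y) = dist x y" and inv: "\<And>x. f (f x) = x"
  shows "distr lborel borel f = lborel"
proof (rule lborel_eqI[symmetric])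
  have "continuous_on UNIV f"
    unfolding continuous_on_iff using iso by metis
  then have fm[measurable]: "f \<in> borel_measurable borel" by (rule borel_measurable_continuous_onI)
  have vim: "f -` S = f ` S" for S
    using inv by (auto simp: image_iff) (metis inv)
  have ball: "f ` ball c r = ball (f c) r" for c r
    using iso inv unfolding vim[symmetric] by (auto simp: vimage_def) (metis iso inv)+
  fix l u :: 'a assume "\<And>b. b \<in> Basis \<Longrightarrow> l \<bullet> b \<le> u \<bullet> b"
  then have m: "emeasure lborel (box l u) = (\<Prod>b\<in>Basis. (u - l) \<bullet> b)" by simp
  obtain c :: "nat \<Rightarrow> 'a" and r where C: "\<forall>n. 0 \<le> r n" "\<forall>n. ball (c n) (r n) \<subseteq> box l u" "disjoint_family (\<lambda>n. ball (c n) (r n))"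
    "box l u - (\<Union>n. ball (c n) (r n)) \<in> null_sets lborel" (is "?N \<in> _")
    by (rule open_Vitali_balls[OF open_box[of l u]])
  have Nm[measurable]: "?N \<in> sets borel" using C(4) by (auto simp: null_sets_def)
  have N: "f ` ?N \<in> null_sets lborel"
  proof -
    have "emeasure lborel (f ` ?N) \<le> ennreal ((2 * 1 + 1) ^ DIM('a)) * emeasure lborel ?N"
    proof (rule emeasure_Lipschitz_image_le)
      show "f ` ?N \<in> sets borel" unfolding vim[symmetric] using measurable_sets[OF fm Nm] by simp
    qed (use iso in auto)
    also have "\<dots> = 0" using C(4) by (simp add: null_sets_def)
    finally have "emeasure lborel (f ` ?N) = 0" by simp
    moreover have "f ` ?N \<in> sets lborel" unfolding vim[symmetric] using measurable_sets[OF fm Nm] by simp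
    ultimately show ?thesis by (simp add: null_sets_def)
  qed
  have sp: "box l u = (\<Union>n. ball (c n) (r n)) \<union> ?N" using C(2) by auto
  have "emeasure (distr lborel borel f) (box l u) = emeasure lborel (f ` box l u)"
    by (simp add: emeasure_distr vim)
  also have "f ` box l u = (\<Union>n. ball (f (c n)) (r n)) \<union> f ` ?N"
    by (subst sp) (simp only: image_Un image_UN ball)
  also have "emeasure lborel \<dots> = emeasure lborel (\<Union>n. ball (f (c n)) (r n))"
    using N by (intro emeasure_Un_null_set) auto
  also have "\<dots> = (\<Sum>n. emeasure lborel (ball (f (c n)) (r n)))"
  proof (rule suminf_emeasure[symmetric])
    have "inj f" by (metis inv injI)
    then show "disjoint_family (\<lambda>n. ball (f (c n)) (r n))"
      using C(3) unfolding disjoint_family_on_def ball[symmetric] by (simp add: image_Int[symmetric])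
  qed auto
  also have "\<dots> = (\<Sum>n. emeasure lborel (ball (c n) (r n)))"
    using C(1) by (simp add: emeasure_ball)
  also have "\<dots> = emeasure lborel (\<Union>n. ball (c n) (r n))"
    using C(3) by (intro suminf_emeasure) auto
  also have "\<dots> = emeasure lborel ((\<Union>n. ball (c n) (r n)) \<union> ?N)"
    using C(4) by (intro emeasure_Un_null_set[symmetric]) auto
  finally show "emeasure (distr lborel borel f) (box l u) = (\<Prod>b\<in>Basis. (u - l) \<bullet> b)"
    using sp m by simp
qed simp

section \<open>Polarization and the Riesz rearrangement inequality\<close>

lemma inner_add_scaleR_self:
  fixes w v :: "'a::real_inner"
  shows "(w + k *\<^sub>R v) \<bullet> (w + k *\<^sub>R v) = w \<bullet> w + k * (2 * (w \<bullet> v) + k * (v \<bullet> v))"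
  by (simp add: inner_add_left inner_add_right inner_commute algebra_simps)

text \<open>Reflection in the perpendicular bisector of 0 and \<open>v\<close>, so it exchanges
  these two points. Taking the image of the origin as parameter indexes the reflections by a
  Euclidean space, over which one can average.\<close>

definition flip :: "'a::euclidean_space \<Rightarrow> 'a \<Rightarrow> 'a" where
  "flip v x = x - ((2 * (x \<bullet> v) - v \<bullet> v) / (v \<bullet> v)) *\<^sub>R v"

definition near0 :: "'a::euclidean_space \<Rightarrow> 'a set" where
  "near0 v = {x. 2 * (x \<bullet> v) < v \<bullet> v}"

lemma inner_flip: "v \<noteq> 0 \<Longrightarrow> flip v x \<bullet> v = v \<bullet> v - x \<bullet> v"
  by (simp add: flip_def inner_diff_left)

lemma flip_flip [simp]: "flip v (flip v x) = x"
proof (cases "v = 0")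
  case False
  have "(2 * (flip v x \<bullet> v) - v \<bullet> v) / (v \<bullet> v) = - ((2 * (x \<bullet> v) - v \<bullet> v) / (v \<bullet> v))"
    using False by (simp add: inner_flip diff_divide_distrib)
  then show ?thesis by (simp only: flip_def[of v "flip v x"]) (simp add: flip_def)
qed (simp add: flip_def)

lemma dist_flip [simp]: "dist (flip v x) (flip v y) = dist x y"
proof (cases "v = 0")
  case False
  let ?w = "x - y"
  have vv: "v \<bullet> v \<noteq> 0" using False by simp
  define k where "k = - 2 * (?w \<bullet> v) / (v \<bullet> v)"
  have eq: "flip v x - flip v y = ?w + k *\<^sub>R v"
    unfolding k_def flip_def inner_diff_left scaleR_left_distrib[symmetric]
    by (simp add: diff_divide_distrib algebra_simps)
  have k: "k * (v \<bullet> v) = - 2 * (?w \<bullet> v)" using vv by (simp add: k_def)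
  have "(?w + k *\<^sub>R v) \<bullet> (?w + k *\<^sub>R v) = ?w \<bullet> ?w"
    unfolding inner_add_scaleR_self k by simp
  then have "norm (flip v x - flip v y) = norm ?w"
    unfolding eq by (simp add: norm_eq_sqrt_inner)
  then show ?thesis by (simp add: dist_norm)
qed (simp add: flip_def)

lemma norm_flip: "v \<noteq> 0 \<Longrightarrow> norm (flip v x) = norm (x - v)"
  using dist_flip[of v x v] by (simp add: dist_norm flip_def)

lemma near0_iff: "x \<in> near0 v \<longleftrightarrow> norm x < norm (x - v)"
proof -
  have "norm x < norm (x - v) \<longleftrightarrow> x \<bullet> x < (x - v) \<bullet> (x - v)"
    by (simp add: norm_lt)
  also have "\<dots> \<longleftrightarrow> 2 * (x \<bullet> v) < v \<bullet> v"
    by (simp add: inner_diff_left inner_diff_right inner_commute)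
  finally show ?thesis by (simp add: near0_def)
qed

lemma flip_near0: "v \<noteq> 0 \<Longrightarrow> flip v x \<in> near0 v \<longleftrightarrow> v \<bullet> v < 2 * (x \<bullet> v)"
  by (auto simp: near0_def inner_flip)

text \<open>Reflecting one of two points of the same half-space can only increase their distance.
  With a decreasing kernel this is the whole geometric input of the energy inequality for
  polarizations.\<close>

lemma dist_le_dist_flip:
  assumes "x \<in> near0 v" "y \<in> near0 v"
  shows "norm (x - y) \<le> norm (x - flip v y)"
proof (cases "v = 0")
  case False
  define k where "k = (2 * (y \<bullet> v) - v \<bullet> v) / (v \<bullet> v)"
  have vv: "v \<bullet> v > 0" using False by simp
  have k: "k * (v \<bullet> v) = 2 * (y \<bullet> v) - v \<bullet> v" "k \<le> 0"
    using assms vv by (auto simp: k_def near0_def field_simps)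
  have eq: "x - flip v y = (x - y) + k *\<^sub>R v" by (simp add: flip_def k_def)
  have "(x - flip v y) \<bullet> (x - flip v y) = (x - y) \<bullet> (x - y) + k * (2 * (x \<bullet> v) - 2 * (y \<bullet> v) + k * (v \<bullet> v))"
    unfolding eq inner_add_scaleR_self by (simp add: inner_diff_left)
  also have "\<dots> = (x - y) \<bullet> (x - y) + k * (2 * (x \<bullet> v) - v \<bullet> v)" unfolding k by simp
  also have "\<dots> \<ge> (x - y) \<bullet> (x - y)"
    using k(2) assms(1) by (simp add: near0_def mult_nonpos_nonpos)
  finally show ?thesis by (simp add: norm_le)
qed (use assms in \<open>simp add: near0_def\<close>)

lemma measurable_flip [measurable]: "flip v \<in> borel_measurable borel"
  unfolding flip_def[abs_def] by measurable

lemma measurable_flip2 [measurable]: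
  assumes [measurable]: "f \<in> borel_measurable M" "g \<in> borel_measurable M"
  shows "(\<lambda>x. flip (f x) (g x)) \<in> borel_measurable M"
  unfolding flip_def by measurable

lemma near0_sets [measurable]: "near0 v \<in> sets borel"
  unfolding near0_def by measurable

lemma distr_flip: "distr lborel borel (flip v) = lborel"
  by (rule distr_lborel_isometry) auto

lemma nn_integral_flip:
  assumes [measurable]: "f \<in> borel_measurable borel"
  shows "(\<integral>\<^sup>+x. f (flip v x) \<partial>lborel) = (\<integral>\<^sup>+x. f x \<partial>lborel)"
  by (subst (2) distr_flip[of v, symmetric]) (simp add: nn_integral_distr)

lemma AE_hyperplane:
  fixes v :: "'a::euclidean_space"
  assumes "v \<noteq> 0"
  shows "AE x in lborel. 2 * (x \<bullet> v) \<noteq> v \<bullet> v"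
proof -
  have "{x. v \<bullet> x = (v \<bullet> v) / 2} \<in> null_sets lebesgue"
    using negligible_hyperplane[of v "(v \<bullet> v) / 2"] assms unfolding negligible_iff_null_sets by blast
  moreover have "{x. v \<bullet> x = (v \<bullet> v) / 2} \<in> sets lborel"
    using closed_hyperplane[of v] by auto
  ultimately have "{x. v \<bullet> x = (v \<bullet> v) / 2} \<in> null_sets lborel"
    by (simp add: null_sets_completion_iff)
  then show ?thesis by (rule AE_I') (auto simp: inner_commute)
qed

text \<open>Folding onto the near half-space groups each point with its mirror image; a polarization
  then only rearranges values within a pair.\<close>

lemma nn_integral_fold:
  assumes v: "v \<noteq> 0" and [measurable]: "f \<in> borel_measurable borel"
  shows "(\<integral>\<^sup>+x. f x \<partial>lborel) = (\<integral>\<^sup>+x. indicator (near0 v) x * (f x + f (flip v x)) \<partial>lborel)"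
proof -
  have "(\<integral>\<^sup>+x. f x \<partial>lborel) = (\<integral>\<^sup>+x. indicator (near0 v) x * f x + indicator (near0 v) (flip v x) * f x \<partial>lborel)"
  proof (rule nn_integral_cong_AE)
    show "AE x in lborel. f x = indicator (near0 v) x * f x + indicator (near0 v) (flip v x) * f x"
      using AE_hyperplane[OF v]
      by eventually_elim (auto simp: indicator_def flip_near0[OF v], auto simp: near0_def)
  qed
  also have "\<dots> = (\<integral>\<^sup>+x. indicator (near0 v) x * f x \<partial>lborel) + (\<integral>\<^sup>+x. indicator (near0 v) (flip v x) * f x \<partial>lborel)"
    by (rule nn_integral_add) auto
  also have "(\<integral>\<^sup>+x. indicator (near0 v) (flip v x) * f x \<partial>lborel) = (\<integral>\<^sup>+x. indicator (near0 v) x * f (flip v x) \<partial>lborel)"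
    by (subst nn_integral_flip[of "\<lambda>x. indicator (near0 v) (flip v x) * f x" v, symmetric]) auto
  also have "(\<integral>\<^sup>+x. indicator (near0 v) x * f x \<partial>lborel) + \<dots> = (\<integral>\<^sup>+x. indicator (near0 v) x * (f x + f (flip v x)) \<partial>lborel)"
    by (subst nn_integral_add[symmetric]) (auto simp: distrib_left)
  finally show ?thesis .
qed

section \<open>Polarization of sets and its effect on mass in centred balls\<close>

definition polarize :: "'a::euclidean_space \<Rightarrow> 'a set \<Rightarrow> 'a set" where
  "polarize v A = {x. if x \<in> near0 v then x \<in> A \<or> flip v x \<in> A else x \<in> A \<and> flip v x \<in> A}"

lemma polarize_sets [measurable]:
  assumes [measurable]: "A \<in> sets borel"
  shows "polarize v A \<in> sets borel"
proof -
  have "polarize v A = (near0 v \<inter> (A \<union> flip v -` A)) \<union> (- near0 v \<inter> (A \<inter> flip v -` A))"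
    by (auto simp: polarize_def)
  moreover have "flip v -` A \<in> sets borel"
    using measurable_sets[OF measurable_flip assms, of v] by simp
  ultimately show ?thesis by auto
qed

lemma polarize_near0:
  assumes "v \<noteq> 0" "x \<in> near0 v"
  shows "x \<in> polarize v A \<longleftrightarrow> x \<in> A \<or> flip v x \<in> A"
    and "flip v x \<in> polarize v A \<longleftrightarrow> x \<in> A \<and> flip v x \<in> A"
proof -
  have "flip v x \<notin> near0 v" using assms by (auto simp: flip_near0) (simp add: near0_def)
  then show "x \<in> polarize v A \<longleftrightarrow> x \<in> A \<or> flip v x \<in> A"
    "flip v x \<in> polarize v A \<longleftrightarrow> x \<in> A \<and> flip v x \<in> A"
    using assms by (auto simp: polarize_def)
qed

lemma emeasure_polarize:
  assumes v: "v \<noteq> 0" and [measurable]: "A \<in> sets borel"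
  shows "emeasure lborel (polarize v A) = emeasure lborel A"
proof -
  have "emeasure lborel (polarize v A) = (\<integral>\<^sup>+x. indicator (polarize v A) x \<partial>lborel)" by simp
  also have "\<dots> = (\<integral>\<^sup>+x. indicator (near0 v) x * (indicator (polarize v A) x + indicator (polarize v A) (flip v x)) \<partial>lborel)"
    by (rule nn_integral_fold[OF v]) measurable
  also have "\<dots> = (\<integral>\<^sup>+x. indicator (near0 v) x * (indicator A x + indicator A (flip v x)) \<partial>lborel)"
    using polarize_near0[OF v] by (intro nn_integral_cong) (auto simp: indicator_def)
  also have "\<dots> = (\<integral>\<^sup>+x. indicator A x \<partial>lborel)"
    by (rule nn_integral_fold[OF v, symmetric]) measurable
  finally show ?thesis by simp
qed

text \<open>Beyond monotonicity this records a quantitative gain: a point of the ball outside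
  \<open>A\<close> is exchanged for its mirror image when that lies in \<open>A\<close> outside the
  ball. Such a point is always on the near side, because reflection increases its norm.\<close>

lemma emeasure_polarize_Int_ball:
  assumes v: "v \<noteq> 0" and [measurable]: "A \<in> sets borel"
  shows "emeasure lborel (A \<inter> ball 0 R) + emeasure lborel {x \<in> ball 0 R - A. flip v x \<in> A - ball 0 R}
    \<le> emeasure lborel (polarize v A \<inter> ball 0 R)"
proof -
  let ?G = "{x \<in> ball 0 R - A. flip v x \<in> A - ball 0 R}"
  have "?G = (ball 0 R - A) \<inter> flip v -` (A - ball 0 R)" by auto
  moreover have "flip v -` (A - ball 0 R) \<in> sets borel"
    using measurable_sets[OF measurable_flip, of "A - ball 0 R" v] by simp
  ultimately have [measurable]: "?G \<in> sets borel" by simp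
  have [measurable]: "A \<inter> ball 0 R \<in> sets borel" "polarize v A \<inter> ball 0 R \<in> sets borel" by auto
  have G: "x \<in> near0 v" if "x \<in> ?G" for x
    using that by (auto simp: near0_iff norm_flip[OF v])
  have "emeasure lborel (A \<inter> ball 0 R) + emeasure lborel ?G
    = (\<integral>\<^sup>+x. indicator (A \<inter> ball 0 R) x + indicator ?G x \<partial>lborel)"
    by (subst nn_integral_add) (auto intro!: borel_measurable_indicator)
  also have "\<dots> = (\<integral>\<^sup>+x. indicator (near0 v) x * ((indicator (A \<inter> ball 0 R) x + indicator ?G x)
     + (indicator (A \<inter> ball 0 R) (flip v x) + indicator ?G (flip v x))) \<partial>lborel)"
    by (rule nn_integral_fold[OF v]) measurable
  also have "\<dots> \<le> (\<integral>\<^sup>+x. indicator (near0 v) x * (indicator (polarize v A \<inter> ball 0 R) x + indicator (polarize v A \<inter> ball 0 R) (flip v x)) \<partial>lborel)"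
  proof (rule nn_integral_mono)
    fix x
    show "indicator (near0 v) x * ((indicator (A \<inter> ball 0 R) x + indicator ?G x)
        + (indicator (A \<inter> ball 0 R) (flip v x) + indicator ?G (flip v x)))
      \<le> indicator (near0 v) x * (indicator (polarize v A \<inter> ball 0 R) x + indicator (polarize v A \<inter> ball 0 R) (flip v x) :: ennreal)"
    proof (cases "x \<in> near0 v")
      case True
      have "flip v x \<in> ball 0 R \<Longrightarrow> x \<in> ball 0 R" using True by (auto simp: near0_iff norm_flip[OF v])
      moreover have "\<not> v \<bullet> v < 2 * (x \<bullet> v)" using True by (simp add: near0_def)
      then have "flip v x \<notin> near0 v" by (simp add: flip_near0[OF v])
      then have "flip v x \<notin> ?G" using G by blast
      ultimately show ?thesis
        using polarize_near0[OF v True, of A] True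
        by (cases "x \<in> A"; cases "flip v x \<in> A"; cases "x \<in> ball 0 R"; cases "flip v x \<in> ball 0 R")
          (simp_all add: indicator_def del: mem_ball mem_ball_0)
    qed simp
  qed
  also have "\<dots> = (\<integral>\<^sup>+x. indicator (polarize v A \<inter> ball 0 R) x \<partial>lborel)"
    by (rule nn_integral_fold[OF v, symmetric]) measurable
  finally show ?thesis by simp
qed

text \<open>The second set will also be the complement of \<open>F\<close>, which has infinite
  measure, and kernels will be split into summands; values in \<open>ennreal\<close> make all this
  free of integrability conditions.\<close>

definition en :: "(real \<Rightarrow> ennreal) \<Rightarrow> 'a::euclidean_space set \<Rightarrow> 'a set \<Rightarrow> ennreal" where
  "en J A C = (\<integral>\<^sup>+y. \<integral>\<^sup>+x. indicator A x * indicator C y * J (norm (x - y)) \<partial>lborel \<partial>lborel)"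

lemma en_fold:
  assumes v: "v \<noteq> 0" and [measurable]: "A \<in> sets borel" "C \<in> sets borel" "J \<in> borel_measurable borel"
  shows "en J A C = (\<integral>\<^sup>+y. \<integral>\<^sup>+x. indicator (near0 v) y * (indicator (near0 v) x *
    ((indicator A x * indicator C y + indicator A (flip v x) * indicator C (flip v y)) * J (norm (x - y)) +
     (indicator A (flip v x) * indicator C y + indicator A x * indicator C (flip v y)) * J (norm (x - flip v y)))) \<partial>lborel \<partial>lborel)"
proof -
  define g where "g x y = indicator A x * indicator C y * J (norm (x - y))" for x y
  have [measurable]: "(\<lambda>(x, y). g x y) \<in> borel_measurable (borel \<Otimes>\<^sub>M borel)"
    unfolding g_def by measurable
  have [measurable]: "(\<lambda>x. g x y) \<in> borel_measurable borel" for y unfolding g_def by measurable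
  have n1: "norm (flip v x - flip v y) = norm (x - y)" for x y
    using dist_flip[of v x y] by (simp add: dist_norm)
  have n2: "norm (flip v x - y) = norm (x - flip v y)" for x y
    using n1[of x "flip v y"] by simp
  let ?I = "\<lambda>y. \<integral>\<^sup>+x. g x y \<partial>lborel"
  have I: "?I y = (\<integral>\<^sup>+x. indicator (near0 v) x * (g x y + g (flip v x) y) \<partial>lborel)" for y
    by (rule nn_integral_fold[OF v]) measurable
  have "en J A C = (\<integral>\<^sup>+y. ?I y \<partial>lborel)" by (simp add: en_def g_def)
  also have "\<dots> = (\<integral>\<^sup>+y. indicator (near0 v) y * (?I y + ?I (flip v y)) \<partial>lborel)"
    by (rule nn_integral_fold[OF v]) measurable
  also have "\<dots> = (\<integral>\<^sup>+y. \<integral>\<^sup>+x. indicator (near0 v) y * (indicator (near0 v) x *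
    (g x y + g (flip v x) y + (g x (flip v y) + g (flip v x) (flip v y)))) \<partial>lborel \<partial>lborel)"
    unfolding I
    by (intro nn_integral_cong, subst nn_integral_add[symmetric], measurable, subst nn_integral_cmult[symmetric], measurable)
       (simp add: distrib_left)
  also have "\<dots> = (\<integral>\<^sup>+y. \<integral>\<^sup>+x. indicator (near0 v) y * (indicator (near0 v) x *
    ((indicator A x * indicator C y + indicator A (flip v x) * indicator C (flip v y)) * J (norm (x - y)) +
     (indicator A (flip v x) * indicator C y + indicator A x * indicator C (flip v y)) * J (norm (x - flip v y)))) \<partial>lborel \<partial>lborel)"
    unfolding g_def n1 n2
    by (intro nn_integral_cong arg_cong2[where f="(*)"] refl) (simp add: algebra_simps)
  finally show ?thesis .
qed

text \<open>A two-point inequality under the folded integral: polarization moves interactions from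
  the larger distance \<open>norm (x - flip v y)\<close> to the smaller one
  \<open>norm (x - y)\<close>. The sixteen membership patterns of two points and their images are
  checked one by one.\<close>

lemma en_polarize:
  assumes v: "v \<noteq> 0" and [measurable]: "A \<in> sets borel" "C \<in> sets borel" "J \<in> borel_measurable borel"
    and J: "antimono_on {0..} J"
  shows "en J A C \<le> en J (polarize v A) (polarize v C)"
  unfolding en_fold[OF v assms(2-4)] en_fold[OF v polarize_sets[OF assms(2)] polarize_sets[OF assms(3)] assms(4)]
proof (intro nn_integral_mono)
  fix x y
  show "indicator (near0 v) y * (indicator (near0 v) x *
    ((indicator A x * indicator C y + indicator A (flip v x) * indicator C (flip v y)) * J (norm (x - y)) +
     (indicator A (flip v x) * indicator C y + indicator A x * indicator C (flip v y)) * J (norm (x - flip v y))))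
   \<le> indicator (near0 v) y * (indicator (near0 v) x *
    ((indicator (polarize v A) x * indicator (polarize v C) y + indicator (polarize v A) (flip v x) * indicator (polarize v C) (flip v y)) * J (norm (x - y)) +
     (indicator (polarize v A) (flip v x) * indicator (polarize v C) y + indicator (polarize v A) x * indicator (polarize v C) (flip v y)) * J (norm (x - flip v y))))"
  proof (cases "x \<in> near0 v \<and> y \<in> near0 v")
    case True
    have "J (norm (x - flip v y)) \<le> J (norm (x - y))"
      using dist_le_dist_flip[of x v y] True by (intro monotone_onD[OF J]) auto
    then show ?thesis
      using True polarize_near0[OF v, of x A] polarize_near0[OF v, of y C]
      by (cases "x \<in> A"; cases "flip v x \<in> A"; cases "y \<in> C"; cases "flip v y \<in> C") (simp_all add: add_ac)
  qed auto
qed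

text \<open>With \<open>u\<close> the unit vector of \<open>v\<close>, the mirror image of
  \<open>x\<close> is x + v - 2 (x . u) u. Only the normalization is singular, at
  \<open>v = 0\<close>, which explains the lower bound \<delta> and its place in the Lipschitz
  constant.\<close>

lemma dist_scaled_le:
  fixes x :: "'a::euclidean_space"
  assumes "0 < \<delta>" "\<delta> \<le> norm v" "\<delta> \<le> norm w"
  shows "dist (flip v x) (flip w x) \<le> (1 + 8 * norm x / \<delta>) * dist v w"
proof -
  define u where "u = v /\<^sub>R norm v"
  define u' where "u' = w /\<^sub>R norm w"
  have nz: "norm v > 0" "norm w > 0" using assms by auto
  have nu: "norm u = 1" "norm u' = 1" using nz by (auto simp: u_def u'_def)
  have "norm (u - u') \<le> 2 * norm (v - w) / \<delta>"
  proof -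
    have "u - u' = (v - w) /\<^sub>R norm v + (inverse (norm v) - inverse (norm w)) *\<^sub>R w"
      by (simp add: u_def u'_def algebra_simps)
    then have "norm (u - u') \<le> norm ((v - w) /\<^sub>R norm v) + norm ((inverse (norm v) - inverse (norm w)) *\<^sub>R w)"
      by (metis norm_triangle_ineq)
    also have "norm ((inverse (norm v) - inverse (norm w)) *\<^sub>R w) = \<bar>norm w - norm v\<bar> / norm v"
    proof -
      have "(inverse (norm v) - inverse (norm w)) * norm w = (norm w - norm v) / norm v"
        using nz by (simp add: field_simps)
      then show ?thesis using nz by (simp add: abs_mult[symmetric, of _ "norm w", simplified] abs_divide)
    qed
    also have "norm ((v - w) /\<^sub>R norm v) = norm (v - w) / norm v"
      by (simp add: divide_inverse mult.commute)
    also have "\<bar>norm w - norm v\<bar> \<le> norm (v - w)" by (metis norm_triangle_ineq3 norm_minus_commute)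
    finally have "norm (u - u') \<le> 2 * norm (v - w) / norm v"
      using nz by (simp add: divide_right_mono)
    also have "\<dots> \<le> 2 * norm (v - w) / \<delta>" using assms nz by (intro divide_left_mono mult_pos_pos) auto
    finally show ?thesis .
  qed
  have fl: "flip z x = x + z - 2 *\<^sub>R ((x \<bullet> (z /\<^sub>R norm z)) *\<^sub>R (z /\<^sub>R norm z))" if "norm z > 0" for z
  proof -
    have "(x \<bullet> (z /\<^sub>R norm z)) *\<^sub>R (z /\<^sub>R norm z) = ((x \<bullet> z) / (z \<bullet> z)) *\<^sub>R z"
      by (simp add: dot_square_norm power2_eq_square divide_inverse mult_ac)
    then show ?thesis using that by (simp add: flip_def diff_divide_distrib scaleR_left_diff_distrib)
  qed
  have "flip v x - flip w x = (v - w) - 2 *\<^sub>R ((x \<bullet> u) *\<^sub>R (u - u') + (x \<bullet> (u - u')) *\<^sub>R u')"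
    unfolding fl[OF nz(1)] fl[OF nz(2)] u_def[symmetric] u'_def[symmetric]
    by (simp add: algebra_simps inner_diff_right)
  then have "norm (flip v x - flip w x) \<le> norm (v - w) + norm (2 *\<^sub>R ((x \<bullet> u) *\<^sub>R (u - u') + (x \<bullet> (u - u')) *\<^sub>R u'))"
    by (metis norm_triangle_ineq4)
  also have "norm (2 *\<^sub>R ((x \<bullet> u) *\<^sub>R (u - u') + (x \<bullet> (u - u')) *\<^sub>R u')) \<le> 2 * (norm x * norm (u - u') + norm x * norm (u - u'))"
  proof -
    have "norm ((x \<bullet> u) *\<^sub>R (u - u') + (x \<bullet> (u - u')) *\<^sub>R u') \<le> norm ((x \<bullet> u) *\<^sub>R (u - u')) + norm ((x \<bullet> (u - u')) *\<^sub>R u')"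
      by (rule norm_triangle_ineq)
    also have "norm ((x \<bullet> u) *\<^sub>R (u - u')) \<le> norm x * norm (u - u')"
      using Cauchy_Schwarz_ineq2[of x u] nu by (simp add: mult_right_mono)
    also have "norm ((x \<bullet> (u - u')) *\<^sub>R u') \<le> norm x * norm (u - u')"
      using Cauchy_Schwarz_ineq2[of x "u - u'"] nu by simp
    finally show ?thesis by simp
  qed
  also have "\<dots> = 4 * norm x * norm (u - u')" by simp
  also have "\<dots> \<le> 4 * norm x * (2 * norm (v - w) / \<delta>)"
    using \<open>norm (u - u') \<le> _\<close> by (intro mult_left_mono) auto
  finally show ?thesis using assms by (simp add: dist_norm algebra_simps)
qed

text \<open>The mirror exchanging \<open>x\<close> and \<open>y\<close> has normal
  \<open>y - x\<close>, and its parameter satisfies |v| |y - x| = |y|^2 - |x|^2. A gap \<delta>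
  between the norms therefore keeps \<open>v\<close> at distance \<delta> from the singular value
  0.\<close>

lemma ex_flip_eq:
  assumes "0 < \<delta>" "norm x + \<delta> \<le> norm y"
  shows "\<exists>v. \<delta> \<le> norm v \<and> norm v \<le> norm x + norm y \<and> flip v x = y"
proof -
  have ne: "y - x \<noteq> 0" using assms by auto
  have n0: "norm (y - x) > 0" using ne by simp
  define s where "s = (y \<bullet> y - x \<bullet> x) / ((y - x) \<bullet> (y - x))"
  define v where "v = s *\<^sub>R (y - x)"
  have q: "(y - x) \<bullet> (y - x) > 0" using ne by simp
  have sq: "s * ((y - x) \<bullet> (y - x)) = y \<bullet> y - x \<bullet> x" using q by (simp add: s_def)
  have diff: "y \<bullet> y - x \<bullet> x = (norm y - norm x) * (norm y + norm x)"
    by (simp add: dot_square_norm power2_eq_square algebra_simps)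
  have pos: "y \<bullet> y - x \<bullet> x > 0"
    unfolding diff using assms norm_ge_zero[of x] by (intro mult_pos_pos) linarith+
  have s: "s > 0" using pos q by (simp add: s_def)
  have vv: "v \<bullet> v = s * (y \<bullet> y - x \<bullet> x)" unfolding sq[symmetric] by (simp add: v_def)
  have xv: "2 * (x \<bullet> v) - v \<bullet> v = - s * ((y - x) \<bullet> (y - x))"
    unfolding vv by (simp add: v_def inner_diff_left inner_diff_right algebra_simps inner_commute)
  have "(2 * (x \<bullet> v) - v \<bullet> v) / (v \<bullet> v) = - 1 / s"
  proof -
    have "v \<bullet> v = s * (s * ((y - x) \<bullet> (y - x)))" by (simp only: vv sq)
    then have "(2 * (x \<bullet> v) - v \<bullet> v) / (v \<bullet> v) = (- s * ((y - x) \<bullet> (y - x))) / (s * (s * ((y - x) \<bullet> (y - x))))"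
      using xv by presburger
    then show ?thesis using s q by simp
  qed
  then have "flip v x = y" using s by (simp add: flip_def v_def)
  have nv: "norm v * norm (y - x) = (norm y - norm x) * (norm y + norm x)"
    using sq s unfolding diff by (simp add: v_def dot_square_norm power2_eq_square)
  have "\<delta> * norm (y - x) \<le> (norm y - norm x) * (norm y + norm x)"
    using assms norm_triangle_ineq4[of y x] by (intro mult_mono) auto
  then have "\<delta> \<le> norm v" using n0 unfolding nv[symmetric] by simp
  moreover have "(norm y - norm x) * (norm y + norm x) \<le> norm (y - x) * (norm x + norm y)"
    using assms norm_triangle_ineq2[of y x] by (intro mult_mono) auto
  then have "norm v \<le> norm x + norm y" using n0 unfolding nv[symmetric] by (simp add: mult.commute)
  ultimately show ?thesis using \<open>flip v x = y\<close> by blast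
qed

text \<open>Every point of \<open>Q\<close> is the mirror image of the fixed \<open>x\<close> for
  some parameter of norm at least \<delta>. So \<open>Q\<close> is covered by a Lipschitz image of
  the parameter set, which cannot be much smaller than \<open>Q\<close>.\<close>

lemma emeasure_flip_param_ge:
  fixes Q :: "'a::euclidean_space set"
  assumes \<delta>: "0 < \<delta>" and x: "norm x + \<delta> \<le> R"
    and Q: "Q \<in> sets borel" "Q \<subseteq> ball 0 N - ball 0 R"
  shows "emeasure lborel Q \<le> ennreal ((2 * (1 + 8 * R / \<delta>) + 1) ^ DIM('a)) *
    emeasure lborel {v \<in> cball 0 (N + R). flip v x \<in> Q}"
proof -
  define T where "T = {v. v \<in> cball 0 (N + R) \<and> \<delta> \<le> norm v \<and> flip v x \<in> Q}"
  have [measurable]: "Q \<in> sets borel" by fact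
  have R: "0 < R" using \<delta> x norm_ge_zero[of x] by linarith
  have "emeasure lborel Q \<le> ennreal ((2 * (1 + 8 * R / \<delta>) + 1) ^ DIM('a)) * emeasure lborel T"
  proof (rule emeasure_Lipschitz_image_le)
    show "T \<in> sets borel" unfolding T_def by measurable
    show "Q \<subseteq> (\<lambda>v. flip v x) ` T"
    proof
      fix y assume y: "y \<in> Q"
      then have yn: "R \<le> norm y" "norm y < N" using Q(2) by auto
      then obtain v where v: "\<delta> \<le> norm v" "norm v \<le> norm x + norm y" "flip v x = y"
        using ex_flip_eq[OF \<delta>, of x y] x by auto
      then have "v \<in> T" using y yn x \<delta> by (auto simp: T_def)
      then show "y \<in> (\<lambda>v. flip v x) ` T" using v by blast
    qed
    fix v w assume "v \<in> T" "w \<in> T"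
    then have "dist (flip v x) (flip w x) \<le> (1 + 8 * norm x / \<delta>) * dist v w"
      by (intro dist_scaled_le[OF \<delta>]) (auto simp: T_def)
    also have "\<dots> \<le> (1 + 8 * R / \<delta>) * dist v w"
      using x \<delta> by (intro mult_right_mono add_left_mono divide_right_mono) auto
    finally show "dist (flip v x) (flip w x) \<le> (1 + 8 * R / \<delta>) * dist v w" .
  qed (use R \<delta> Q in auto)
  also have "emeasure lborel T \<le> emeasure lborel {v \<in> cball 0 (N + R). flip v x \<in> Q}"
    by (intro emeasure_mono) (auto simp: T_def)
  finally show ?thesis by (simp add: mult_left_mono)
qed

text \<open>By averaging: if every reflection carried at most measure \<open>c\<close> of
  \<open>P\<close> into \<open>Q\<close>, integrating over the parameters and exchanging the
  integrals would contradict the amount of parameters available for each point of \<open>P\<close>.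
  What matters later is that \<open>c\<close> depends on \<open>R\<close>, \<open>N\<close> and
  \<epsilon> but not on the sets.\<close>

lemma ex_flip_overlap:
  assumes R: "0 < R" and \<epsilon>: "0 < \<epsilon>"
  shows "\<exists>c>0. \<forall>P Q :: 'a::euclidean_space set. P \<in> sets borel \<longrightarrow> Q \<in> sets borel \<longrightarrow> P \<subseteq> ball 0 R \<longrightarrow>
    Q \<subseteq> ball 0 N - ball 0 R \<longrightarrow> ennreal \<epsilon> \<le> emeasure lborel P \<longrightarrow> ennreal \<epsilon> \<le> emeasure lborel Q \<longrightarrow>
    (\<exists>v. v \<noteq> 0 \<and> ennreal c < emeasure lborel {x \<in> P. flip v x \<in> Q})"
proof -
  define \<omega> where "\<omega> = unit_ball_vol (DIM('a))"
  have "((\<lambda>s. \<omega> * R ^ DIM('a) - \<omega> * s ^ DIM('a)) \<longlongrightarrow> \<omega> * R ^ DIM('a) - \<omega> * R ^ DIM('a)) (at_left R)"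
    by (intro tendsto_intros)
  then have "eventually (\<lambda>s. \<omega> * R ^ DIM('a) - \<omega> * s ^ DIM('a) < \<epsilon> / 2) (at_left R)"
    using \<epsilon> by (intro order_tendstoD(2)) auto
  moreover have "eventually (\<lambda>s. s \<in> {0<..<R}) (at_left R)"
    using R by (intro eventually_at_left_real)
  \<comment> \<open>The shell between radii \<open>s\<close> and \<open>R\<close> has measure below
    \<open>\<epsilon> / 2\<close>, so at least \<open>\<epsilon> / 2\<close> of \<open>P\<close>
    remains at norm at most \<open>s\<close>, with a gap \<open>R - s\<close> to
    \<open>Q\<close>.\<close>
  ultimately obtain s where s: "0 < s" "s < R" "\<omega> * R ^ DIM('a) - \<omega> * s ^ DIM('a) < \<epsilon> / 2"
    using eventually_happens'[OF _ eventually_conj] by (metis (mono_tags, lifting) greaterThanLessThan_iff trivial_limit_at_left_real)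
  define \<delta> where "\<delta> = R - s"
  have \<delta>: "0 < \<delta>" using s by (simp add: \<delta>_def)
  define \<Lambda> where "\<Lambda> = (2 * (1 + 8 * R / \<delta>) + 1) ^ DIM('a)"
  have \<Lambda>: "0 < \<Lambda>" unfolding \<Lambda>_def using R \<delta> by (intro zero_less_power add_pos_pos mult_pos_pos) auto
  let ?K = "cball 0 (N + R) :: 'a set"
  define \<kappa> where "\<kappa> = measure lborel ?K"
  have \<kappa>: "emeasure lborel ?K = ennreal \<kappa>" "0 \<le> \<kappa>"
    using emeasure_lborel_cball_finite[of "0::'a" "N + R"] by (auto simp: \<kappa>_def emeasure_eq_ennreal_measure)
  \<comment> \<open>Chosen to make \<open>\<Lambda> * (c * \<kappa>)\<close> smaller than
    \<open>\<epsilon> * (\<epsilon> / 2)\<close>; \<open>\<kappa> + 1\<close> avoids a division by 0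
    when the parameter ball is null.\<close>
  define c where "c = \<epsilon> * (\<epsilon> / 2) / (\<Lambda> * (\<kappa> + 1)) / 2"
  have c: "0 < c" using \<epsilon> \<Lambda> \<kappa>(2) by (simp add: c_def)
  have c\<kappa>: "\<Lambda> * (c * \<kappa>) < \<epsilon> * (\<epsilon> / 2)"
  proof -
    have "\<Lambda> * (c * (\<kappa> + 1)) = \<epsilon> * (\<epsilon> / 2) / 2"
      using \<Lambda> \<kappa>(2) by (simp add: c_def add_nonneg_eq_0_iff)
    moreover have "\<Lambda> * (c * \<kappa>) < \<Lambda> * (c * (\<kappa> + 1))" using \<Lambda> c by simp
    moreover have "\<epsilon> * (\<epsilon> / 2) > 0" using \<epsilon> by simp
    ultimately show ?thesis by linarith
  qed
  show ?thesis
  proof (intro exI[of _ c] conjI c allI impI, rule ccontr)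
    fix P Q :: "'a set"
    assume [measurable]: "P \<in> sets borel" "Q \<in> sets borel" and sub: "P \<subseteq> ball 0 R" "Q \<subseteq> ball 0 N - ball 0 R"
      and big: "ennreal \<epsilon> \<le> emeasure lborel P" "ennreal \<epsilon> \<le> emeasure lborel Q"
      and "\<not> (\<exists>v. v \<noteq> 0 \<and> ennreal c < emeasure lborel {x \<in> P. flip v x \<in> Q})"
    then have small: "emeasure lborel {x \<in> P. flip v x \<in> Q} \<le> ennreal c" if "v \<noteq> 0" for v
      using that by (auto simp: not_less)
    let ?P = "P \<inter> cball 0 s"
    have P': "ennreal (\<epsilon> / 2) \<le> emeasure lborel ?P"
    proof -
      have "emeasure lborel (ball 0 R - cball (0::'a) s) = emeasure lborel (ball (0::'a) R) - emeasure lborel (cball (0::'a) s)"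
        using s by (intro emeasure_Diff) (auto simp: emeasure_cball)
      also have "\<dots> = ennreal (\<omega> * R ^ DIM('a) - \<omega> * s ^ DIM('a))"
        using s R by (simp add: emeasure_ball emeasure_cball \<omega>_def ennreal_minus)
      also have "\<dots> \<le> ennreal (\<epsilon> / 2)" using s(3) by (intro ennreal_leI) simp
      finally have an: "emeasure lborel (ball 0 R - cball (0::'a) s) \<le> ennreal (\<epsilon> / 2)" .
      have "ennreal (\<epsilon> / 2) + ennreal (\<epsilon> / 2) \<le> emeasure lborel P" using big(1) \<epsilon> by (simp add: ennreal_plus[symmetric] del: ennreal_plus)
      also have "\<dots> \<le> emeasure lborel (?P \<union> (ball 0 R - cball 0 s))" using sub by (intro emeasure_mono) auto
      also have "\<dots> \<le> emeasure lborel ?P + emeasure lborel (ball 0 R - cball (0::'a) s)"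
        by (intro emeasure_subadditive) auto
      also have "\<dots> \<le> emeasure lborel ?P + ennreal (\<epsilon> / 2)" using an by (rule add_left_mono)
      finally show ?thesis by (simp add: add.commute[of "emeasure _ _"] ennreal_add_left_cancel_le)
    qed
    have fl: "{x \<in> P. flip v x \<in> Q} \<in> sets borel" for v by measurable
    have [measurable]: "?K \<in> sets borel" by auto
    have "(\<lambda>z. flip (snd z) (fst z)) \<in> borel_measurable (lborel \<Otimes>\<^sub>M lborel)" by measurable
    then have [measurable]: "(\<lambda>z. indicator Q (flip (snd z) (fst z)) :: ennreal) \<in> borel_measurable (lborel \<Otimes>\<^sub>M lborel)"
      by (rule measurable_compose) measurable
    have [measurable]: "(\<lambda>z. indicator P (fst z) * indicator ?K (snd z) * indicator Q (flip (snd z) (fst z)) :: ennreal) \<in> borel_measurable (lborel \<Otimes>\<^sub>M lborel)"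
      by measurable
    have "ennreal \<epsilon> * ennreal (\<epsilon> / 2) \<le> (\<integral>\<^sup>+x. emeasure lborel Q * indicator ?P x \<partial>lborel)"
      using big(2) P' by (simp add: nn_integral_cmult_indicator mult_mono)
    also have "\<dots> \<le> (\<integral>\<^sup>+x. ennreal \<Lambda> * (\<integral>\<^sup>+v. indicator P x * indicator ?K v * indicator Q (flip v x) \<partial>lborel) \<partial>lborel)"
    proof (rule nn_integral_mono)
      fix x
      show "emeasure lborel Q * indicator ?P x \<le> ennreal \<Lambda> * (\<integral>\<^sup>+v. indicator P x * indicator ?K v * indicator Q (flip v x) \<partial>lborel)"
      proof (cases "x \<in> ?P")
        case True
        have "emeasure lborel Q \<le> ennreal \<Lambda> * emeasure lborel {v \<in> ?K. flip v x \<in> Q}"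
          unfolding \<Lambda>_def using True sub by (intro emeasure_flip_param_ge[OF \<delta>]) (auto simp: \<delta>_def)
        also have "emeasure lborel {v \<in> ?K. flip v x \<in> Q} = (\<integral>\<^sup>+v. indicator {v \<in> ?K. flip v x \<in> Q} v \<partial>lborel)"
          by (rule nn_integral_indicator[symmetric]) measurable
        also have "\<dots> = (\<integral>\<^sup>+v. indicator P x * indicator ?K v * indicator Q (flip v x) \<partial>lborel)"
          using True by (intro nn_integral_cong) (auto simp: indicator_def)
        finally show ?thesis using True by simp
      qed simp
    qed
    also have "\<dots> = ennreal \<Lambda> * (\<integral>\<^sup>+x. \<integral>\<^sup>+v. indicator P x * indicator ?K v * indicator Q (flip v x) \<partial>lborel \<partial>lborel)"
      by (rule nn_integral_cmult) measurable
    also have "(\<integral>\<^sup>+x. \<integral>\<^sup>+v. indicator P x * indicator ?K v * indicator Q (flip v x) \<partial>lborel \<partial>lborel) =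
      (\<integral>\<^sup>+v. \<integral>\<^sup>+x. indicator P x * indicator ?K v * indicator Q (flip v x) \<partial>lborel \<partial>lborel)"
      by (rule lborel_pair.Fubini') measurable
    also have "\<dots> \<le> (\<integral>\<^sup>+v. ennreal c * indicator ?K v \<partial>lborel)"
    proof (rule nn_integral_mono_AE)
      show "AE v in lborel. (\<integral>\<^sup>+x. indicator P x * indicator ?K v * indicator Q (flip v x) \<partial>lborel) \<le> ennreal c * indicator ?K v"
        using AE_lborel_singleton[of 0]
      proof eventually_elim
        case (elim v)
        have "(\<integral>\<^sup>+x. indicator P x * indicator ?K v * indicator Q (flip v x) \<partial>lborel) = (\<integral>\<^sup>+x. indicator ?K v * indicator {x \<in> P. flip v x \<in> Q} x \<partial>lborel)"
          by (intro nn_integral_cong) (auto simp: indicator_def)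
        also have "\<dots> = indicator ?K v * emeasure lborel {x \<in> P. flip v x \<in> Q}"
          using fl by (intro nn_integral_cmult_indicator) simp
        also have "\<dots> \<le> ennreal c * indicator ?K v" using small[OF elim] by (auto simp: indicator_def)
        finally show ?case .
      qed
    qed
    also have "\<dots> = ennreal c * ennreal \<kappa>" by (simp add: nn_integral_cmult_indicator \<kappa>)
    finally have "ennreal \<epsilon> * ennreal (\<epsilon> / 2) \<le> ennreal \<Lambda> * (ennreal c * ennreal \<kappa>)"
      by (simp add: mult_left_mono)
    then have "ennreal (\<epsilon> * (\<epsilon> / 2)) \<le> ennreal (\<Lambda> * (c * \<kappa>))"
      using c \<kappa>(2) \<Lambda> \<epsilon> by (simp only: ennreal_mult less_imp_le mult_nonneg_nonneg half_gt_zero)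
    then show False using c\<kappa> c \<kappa> \<Lambda> by (subst (asm) ennreal_le_iff) auto
  qed
qed

section \<open>Approaching two balls by finitely many common polarizations\<close>

inductive polarized :: "'a::euclidean_space set \<Rightarrow> 'a set \<Rightarrow> 'a set \<Rightarrow> 'a set \<Rightarrow> bool" for A C where
  start: "polarized A C A C"
| step: "polarized A C A' C' \<Longrightarrow> v \<noteq> 0 \<Longrightarrow> polarized A C (polarize v A') (polarize v C')"

lemma polarized_invariants:
  assumes "polarized A C A' C'" and [measurable]: "A \<in> sets borel" "C \<in> sets borel"
  shows "A' \<in> sets borel" "C' \<in> sets borel"
    "emeasure lborel A' = emeasure lborel A" "emeasure lborel C' = emeasure lborel C"
    "emeasure lborel (A \<inter> ball 0 N) \<le> emeasure lborel (A' \<inter> ball 0 N)"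
    "emeasure lborel (C \<inter> ball 0 N) \<le> emeasure lborel (C' \<inter> ball 0 N)"
    "J \<in> borel_measurable borel \<Longrightarrow> antimono_on {0..} J \<Longrightarrow> en J A C \<le> en J A' C'"
  using assms(1)
proof induction
  case (step A' C' v)
  { case 1 then show ?case using step by simp }
  { case 2 then show ?case using step by simp }
  { case 3 then show ?case using step by (simp add: emeasure_polarize) }
  { case 4 then show ?case using step by (simp add: emeasure_polarize) }
  { case 5 then show ?case
      using step emeasure_polarize_Int_ball[OF \<open>v \<noteq> 0\<close> \<open>A' \<in> sets borel\<close>, of N] by (meson le_iff_add order_trans) }
  { case 6 then show ?case
      using step emeasure_polarize_Int_ball[OF \<open>v \<noteq> 0\<close> \<open>C' \<in> sets borel\<close>, of N] by (meson le_iff_add order_trans) }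
  { case 7 then show ?case
      using step en_polarize[OF \<open>v \<noteq> 0\<close> \<open>A' \<in> sets borel\<close> \<open>C' \<in> sets borel\<close>, of J] by (meson order_trans) }
qed auto

lemma ex_tail_small:
  assumes A: "A \<in> fmeasurable lborel" and "0 < \<eta>"
  shows "\<exists>N. measure lborel (A - ball (0::'a::euclidean_space) N) < \<eta>"
proof -
  have [measurable]: "A \<in> sets borel" using A by (auto simp: fmeasurable_def)
  have "(\<lambda>n. measure lborel (A - ball 0 (real n))) \<longlonglongrightarrow> measure lborel (\<Inter>n. A - ball 0 (real n))"
  proof (rule Lim_measure_decseq)
    fix n show "emeasure lborel (A - ball 0 (real n)) \<noteq> \<infinity>"
      using fmeasurable_Diff[OF A, of "ball 0 (real n)"] by (simp add: fmeasurableD2)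
  qed (auto simp: decseq_def)
  moreover have e: "(\<Inter>n. A - ball 0 (real n)) = {}" using reals_Archimedean2 by auto
  ultimately have "(\<lambda>n. measure lborel (A - ball 0 (real n))) \<longlonglongrightarrow> 0" by (simp only: e measure_empty)
  from order_tendstoD(2)[OF this assms(2)] show ?thesis by (auto simp: eventually_sequentially)
qed

lemma fmeasurable_lborel_ball [simp]: "ball a r \<in> fmeasurable lborel"
  using emeasure_lborel_ball_finite[of a r] by (simp add: fmeasurable_def)

lemma measure_Int_Diff:
  assumes "A \<in> fmeasurable M" "B \<in> sets M"
  shows "measure M A = measure M (A \<inter> B) + measure M (A - B)"
proof -
  have "measure M ((A \<inter> B) \<union> (A - B)) = measure M (A \<inter> B) + measure M (A - B)"
    using assms by (intro measure_Un_AE) (auto intro: fmeasurable_Int_fmeasurable fmeasurable_Diff)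
  then show ?thesis by (simp add: Int_Diff_Un)
qed

lemma measure_split_ball:
  assumes "A \<in> fmeasurable lborel"
  shows "measure lborel A = measure lborel (A \<inter> ball 0 N) + measure lborel (A - ball (0::'a::euclidean_space) N)"
  using assms by (rule measure_Int_Diff) simp

text \<open>The gain \<open>c\<close> has to be the same for every set reachable from
  \<open>A\<close>. Mass in centred balls never decreases along the way, so the tails of
  \<open>A'\<close> are no heavier than those of \<open>A\<close>, and one radius \<open>N\<close>
  serves all these sets.\<close>

lemma ex_flip_gain:
  fixes A :: "'a::euclidean_space set"
  assumes A: "A \<in> fmeasurable lborel" and R: "measure lborel (ball (0::'a) R) = measure lborel A" and \<eta>: "0 < \<eta>"
  shows "\<exists>c>0. \<forall>A' :: 'a set. A' \<in> fmeasurable lborel \<longrightarrow> measure lborel A' = measure lborel A \<longrightarrow>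
    (\<forall>N. measure lborel (A \<inter> ball 0 N) \<le> measure lborel (A' \<inter> ball 0 N)) \<longrightarrow>
    \<eta> \<le> measure lborel (A' - ball 0 R) \<longrightarrow>
    (\<exists>v. v \<noteq> 0 \<and> measure lborel (A' \<inter> ball 0 R) + c < measure lborel (polarize v A' \<inter> ball 0 R))"
proof (cases "0 < R")
  case False
  then have "ball (0::'a) R = {}" by simp
  then have "measure lborel A = 0" using R by (metis measure_empty)
  have "measure lborel (A' - ball 0 R) = 0" if "A' \<in> fmeasurable lborel" "measure lborel A' = measure lborel A" for A' :: "'a set"
  proof -
    have "measure lborel (A' - ball 0 R) \<le> measure lborel A'"
      using that by (intro measure_mono_fmeasurable) (auto dest: fmeasurableD)
    then show ?thesis using that \<open>measure lborel A = 0\<close> by (simp add: measure_le_0_iff)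
  qed
  then show ?thesis using \<eta> by (intro exI[of _ 1]) auto
next
  case True
  obtain N where N: "measure lborel (A - ball 0 N) < \<eta> / 2" using ex_tail_small[OF A] \<eta> by (metis half_gt_zero)
  obtain c where c: "0 < c" "\<And>P Q :: 'a set. P \<in> sets borel \<Longrightarrow> Q \<in> sets borel \<Longrightarrow> P \<subseteq> ball 0 R \<Longrightarrow>
    Q \<subseteq> ball 0 N - ball 0 R \<Longrightarrow> ennreal (\<eta> / 2) \<le> emeasure lborel P \<Longrightarrow> ennreal (\<eta> / 2) \<le> emeasure lborel Q \<Longrightarrow>
    (\<exists>v. v \<noteq> 0 \<and> ennreal c < emeasure lborel {x \<in> P. flip v x \<in> Q})"
    using ex_flip_overlap[OF True half_gt_zero[OF \<eta>], of N] by blast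
  show ?thesis
  proof (intro exI[of _ c] conjI c(1) allI impI)
    fix A' :: "'a set" assume A': "A' \<in> fmeasurable lborel" "measure lborel A' = measure lborel A"
      "\<forall>N. measure lborel (A \<inter> ball 0 N) \<le> measure lborel (A' \<inter> ball 0 N)" "\<eta> \<le> measure lborel (A' - ball 0 R)"
    have [measurable]: "A' \<in> sets borel" using A' by (auto simp: fmeasurable_def)
    have "measure lborel (A' - ball 0 N) < \<eta> / 2"
      using measure_split_ball[OF A, of N] measure_split_ball[OF A'(1), of N] A'(2,3) N by (smt (verit))
    moreover have "measure lborel (A' - ball 0 R) \<le> measure lborel ((A' \<inter> ball 0 N - ball 0 R) \<union> (A' - ball 0 N))"
      using A'(1) by (intro measure_mono_fmeasurable) (auto intro!: fmeasurable.Un fmeasurable_Diff fmeasurable_Int_fmeasurable)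
    moreover have "\<dots> \<le> measure lborel (A' \<inter> ball 0 N - ball 0 R) + measure lborel (A' - ball 0 N)"
      by (rule measure_Un_le) auto
    ultimately have Q: "\<eta> / 2 \<le> measure lborel (A' \<inter> ball 0 N - ball 0 R)" using A'(4) by linarith
    have fB: "ball (0::'a) R \<in> fmeasurable lborel" by simp
    have "measure lborel (ball 0 R - A') = measure lborel (A' - ball 0 R)"
    proof -
      have "measure lborel (ball (0::'a) R) = measure lborel (ball 0 R \<inter> A') + measure lborel (ball 0 R - A')"
        by (rule measure_Int_Diff) auto
      then show ?thesis using measure_split_ball[OF A'(1), of R] R A'(2) by (simp add: Int_commute)
    qed
    then have P: "\<eta> / 2 \<le> measure lborel (ball 0 R - A')" using A'(4) \<eta> by linarith
    have fP: "ball 0 R - A' \<in> fmeasurable lborel" using fB by (intro fmeasurable_Diff) auto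
    have fQ: "A' \<inter> ball 0 N - ball 0 R \<in> fmeasurable lborel"
      using A'(1) by (auto intro!: fmeasurable_Diff fmeasurable_Int_fmeasurable)
    let ?P = "ball 0 R - A'" and ?Q = "A' \<inter> ball 0 N - ball 0 R"
    have "\<exists>v. v \<noteq> 0 \<and> ennreal c < emeasure lborel {x \<in> ?P. flip v x \<in> ?Q}"
      using P Q fP fQ by (intro c(2)) (auto simp: emeasure_eq_measure2 ennreal_leI)
    then obtain v where v: "v \<noteq> 0" "ennreal c < emeasure lborel {x \<in> ?P. flip v x \<in> ?Q}" by blast
    have fl: "{x \<in> ?P. flip v x \<in> A' - ball 0 R} \<in> fmeasurable lborel"
    proof (rule fmeasurableI2[OF fP])
      have "flip v -` (A' - ball 0 R) \<in> sets borel"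
        using measurable_sets[OF measurable_flip, of "A' - ball 0 R" v] by simp
      then have "?P \<inter> flip v -` (A' - ball 0 R) \<in> sets lborel" by simp
      moreover have "?P \<inter> flip v -` (A' - ball 0 R) = {x \<in> ?P. flip v x \<in> A' - ball 0 R}" by auto
      ultimately show "{x \<in> ?P. flip v x \<in> A' - ball 0 R} \<in> sets lborel" by simp
    qed auto
    have "ennreal c < emeasure lborel {x \<in> ?P. flip v x \<in> A' - ball 0 R}"
      using fl by (intro less_le_trans[OF v(2)] emeasure_mono) auto
    then have "c < measure lborel {x \<in> ?P. flip v x \<in> A' - ball 0 R}"
      using fl c(1) by (simp add: emeasure_eq_measure2 ennreal_less_iff)
    moreover have "measure lborel (A' \<inter> ball 0 R) + measure lborel {x \<in> ?P. flip v x \<in> A' - ball 0 R} \<le> measure lborel (polarize v A' \<inter> ball 0 R)"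
    proof -
      have f1: "A' \<inter> ball 0 R \<in> fmeasurable lborel" using A'(1) by (intro fmeasurable_Int_fmeasurable) auto
      have f2: "polarize v A' \<inter> ball 0 R \<in> fmeasurable lborel"
        using fB by (subst Int_commute, intro fmeasurable_Int_fmeasurable) auto
      show ?thesis
        using emeasure_polarize_Int_ball[OF v(1), of A' R] f1 f2 fl
        by (simp add: emeasure_eq_measure2 flip: ennreal_plus)
    qed
    ultimately show "\<exists>v. v \<noteq> 0 \<and> measure lborel (A' \<inter> ball 0 R) + c < measure lborel (polarize v A' \<inter> ball 0 R)"
      using v(1) by (intro exI[of _ v]) linarith
  qed
qed

lemma polarize_Int_ball_mono:
  assumes "v \<noteq> 0" "A \<in> fmeasurable lborel"
  shows "measure lborel (A \<inter> ball 0 R) \<le> measure lborel (polarize v A \<inter> ball 0 R)"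
proof -
  have [measurable]: "A \<in> sets borel" using assms by (auto simp: fmeasurable_def)
  have fB: "ball 0 R \<in> fmeasurable lborel" by simp
  have f1: "A \<inter> ball 0 R \<in> fmeasurable lborel" using assms(2) by (intro fmeasurable_Int_fmeasurable) auto
  have f2: "polarize v A \<inter> ball 0 R \<in> fmeasurable lborel"
    using fB by (subst Int_commute, intro fmeasurable_Int_fmeasurable) auto
  have "emeasure lborel (A \<inter> ball 0 R) \<le> emeasure lborel (polarize v A \<inter> ball 0 R)"
    using emeasure_polarize_Int_ball[OF assms(1), of A R] by (meson \<open>A \<in> sets borel\<close> le_iff_add order_trans)
  then show ?thesis using f1 f2 by (simp add: emeasure_eq_measure2)
qed

text \<open>Among the reachable pairs choose one whose total mass in the two balls is within the
  uniform gain of the supremum. Were one of its sets still off by \<eta>, one more polarization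
  would exceed the supremum, since the other set loses nothing. This replaces any convergence of a
  sequence of sets.\<close>

lemma ex_polarized_near_ball:
  fixes A C :: "'a::euclidean_space set"
  assumes A: "A \<in> fmeasurable lborel" "measure lborel (ball (0::'a) R) = measure lborel A"
    and C: "C \<in> fmeasurable lborel" "measure lborel (ball (0::'a) S) = measure lborel C" and \<eta>: "0 < \<eta>"
  shows "\<exists>A' C'. polarized A C A' C' \<and> measure lborel (A' - ball 0 R) < \<eta> \<and> measure lborel (C' - ball 0 S) < \<eta>"
proof -
  obtain a where a: "0 < a" "\<And>A' :: 'a set. A' \<in> fmeasurable lborel \<Longrightarrow> measure lborel A' = measure lborel A \<Longrightarrow>
    (\<forall>N. measure lborel (A \<inter> ball 0 N) \<le> measure lborel (A' \<inter> ball 0 N)) \<Longrightarrow>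
    \<eta> \<le> measure lborel (A' - ball 0 R) \<Longrightarrow>
    (\<exists>v. v \<noteq> 0 \<and> measure lborel (A' \<inter> ball 0 R) + a < measure lborel (polarize v A' \<inter> ball 0 R))"
    using ex_flip_gain[OF A \<eta>] by blast
  obtain c where c: "0 < c" "\<And>C' :: 'a set. C' \<in> fmeasurable lborel \<Longrightarrow> measure lborel C' = measure lborel C \<Longrightarrow>
    (\<forall>N. measure lborel (C \<inter> ball 0 N) \<le> measure lborel (C' \<inter> ball 0 N)) \<Longrightarrow>
    \<eta> \<le> measure lborel (C' - ball 0 S) \<Longrightarrow>
    (\<exists>v. v \<noteq> 0 \<and> measure lborel (C' \<inter> ball 0 S) + c < measure lborel (polarize v C' \<inter> ball 0 S))"
    using ex_flip_gain[OF C \<eta>] by blast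
  have sA: "A \<in> sets borel" "C \<in> sets borel" using A C by (auto simp: fmeasurable_def)
  define \<Phi> where "\<Phi> p = measure lborel (fst p \<inter> ball 0 R) + measure lborel (snd p \<inter> ball 0 S)" for p :: "'a set \<times> 'a set"
  define X where "X = \<Phi> ` {(A', C'). polarized A C A' C'}"
  have inv: "A' \<in> fmeasurable lborel" "C' \<in> fmeasurable lborel" "measure lborel A' = measure lborel A" "measure lborel C' = measure lborel C"
    "measure lborel (A \<inter> ball 0 N) \<le> measure lborel (A' \<inter> ball 0 N)" "measure lborel (C \<inter> ball 0 N) \<le> measure lborel (C' \<inter> ball 0 N)"
    if "polarized A C A' C'" for A' C' N
  proof -
    note i = polarized_invariants[OF that sA]
    show f: "A' \<in> fmeasurable lborel" "C' \<in> fmeasurable lborel" using i(1-4) A C by (auto simp: fmeasurable_def)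
    show "measure lborel A' = measure lborel A" "measure lborel C' = measure lborel C" using i(3,4) by (auto simp: measure_def)
    have "X \<inter> ball 0 N \<in> fmeasurable lborel" if "X \<in> fmeasurable lborel" for X :: "'a set"
      using that by (intro fmeasurable_Int_fmeasurable) auto
    then show "measure lborel (A \<inter> ball 0 N) \<le> measure lborel (A' \<inter> ball 0 N)" "measure lborel (C \<inter> ball 0 N) \<le> measure lborel (C' \<inter> ball 0 N)"
      using i(5,6)[of N] f A C by (auto simp: emeasure_eq_measure2)
  qed
  have bdd: "bdd_above X"
  proof (rule bdd_aboveI)
    fix z assume "z \<in> X"
    then obtain A' C' where p: "polarized A C A' C'" "z = \<Phi> (A', C')" by (auto simp: X_def)
    show "z \<le> measure lborel A + measure lborel C"
      using measure_split_ball[OF inv(1)[OF p(1)], of R] measure_split_ball[OF inv(2)[OF p(1)], of S] inv(3,4)[OF p(1)]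
        measure_nonneg[of lborel "A' - ball 0 R"] measure_nonneg[of lborel "C' - ball 0 S"]
      unfolding p(2) \<Phi>_def fst_conv snd_conv by linarith
  qed
  have ne: "X \<noteq> {}" using start by (auto simp: X_def)
  have "Sup X - min a c < Sup X" using a(1) c(1) by simp
  then obtain z where z: "z \<in> X" "Sup X - min a c < z" using less_cSup_iff[OF ne bdd] by blast
  then obtain A' C' where p: "polarized A C A' C'" "z = \<Phi> (A', C')" by (auto simp: X_def)
  have up: "\<Phi> (polarize v A', polarize v C') \<le> Sup X" if "v \<noteq> 0" for v
    using polarized.step[OF p(1) that] by (intro cSup_upper bdd) (auto simp: X_def)
  have "measure lborel (A' - ball 0 R) < \<eta>"
  proof (rule ccontr)
    assume "\<not> ?thesis"
    then obtain v where v: "v \<noteq> 0" "measure lborel (A' \<inter> ball 0 R) + a < measure lborel (polarize v A' \<inter> ball 0 R)"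
      using a(2)[OF inv(1,3)[OF p(1)]] inv(5)[OF p(1)] by auto
    moreover have "measure lborel (C' \<inter> ball 0 S) \<le> measure lborel (polarize v C' \<inter> ball 0 S)"
      using v(1) inv(2)[OF p(1)] by (rule polarize_Int_ball_mono)
    ultimately show False using up[OF v(1)] z(2) unfolding p(2) \<Phi>_def fst_conv snd_conv by linarith
  qed
  moreover have "measure lborel (C' - ball 0 S) < \<eta>"
  proof (rule ccontr)
    assume "\<not> ?thesis"
    then obtain v where v: "v \<noteq> 0" "measure lborel (C' \<inter> ball 0 S) + c < measure lborel (polarize v C' \<inter> ball 0 S)"
      using c(2)[OF inv(2,4)[OF p(1)]] inv(6)[OF p(1)] by auto
    moreover have "measure lborel (A' \<inter> ball 0 R) \<le> measure lborel (polarize v A' \<inter> ball 0 R)"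
      using v(1) inv(1)[OF p(1)] by (rule polarize_Int_ball_mono)
    ultimately show False using up[OF v(1)] z(2) unfolding p(2) \<Phi>_def fst_conv snd_conv by linarith
  qed
  ultimately show ?thesis using p(1) by blast
qed

lemma en_swap:
  assumes [measurable]: "A \<in> sets borel" "C \<in> sets borel" "J \<in> borel_measurable borel"
  shows "en J A C = en J C A"
proof -
  have "en J A C = (\<integral>\<^sup>+x. \<integral>\<^sup>+y. indicator A x * indicator C y * J (norm (x - y)) \<partial>lborel \<partial>lborel)"
    unfolding en_def by (rule lborel_pair.Fubini') measurable
  then show ?thesis by (simp add: en_def norm_minus_commute mult.commute mult.left_commute)
qed

lemma en_mono: "A \<subseteq> A' \<Longrightarrow> C \<subseteq> C' \<Longrightarrow> en J A C \<le> en J A' C'"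
  unfolding en_def by (intro nn_integral_mono mult_right_mono mult_mono) (auto simp: indicator_def)

lemma en_Un_le:
  assumes [measurable]: "A \<in> sets borel" "A' \<in> sets borel" "C \<in> sets borel" "J \<in> borel_measurable borel"
  shows "en J (A \<union> A') C \<le> en J A C + en J A' C"
proof -
  have "en J (A \<union> A') C \<le> (\<integral>\<^sup>+y. \<integral>\<^sup>+x. indicator A x * indicator C y * J (norm (x - y)) + indicator A' x * indicator C y * J (norm (x - y)) \<partial>lborel \<partial>lborel)"
    unfolding en_def by (intro nn_integral_mono) (auto simp: indicator_def)
  also have "\<dots> = (\<integral>\<^sup>+y. (\<integral>\<^sup>+x. indicator A x * indicator C y * J (norm (x - y)) \<partial>lborel) + (\<integral>\<^sup>+x. indicator A' x * indicator C y * J (norm (x - y)) \<partial>lborel) \<partial>lborel)"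
    by (intro nn_integral_cong nn_integral_add) measurable
  also have "\<dots> = en J A C + en J A' C"
    unfolding en_def by (rule nn_integral_add) measurable
  finally show ?thesis .
qed

lemma nn_integral_radial_translate:
  fixes y :: "'a::euclidean_space"
  assumes [measurable]: "J \<in> borel_measurable borel"
  shows "(\<integral>\<^sup>+x. J (norm (x - y)) \<partial>lborel) = (\<integral>\<^sup>+x. J (norm (x :: 'a)) \<partial>lborel)"
proof -
  have "(\<integral>\<^sup>+x. J (norm (x :: 'a)) \<partial>distr lborel borel ((+) (- y))) = (\<integral>\<^sup>+x. J (norm (- y + x)) \<partial>lborel)"
    by (subst nn_integral_distr) auto
  then show ?thesis unfolding lborel_distr_plus by simp
qed

lemma en_le_measure:
  fixes C :: "'a::euclidean_space set"
  assumes [measurable]: "C \<in> sets borel" "J \<in> borel_measurable borel"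
  shows "en J A C \<le> emeasure lborel C * (\<integral>\<^sup>+x. J (norm (x :: 'a)) \<partial>lborel)"
proof -
  have "en J A C \<le> (\<integral>\<^sup>+y. indicator C y * (\<integral>\<^sup>+x. J (norm (x - y)) \<partial>lborel) \<partial>lborel)"
    unfolding en_def
    by (subst nn_integral_cmult[symmetric], measurable, intro nn_integral_mono) (auto simp: indicator_def)
  also have "\<dots> = (\<integral>\<^sup>+y. (\<integral>\<^sup>+x. J (norm (x :: 'a)) \<partial>lborel) * indicator C y \<partial>lborel)"
    by (simp add: nn_integral_radial_translate[OF assms(2)] mult.commute)
  also have "\<dots> = emeasure lborel C * (\<integral>\<^sup>+x. J (norm (x :: 'a)) \<partial>lborel)"
    by (subst nn_integral_cmult_indicator) (auto simp: mult.commute)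
  finally show ?thesis .
qed

lemma en_le_Diff:
  fixes A B C :: "'a::euclidean_space set"
  assumes [measurable]: "A \<in> sets borel" "B \<in> sets borel" "C \<in> sets borel" "J \<in> borel_measurable borel"
  shows "en J A C \<le> en J B C + emeasure lborel (A - B) * (\<integral>\<^sup>+x. J (norm (x :: 'a)) \<partial>lborel)"
proof -
  have "en J A C \<le> en J (B \<union> (A - B)) C" by (intro en_mono) auto
  also have "\<dots> \<le> en J B C + en J (A - B) C" by (rule en_Un_le) auto
  also have "\<dots> \<le> en J B C + emeasure lborel (A - B) * (\<integral>\<^sup>+x. J (norm (x :: 'a)) \<partial>lborel)"
    by (intro add_left_mono, subst en_swap) (auto intro!: en_le_measure)
  finally show ?thesis .
qed

text \<open>The polarized sets are only close to the balls, but a kernel of finite integral makes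
  the energy Lipschitz in measure: each of the two replacements costs at most
  \<open>\<eta> * K\<close>.\<close>

theorem Riesz_rearrangement_radial:
  fixes A C :: "'a::euclidean_space set"
  assumes A: "A \<in> fmeasurable lborel" "measure lborel (ball (0::'a) R) = measure lborel A"
    and C: "C \<in> fmeasurable lborel" "measure lborel (ball (0::'a) S) = measure lborel C"
    and J[measurable]: "J \<in> borel_measurable borel" and anti: "antimono_on {0..} J"
    and fin: "(\<integral>\<^sup>+x. J (norm (x :: 'a)) \<partial>lborel) = ennreal K" "0 \<le> K"
  shows "en J A C \<le> en J (ball (0::'a) R) (ball 0 S)"
proof (rule ennreal_le_epsilon)
  fix e :: real assume e: "0 < e"
  define \<eta> where "\<eta> = e / (2 * (K + 1))"
  have "\<eta> * (2 * (K + 1)) = e" "0 < \<eta>" using e fin(2) by (auto simp: \<eta>_def)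
  then have \<eta>: "0 < \<eta>" "\<eta> * K + \<eta> * K \<le> e" by (auto simp: algebra_simps)
  obtain A' C' where p: "polarized A C A' C'" and small: "measure lborel (A' - ball 0 R) < \<eta>" "measure lborel (C' - ball 0 S) < \<eta>"
    using ex_polarized_near_ball[OF A C \<eta>(1)] by blast
  have sA: "A \<in> sets borel" "C \<in> sets borel" using A C by (auto simp: fmeasurable_def)
  note i = polarized_invariants[OF p sA]
  have [measurable]: "A' \<in> sets borel" "C' \<in> sets borel" by (fact i(1), fact i(2))
  have f: "A' \<in> fmeasurable lborel" "C' \<in> fmeasurable lborel" using i(1-4) A C by (auto simp: fmeasurable_def)
  have tail: "emeasure lborel (A' - ball 0 R) \<le> ennreal \<eta>" "emeasure lborel (C' - ball 0 S) \<le> ennreal \<eta>"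
    using small fmeasurable_Diff[OF f(1), of "ball 0 R"] fmeasurable_Diff[OF f(2), of "ball 0 S"]
    by (auto simp: emeasure_eq_measure2 ennreal_leI)
  have "en J A C \<le> en J A' C'" by (rule i(7)[OF J anti])
  also have "\<dots> \<le> en J (ball 0 R) C' + emeasure lborel (A' - ball 0 R) * ennreal K"
    unfolding fin(1)[symmetric] by (rule en_le_Diff) auto
  also have "\<dots> \<le> (en J (ball (0::'a) R) (ball 0 S) + emeasure lborel (C' - ball 0 S) * ennreal K) + emeasure lborel (A' - ball 0 R) * ennreal K"
  proof (rule add_right_mono)
    have "en J C' (ball 0 R) \<le> en J (ball (0::'a) S) (ball 0 R) + emeasure lborel (C' - ball 0 S) * ennreal K"
      unfolding fin(1)[symmetric] by (rule en_le_Diff) auto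
    then show "en J (ball 0 R) C' \<le> en J (ball (0::'a) R) (ball 0 S) + emeasure lborel (C' - ball 0 S) * ennreal K"
      by (simp add: en_swap[of "ball 0 R" C'] en_swap[of "ball 0 R" "ball 0 S"])
  qed
  also have "\<dots> \<le> (en J (ball (0::'a) R) (ball 0 S) + ennreal \<eta> * ennreal K) + ennreal \<eta> * ennreal K"
    using tail by (intro add_mono mult_right_mono) auto
  also have "\<dots> = en J (ball (0::'a) R) (ball 0 S) + ennreal (\<eta> * K + \<eta> * K)"
    using \<eta> fin(2) by (simp only: ennreal_mult ennreal_plus add.assoc less_imp_le mult_nonneg_nonneg)
  also have "\<dots> \<le> en J (ball (0::'a) R) (ball 0 S) + ennreal e" using \<eta>(2) by (intro add_left_mono ennreal_leI)
  finally show "en J A C \<le> en J (ball (0::'a) R) (ball 0 S) + ennreal e" .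
qed

section \<open>Caps of the ball and quantiles of sets with small Brunn-Minkowski deficit\<close>

lemma power_tangent_le:
  fixes u v :: real
  assumes "0 \<le> u" "0 \<le> v" "0 < n"
  shows "v ^ n + real n * v ^ (n - 1) * (u - v) \<le> u ^ n"
proof (cases "v = 0")
  case True
  then show ?thesis using assms by (cases "n = 1") (auto simp: power_0_left)
next
  case False
  then have v: "v > 0" using assms by simp
  have "1 + real n * ((u - v) / v) \<le> (1 + (u - v) / v) ^ n"
    using assms v by (intro Bernoulli_inequality) (simp add: field_simps)
  also have "1 + (u - v) / v = u / v" using v by (simp add: field_simps)
  finally have "v ^ n * (1 + real n * ((u - v) / v)) \<le> v ^ n * (u / v) ^ n"
    using v by (intro mult_left_mono) auto
  moreover have "v ^ n * (u / v) ^ n = u ^ n" using v by (simp add: power_divide)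
  moreover have "v ^ n * (1 + real n * ((u - v) / v)) = v ^ n + real n * v ^ (n - 1) * (u - v)"
  proof -
    have "v ^ n = v ^ (n - 1) * v" using assms by (metis power_minus_mult)
    then show ?thesis using v by (simp add: field_simps)
  qed
  ultimately show ?thesis by simp
qed

text \<open>A second-order lower bound for the n-th root of 1 + z, with z = y^n - 1. The tangent to
  the power function at \<open>y\<close> gives 1 + z <= y (1 + (1 - 1/n) z), and the quadratic
  polynomial stays below the resulting quotient for all z above -1; \<open>y = 0\<close> is the
  remaining endpoint.\<close>

lemma root_quadratic_lower:
  fixes y :: real
  assumes "0 \<le> y" "0 < n"
  shows "1 + (y ^ n - 1) / n - (y ^ n - 1)\<^sup>2 \<le> y"
proof (cases "y = 0")
  case True
  then show ?thesis using assms by (simp add: power_0_left)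
next
  case False
  then have y: "0 < y" using assms by simp
  define z where "z = y ^ n - 1"
  define p where "p = 1 / real n"
  have p: "0 < p" "p \<le> 1" using assms by (auto simp: p_def)
  have z: "- 1 < z" using y by (simp add: z_def)
  define q where "q = 1 - p"
  have q: "0 \<le> q" "q < 1" using p by (auto simp: q_def)
  have den: "0 < 1 + q * z"
  proof (cases "z \<ge> 0")
    case False
    then have "q * z \<ge> 1 * z" using q by (intro mult_right_mono_neg) auto
    then show ?thesis using z by simp
  qed (use q in \<open>simp add: add_pos_nonneg\<close>)
  have "y ^ n + real n * y ^ (n - 1) * (1 - y) \<le> 1 ^ n"
    using assms by (intro power_tangent_le) auto
  then have "real n * y ^ (n - 1) * (1 - y) \<le> - z" by (simp add: z_def)
  then have "(real n * y ^ (n - 1) * (1 - y)) * y \<le> - z * y" using y by (intro mult_right_mono) auto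
  moreover have "y ^ (n - 1) * y = 1 + z" using power_minus_mult[OF \<open>0 < n\<close>, of y] by (simp add: z_def)
  ultimately have "real n * (1 + z) * (1 - y) \<le> - z * y"
    by (metis mult.assoc mult.commute)
  then have "(1 + z) * (1 - y) \<le> - (p * z * y)"
    using assms by (simp add: p_def field_simps)
  then have "1 + z \<le> y * (1 + q * z)" by (simp add: q_def algebra_simps)
  moreover have "(1 + p * z - z\<^sup>2) * (1 + q * z) \<le> 1 + z"
  proof -
    have "1 + z - (1 + p * z - z\<^sup>2) * (1 + q * z) = z\<^sup>2 * (1 - p * q + q * z)"
      by (simp add: q_def power2_eq_square algebra_simps)
    moreover have "1 - p * q + q * z \<ge> 0"
    proof -
      have "1 - p * q + q * z \<ge> 1 - p * q - q"
      proof -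
        have "q * z \<ge> q * (- 1)" using q z by (intro mult_left_mono) auto
        then show ?thesis by simp
      qed
      moreover have "1 - p * q - q = p * p" by (simp add: q_def algebra_simps)
      ultimately show ?thesis using p by (metis order_trans zero_le_square)
    qed
    ultimately show ?thesis by (smt (verit) mult_nonneg_nonneg zero_le_power2)
  qed
  ultimately have "(1 + p * z - z\<^sup>2) * (1 + q * z) \<le> y * (1 + q * z)" by linarith
  then have "1 + p * z - z\<^sup>2 \<le> y" using den by simp
  then show ?thesis by (simp add: z_def p_def)
qed

text \<open>Evaluates Brunn-Minkowski for the fraction \<open>m\<close> of a body of radius
  \<open>a\<close> and the fraction \<open>c\<close> of a ball of radius \<open>r\<close>. Equal
  fractions give \<open>m * (a + r) ^ n\<close>; a larger cap gains \<open>c - m\<close> to first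
  order, at the price of a quadratic error.\<close>

lemma Minkowski_sum_volume_lower:
  fixes a r m c :: real
  assumes "0 < a" "0 < r" "0 < m" "0 \<le> c" "0 < n"
  shows "m * (a + r) ^ n + r * (a + r) ^ (n - 1) * ((c - m) - n * (c - m)\<^sup>2 / m)
    \<le> (a * root n m + r * root n c) ^ n"
proof -
  define y where "y = root n (c / m)"
  have y: "0 \<le> y" "y ^ n = c / m" using assms by (auto simp: y_def real_root_pow_pos2)
  define z where "z = c / m - 1"
  have "1 + z / n - z\<^sup>2 \<le> y" using root_quadratic_lower[OF y(1) \<open>0 < n\<close>] by (simp add: y z_def)
  then have "r * (z / n - z\<^sup>2) \<le> r * (y - 1)" using assms by (intro mult_left_mono) auto
  then have "real n * (a + r) ^ (n - 1) * (r * (z / n - z\<^sup>2)) \<le> real n * (a + r) ^ (n - 1) * (r * (y - 1))"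
    using assms by (intro mult_left_mono) auto
  also have "r * (y - 1) = (a + r * y) - (a + r)" by (simp add: algebra_simps)
  also have "(a + r) ^ n + real n * (a + r) ^ (n - 1) * ((a + r * y) - (a + r)) \<le> (a + r * y) ^ n"
    using assms y by (intro power_tangent_le) auto
  finally have "(a + r) ^ n + real n * (a + r) ^ (n - 1) * (r * (z / n - z\<^sup>2)) \<le> (a + r * y) ^ n" by simp
  then have "m * ((a + r) ^ n + real n * (a + r) ^ (n - 1) * (r * (z / n - z\<^sup>2))) \<le> m * (a + r * y) ^ n"
    using assms by (intro mult_left_mono) auto
  also have "m * (a + r * y) ^ n = (root n m * (a + r * y)) ^ n"
    using assms by (simp add: power_mult_distrib real_root_pow_pos2)
  also have "root n m * (a + r * y) = a * root n m + r * root n c"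
    using assms by (simp add: y_def real_root_divide algebra_simps)
  finally have *: "m * ((a + r) ^ n + real n * (a + r) ^ (n - 1) * (r * (z / n - z\<^sup>2))) \<le> (a * root n m + r * root n c) ^ n" .
  have mz: "m * z = c - m" using assms by (simp add: z_def field_simps)
  have mz2: "m * z\<^sup>2 = (c - m)\<^sup>2 / m"
    using assms by (simp add: z_def field_simps power2_eq_square)
  have "real n * (m * (z / n - z\<^sup>2)) = m * z - n * (m * z\<^sup>2)"
    using assms by (simp add: field_simps)
  moreover have "m * (real n * (a + r) ^ (n - 1) * (r * (z / n - z\<^sup>2))) = r * (a + r) ^ (n - 1) * (real n * (m * (z / n - z\<^sup>2)))"
    by (simp only: mult_ac)
  ultimately have "m * (real n * (a + r) ^ (n - 1) * (r * (z / n - z\<^sup>2))) = r * (a + r) ^ (n - 1) * (m * z - n * (m * z\<^sup>2))"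
    by simp
  also have "\<dots> = r * (a + r) ^ (n - 1) * ((c - m) - n * (c - m)\<^sup>2 / m)" by (simp add: mz mz2)
  finally have E: "m * (real n * (a + r) ^ (n - 1) * (r * (z / n - z\<^sup>2))) = r * (a + r) ^ (n - 1) * ((c - m) - n * (c - m)\<^sup>2 / m)" .
  show ?thesis using * unfolding distrib_left E .
qed

lemma measure_lborel_ball: "0 \<le> r \<Longrightarrow> measure lborel (ball (c::'a::euclidean_space) r) = measure lborel (ball (0::'a) 1) * r ^ DIM('a)"
  by (simp add: measure_def emeasure_ball ennreal_mult[symmetric])

lemma measure_unit_ball_pos: "0 < measure lborel (ball (0::'a::euclidean_space) 1)"
  by (simp add: measure_def emeasure_ball)

text \<open>The distribution function of the coordinate along \<open>b\<close> for the uniform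
  measure on the unit ball. Its quantiles are the yardstick for those of \<open>A\<close>.\<close>

definition cap_frac :: "'a::euclidean_space \<Rightarrow> real \<Rightarrow> real" where
  "cap_frac b s = measure lborel (ball (0::'a) 1 \<inter> {x. x \<bullet> b < s}) / measure lborel (ball (0::'a) 1)"

lemma measure_scaled_cap:
  fixes b :: "'a::euclidean_space"
  assumes "0 < r"
  shows "measure lborel (ball (0::'a) r \<inter> {x. x \<bullet> b < r * s}) = measure lborel (ball (0::'a) 1) * (r ^ DIM('a) * cap_frac b s)"
proof -
  let ?S = "ball (0::'a) r \<inter> {x. x \<bullet> b < r * s}"
  have vim: "(\<lambda>x. 0 + r *\<^sub>R x) -` ?S = ball 0 1 \<inter> {x. x \<bullet> b < s}"
    using assms by (auto simp: abs_mult)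
  have "emeasure lborel ?S = emeasure (density (distr lborel borel (\<lambda>x. 0 + r *\<^sub>R x)) (\<lambda>_. ennreal (\<bar>r\<bar> ^ DIM('a)))) ?S"
    using lborel_affine[of r "0::'a"] assms by simp
  also have "\<dots> = ennreal (r ^ DIM('a)) * emeasure (distr lborel borel (\<lambda>x. 0 + r *\<^sub>R x)) ?S"
    using assms by (subst emeasure_density) (auto simp: nn_integral_cmult_indicator)
  also have "emeasure (distr lborel borel (\<lambda>x. 0 + r *\<^sub>R x)) ?S = emeasure lborel (ball (0::'a) 1 \<inter> {x. x \<bullet> b < s})"
    by (subst emeasure_distr) (auto simp only: vim space_lborel Int_UNIV_right, auto)
  finally have "measure lborel ?S = r ^ DIM('a) * measure lborel (ball (0::'a) 1 \<inter> {x. x \<bullet> b < s})"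
    using assms by (simp add: measure_def enn2real_mult)
  then show ?thesis using measure_unit_ball_pos[where 'a='a] by (simp add: cap_frac_def)
qed

lemma cap_frac_mono: "s \<le> t \<Longrightarrow> cap_frac b s \<le> cap_frac b t"
  unfolding cap_frac_def
  by (intro divide_right_mono measure_mono_fmeasurable) (auto intro!: fmeasurable_Int_fmeasurable)

lemma cap_frac_bounds:
  fixes b :: "'a::euclidean_space"
  shows "0 \<le> cap_frac b s" "cap_frac b s \<le> 1"
proof -
  show "0 \<le> cap_frac b s" by (simp add: cap_frac_def)
  have "measure lborel (ball 0 1 \<inter> {x. x \<bullet> b < s}) \<le> measure lborel (ball (0::'a) 1)"
    by (rule measure_mono_fmeasurable) auto
  then show "cap_frac b s \<le> 1" using measure_unit_ball_pos by (simp add: cap_frac_def)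
qed

lemma cap_frac_eq_1: "norm b = 1 \<Longrightarrow> 1 \<le> s \<Longrightarrow> cap_frac b s = 1"
proof -
  assume "norm b = 1" "1 \<le> s"
  then have "x \<in> ball 0 1 \<Longrightarrow> x \<bullet> b < s" for x
    using norm_cauchy_schwarz[of x b] by auto
  then have "ball 0 1 \<inter> {x. x \<bullet> b < s} = ball 0 1" by auto
  then show ?thesis using measure_unit_ball_pos[where 'a='a] by (simp add: cap_frac_def)
qed

lemma cap_frac_minus:
  fixes b :: "'a::euclidean_space"
  assumes b: "norm b = 1"
  shows "cap_frac b (- s) = 1 - cap_frac b s"
proof -
  have b0: "b \<noteq> 0" using b by auto
  have "emeasure (distr lborel borel uminus) (ball 0 1 \<inter> {x::'a. x \<bullet> b < - s}) = emeasure lborel (uminus -` (ball 0 1 \<inter> {x::'a. x \<bullet> b < - s}))"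
    by (subst emeasure_distr) auto
  moreover have "distr lborel borel uminus = (lborel :: 'a measure)"
    by (rule distr_lborel_isometry) (auto simp: dist_norm norm_minus_commute)
  moreover have "uminus -` (ball 0 1 \<inter> {x::'a. x \<bullet> b < - s}) = ball 0 1 \<inter> {x. s < x \<bullet> b}" by auto
  ultimately have "measure lborel (ball 0 1 \<inter> {x::'a. x \<bullet> b < - s}) = measure lborel (ball 0 1 \<inter> {x. s < x \<bullet> b})"
    by (simp add: measure_def)
  also have "\<dots> = measure lborel (ball (0::'a) 1) - measure lborel (ball 0 1 \<inter> {x::'a. x \<bullet> b < s})"
    using measure_halfspace_split[of "ball (0::'a) 1" b s] b0 by simp
  finally show ?thesis using measure_unit_ball_pos[where 'a='a] by (simp add: cap_frac_def diff_divide_distrib)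
qed

lemma isCont_cap_frac: "norm b = 1 \<Longrightarrow> isCont (cap_frac b) s"
  unfolding cap_frac_def[abs_def]
  by (intro continuous_intros isCont_measure_halfspace) (use measure_unit_ball_pos in \<open>auto simp: less_imp_neq[symmetric]\<close>)

lemma ex_cap_frac_eq:
  assumes b: "norm b = 1" and c: "0 < c" "c \<le> cap_frac b s"
  shows "\<exists>t\<le>s. cap_frac b t = c"
proof (cases "s \<le> - 1")
  case True
  then have "cap_frac b s = 0" using cap_frac_eq_1[OF b, of "- s"] cap_frac_minus[OF b, of "- s"] by simp
  then show ?thesis using c by simp
next
  case False
  have "cap_frac b (- 1) = 0" using cap_frac_eq_1[OF b, of 1] cap_frac_minus[OF b, of 1] by simp
  then have "\<exists>t\<ge>- 1. t \<le> s \<and> cap_frac b t = c"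
    using False c isCont_cap_frac[OF b] by (intro IVT) auto
  then show ?thesis by blast
qed

text \<open>Brunn-Minkowski makes the d-th root of \<open>cap_frac b\<close> concave where it is
  positive. Tangent estimates at both ends eliminate the roots; the factors
  \<open>cap_frac b x\<close> and \<open>cap_frac b z\<close> are what this costs compared with
  plain concavity.\<close>

lemma cap_frac_slope:
  fixes b :: "'a::euclidean_space"
  assumes b: "norm b = 1" and xyz: "x < y" "y < z"
  shows "(cap_frac b z - cap_frac b y) * (y - x) * cap_frac b x \<le> (cap_frac b y - cap_frac b x) * (z - y) * cap_frac b z"
proof (cases "cap_frac b x = 0")
  case True
  then show ?thesis using xyz cap_frac_bounds[of b y] cap_frac_bounds[of b z] by simp
next
  case False
  let ?d = "DIM('a)" and ?\<omega> = "measure lborel (ball (0::'a) 1)" and ?M = "cap_frac b"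
  define p where "p s = root ?d (?M s)" for s
  have p: "p s ^ ?d = ?M s" "0 \<le> p s" for s
    using cap_frac_bounds[of b s] by (auto simp: p_def real_root_pow_pos2)
  have pm: "p s \<le> p t" if "s \<le> t" for s t using cap_frac_mono[OF that, of b] by (simp add: p_def)
  have Mx: "0 < ?M x" using False cap_frac_bounds(1)[of b x] by simp
  have px: "0 < p x" using Mx by (simp add: p_def)
  have pz: "0 < p z" using px pm[of x z] xyz by simp
  \<comment> \<open>\<open>y\<close> is the mean of \<open>x\<close> and \<open>z\<close> with
    weights \<open>1 - l\<close> and \<open>l\<close>, so caps at \<open>x\<close> and
    \<open>z\<close> scaled by these weights add up inside the cap at \<open>y\<close>.\<close>
  define l where "l = (y - x) / (z - x)"
  have l: "0 < l" "l < 1" using xyz by (auto simp: l_def)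
  have yl: "y - x = l * (z - x)" using xyz by (simp add: l_def)
  have zl: "z - y = (1 - l) * (z - x)" using yl by (simp add: algebra_simps)
  let ?X = "ball (0::'a) (1 - l) \<inter> {v. v \<bullet> b < (1 - l) * x}" and ?Y = "ball (0::'a) l \<inter> {v. v \<bullet> b < l * z}"
  have "?\<omega> * ((1 - l) * p x + l * p z) ^ ?d \<le> measure lborel (ball (0::'a) 1 \<inter> {v. v \<bullet> b < y})"
  proof (rule Brunn_Minkowski[where X = ?X and Y = ?Y])
    show "measure lborel ?X = ?\<omega> * ((1 - l) * p x) ^ ?d"
      using l by (simp add: measure_scaled_cap power_mult_distrib p)
    show "measure lborel ?Y = ?\<omega> * (l * p z) ^ ?d"
      using l by (simp add: measure_scaled_cap power_mult_distrib p)
    show "open ?Y" using open_halfspace_lt[of b "l * z"] by (intro open_Int) (auto simp: inner_commute)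
    show "?X + ?Y \<subseteq> ball 0 1 \<inter> {v. v \<bullet> b < y}"
    proof (rule subsetI, elim set_plus_elim)
      fix v u w assume v: "v = u + w" "u \<in> ?X" "w \<in> ?Y"
      have "norm (u + w) \<le> norm u + norm w" by (rule norm_triangle_ineq)
      moreover have "u \<bullet> b + w \<bullet> b < y"
      proof -
        have "(1 - l) * x + l * z = y" using yl by (simp add: algebra_simps)
        then show ?thesis using v by auto
      qed
      ultimately show "v \<in> ball 0 1 \<inter> {v. v \<bullet> b < y}" using v by (auto simp: inner_add_left)
    qed
  qed (use l px pz measure_unit_ball_pos in \<open>auto intro!: fmeasurable_Int_fmeasurable\<close>)
  also have "\<dots> = ?\<omega> * p y ^ ?d" using measure_unit_ball_pos[where 'a='a] by (simp add: p cap_frac_def)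
  finally have "((1 - l) * p x + l * p z) ^ ?d \<le> p y ^ ?d"
    using measure_unit_ball_pos[where 'a='a] by simp
  then have py: "(1 - l) * p x + l * p z \<le> p y"
    using power_strict_mono[of "p y" "(1 - l) * p x + l * p z" ?d] p(2)[of y] by (meson DIM_positive not_le)
  define \<Delta> where "\<Delta> = p z - p x"
  have \<Delta>: "0 \<le> \<Delta>" using pm[of x z] xyz by (simp add: \<Delta>_def)
  have 1: "l * \<Delta> \<le> p y - p x" "p z - p y \<le> (1 - l) * \<Delta>"
    using py by (auto simp: \<Delta>_def algebra_simps)
  have My: "?d * p x ^ (?d - 1) * (l * \<Delta>) \<le> ?M y - ?M x"
  proof -
    have "?d * p x ^ (?d - 1) * (l * \<Delta>) \<le> ?d * p x ^ (?d - 1) * (p y - p x)"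
      using 1 p(2)[of x] by (intro mult_left_mono) auto
    also have "\<dots> \<le> p y ^ ?d - p x ^ ?d" using power_tangent_le[OF p(2)[of y] p(2)[of x], of ?d] by simp
    finally show ?thesis by (simp add: p)
  qed
  have Mz: "?M z - ?M y \<le> ?d * p z ^ (?d - 1) * ((1 - l) * \<Delta>)"
  proof -
    have "p z ^ ?d - p y ^ ?d \<le> ?d * p z ^ (?d - 1) * (p z - p y)"
      using power_tangent_le[OF p(2)[of y] p(2)[of z], of ?d] by (simp add: algebra_simps)
    also have "\<dots> \<le> ?d * p z ^ (?d - 1) * ((1 - l) * \<Delta>)"
      using 1 p(2)[of z] by (intro mult_left_mono) auto
    finally show ?thesis by (simp add: p)
  qed
  have zx: "0 < z - x" using xyz by simp
  have "(?M z - ?M y) * (y - x) * ?M x \<le> (?d * p z ^ (?d - 1) * ((1 - l) * \<Delta>)) * (l * (z - x)) * p x ^ ?d"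
    unfolding yl p using Mz l zx cap_frac_bounds[of b x] by (intro mult_right_mono) auto
  also have "\<dots> = (?d * (1 - l) * l * \<Delta> * (z - x)) * p z ^ (?d - 1) * p x ^ (?d - 1) * p x"
    by (simp add: power_eq_if)
  also have "\<dots> \<le> (?d * (1 - l) * l * \<Delta> * (z - x)) * p z ^ (?d - 1) * p x ^ (?d - 1) * p z"
    using l \<Delta> zx p(2) pm[of x z] by (intro mult_left_mono mult_nonneg_nonneg) auto
  also have "\<dots> = (?d * p x ^ (?d - 1) * (l * \<Delta>)) * ((1 - l) * (z - x)) * p z ^ ?d"
    by (simp add: power_eq_if)
  also have "\<dots> \<le> (?M y - ?M x) * (z - y) * ?M z"
    unfolding zl p using My l zx cap_frac_bounds[of b z] by (intro mult_right_mono) auto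
  finally show ?thesis .
qed

text \<open>The slope inequality seen from the other side, since the complement of a cap is a cap.
  This version controls growth to the right, which the upward motion of quantiles requires.\<close>

lemma cap_frac_slope':
  fixes b :: "'a::euclidean_space"
  assumes b: "norm b = 1" and xyz: "x < y" "y < z"
  shows "(cap_frac b y - cap_frac b x) * (z - y) * (1 - cap_frac b z) \<le> (cap_frac b z - cap_frac b y) * (y - x) * (1 - cap_frac b x)"
  using cap_frac_slope[OF b, of "- z" "- y" "- x"] xyz by (simp add: cap_frac_minus[OF b] algebra_simps)

text \<open>If \<open>cap_frac b\<close> were flat at a positive level below 1, the slope inequality
  up to a point beyond 1 would forbid all further growth, although the value 1 is attained
  there.\<close>

lemma cap_frac_inj:
  assumes b: "norm b = 1" and "cap_frac b x = cap_frac b y" "0 < cap_frac b x" "cap_frac b x < 1"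
  shows "x = y"
proof -
  have *: False if "x < y" "cap_frac b x = cap_frac b y" "0 < cap_frac b x" "cap_frac b x < 1" for x y
  proof -
    define z where "z = max 1 (y + 1)"
    have z: "cap_frac b z = 1" "y < z" using cap_frac_eq_1[OF b, of z] by (auto simp: z_def)
    have "0 < (1 - cap_frac b x) * (y - x) * cap_frac b x" using that by (intro mult_pos_pos) auto
    moreover have "(1 - cap_frac b x) * (y - x) * cap_frac b x \<le> 0"
      using cap_frac_slope[OF b that(1) z(2), unfolded z(1) that(2)[symmetric]] by (simp only: diff_self mult_zero_left)
    ultimately show False by linarith
  qed
  show ?thesis using *[of x y] *[of y x] assms by (cases x y rule: linorder_cases) auto
qed

text \<open>If A has measure |B| a^d and the neighbourhood A + B_r has almost the minimal measure, cutting A by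
  a hyperplane and the ball into unequal caps shows that quantiles of A cannot be spread out more than those of a ball.\<close>

locale small_BM_deficit =
  fixes A G :: "'a::euclidean_space set" and a r \<beta> :: real
  assumes A: "A \<in> fmeasurable lborel" "measure lborel A = measure lborel (ball (0::'a) 1) * a ^ DIM('a)"
    and G: "G \<in> fmeasurable lborel" "A + ball 0 r \<subseteq> G"
      "measure lborel G \<le> measure lborel (ball (0::'a) 1) * ((a + r) ^ DIM('a) + \<beta> * r * (a + r) ^ (DIM('a) - 1))"
    and pos: "0 < a" "0 < r" "0 < \<beta>"
begin

definition mfrac :: "'a \<Rightarrow> real \<Rightarrow> real" where
  "mfrac b t = measure lborel (A \<inter> {x. x \<bullet> b < t}) / measure lborel A"

lemma measure_A_pos: "0 < measure lborel A" using A(2) pos measure_unit_ball_pos[where 'a='a] by simp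

lemma mfrac_mono: "s \<le> t \<Longrightarrow> mfrac b s \<le> mfrac b t"
  unfolding mfrac_def using A(1)
  by (intro divide_right_mono measure_mono_fmeasurable) (auto intro!: fmeasurable_Int_fmeasurable)

lemma measure_lower: "measure lborel (A \<inter> {x. x \<bullet> b < t}) = measure lborel A * mfrac b t"
  using measure_A_pos by (simp add: mfrac_def)

lemma measure_upper: "b \<noteq> 0 \<Longrightarrow> measure lborel (A \<inter> {x. t < x \<bullet> b}) = measure lborel A * (1 - mfrac b t)"
  using measure_halfspace_split[OF A(1), of b t] by (simp add: measure_lower algebra_simps)

lemma ex_mfrac_eq: "b \<noteq> 0 \<Longrightarrow> 0 < m \<Longrightarrow> m < 1 \<Longrightarrow> \<exists>t. mfrac b t = m"
proof -
  assume b: "b \<noteq> 0" "0 < m" "m < 1"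
  have "\<exists>t. measure lborel (A \<inter> {x. x \<bullet> b < t}) = m * measure lborel A"
    using b measure_A_pos by (intro measure_halfspace_quantile[OF A(1)]) auto
  then obtain t where "measure lborel (A \<inter> {x. x \<bullet> b < t}) = m * measure lborel A" by blast
  then show ?thesis using measure_A_pos by (intro exI[of _ t]) (simp add: mfrac_def)
qed

text \<open>Any \<open>c\<close> up to \<open>cap_frac b \<tau>\<close> is allowed, because
  shrinking the cap keeps the sum below the same hyperplane; the fraction can thus be set to exactly
  the amount wanted in a contradiction.\<close>

lemma measure_G_lower:
  fixes m c :: real
  assumes b: "norm b = 1" and m: "mfrac b t = m" "0 < m" and c: "0 < c" "c \<le> cap_frac b \<tau>"
  shows "measure lborel (ball (0::'a) 1) * (m * (a + r) ^ DIM('a) + r * (a + r) ^ (DIM('a) - 1) * ((c - m) - DIM('a) * (c - m)\<^sup>2 / m))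
    \<le> measure lborel (G \<inter> {x. x \<bullet> b < t + r * \<tau>})"
proof -
  let ?d = "DIM('a)"
  obtain s where s: "s \<le> \<tau>" "cap_frac b s = c" using ex_cap_frac_eq[OF b c] by blast
  let ?X = "A \<inter> {x. x \<bullet> b < t}" and ?Y = "ball (0::'a) r \<inter> {x. x \<bullet> b < r * s}"
  have "measure lborel (ball (0::'a) 1) * (a * root ?d m + r * root ?d c) ^ ?d \<le> measure lborel (G \<inter> {x. x \<bullet> b < t + r * \<tau>})"
  proof (rule Brunn_Minkowski[where X = ?X and Y = ?Y])
    show "measure lborel ?X = measure lborel (ball (0::'a) 1) * (a * root ?d m) ^ ?d"
      using m by (simp add: measure_lower A(2) power_mult_distrib real_root_pow_pos2)
    show "measure lborel ?Y = measure lborel (ball (0::'a) 1) * (r * root ?d c) ^ ?d"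
      using pos c s by (simp add: measure_scaled_cap power_mult_distrib real_root_pow_pos2)
    show "open ?Y" using open_halfspace_lt[of b "r * s"] by (intro open_Int) (auto simp: inner_commute)
    show "?X + ?Y \<subseteq> G \<inter> {x. x \<bullet> b < t + r * \<tau>}"
    proof (rule subsetI, elim set_plus_elim)
      fix v u w assume v: "v = u + w" "u \<in> ?X" "w \<in> ?Y"
      then have "v \<in> A + ball 0 r" by (auto intro: set_plus_intro)
      moreover have "r * s \<le> r * \<tau>" using s pos by simp
      ultimately show "v \<in> G \<inter> {x. x \<bullet> b < t + r * \<tau>}" using v G(2) by (auto simp: inner_add_left)
    qed
  qed (use pos m c measure_unit_ball_pos[where 'a='a] A(1) G(1) in \<open>auto intro!: fmeasurable_Int_fmeasurable\<close>)
  moreover have "m * (a + r) ^ ?d + r * (a + r) ^ (?d - 1) * ((c - m) - ?d * (c - m)\<^sup>2 / m)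
    \<le> (a * root ?d m + r * root ?d c) ^ ?d"
    using pos m c by (intro Minkowski_sum_volume_lower) auto
  ultimately show ?thesis using measure_unit_ball_pos[where 'a='a] by (smt (verit) mult_left_mono)
qed

text \<open>The part of \<open>A\<close> and the cap both have fraction \<open>1 - m\<close>, the
  equality case of the volume estimate, so no correction term appears.\<close>

lemma measure_G_upper:
  assumes b: "norm b = 1" and m: "mfrac b t = m" "m < 1" and q: "cap_frac b q = m"
  shows "measure lborel (ball (0::'a) 1) * ((1 - m) * (a + r) ^ DIM('a)) \<le> measure lborel (G \<inter> {x. t + r * q < x \<bullet> b})"
proof -
  let ?d = "DIM('a)"
  have b0: "b \<noteq> 0" using b by auto
  have up: "measure lborel (ball (0::'a) r \<inter> {x. r * q < x \<bullet> b}) = measure lborel (ball (0::'a) 1) * (r ^ ?d * (1 - m))"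
  proof -
    have "measure lborel (ball (0::'a) r \<inter> {x. x \<bullet> b < r * q}) = measure lborel (ball (0::'a) 1) * (r ^ ?d * m)"
      using measure_scaled_cap[OF pos(2), where b = b and s = q] q by simp
    moreover have "measure lborel (ball (0::'a) r) = measure lborel (ball (0::'a) 1) * r ^ ?d"
      using measure_lborel_ball[of r, where c = "0::'a"] pos by simp
    moreover have "measure lborel (ball (0::'a) 1) * (r ^ ?d * (1 - m)) = measure lborel (ball (0::'a) 1) * r ^ ?d - measure lborel (ball (0::'a) 1) * (r ^ ?d * m)"
      by (simp add: right_diff_distrib)
    ultimately show ?thesis
      using measure_halfspace_split[of "ball (0::'a) r" b "r * q"] b0 by auto
  qed
  let ?X = "A \<inter> {x. t < x \<bullet> b}" and ?Y = "ball (0::'a) r \<inter> {x. r * q < x \<bullet> b}"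
  have "measure lborel (ball (0::'a) 1) * (a * root ?d (1 - m) + r * root ?d (1 - m)) ^ ?d \<le> measure lborel (G \<inter> {x. t + r * q < x \<bullet> b})"
  proof (rule Brunn_Minkowski[where X = ?X and Y = ?Y])
    show "measure lborel ?X = measure lborel (ball (0::'a) 1) * (a * root ?d (1 - m)) ^ ?d"
      using m b0 by (simp add: measure_upper A(2) power_mult_distrib real_root_pow_pos2)
    show "measure lborel ?Y = measure lborel (ball (0::'a) 1) * (r * root ?d (1 - m)) ^ ?d"
      using m up by (simp add: power_mult_distrib real_root_pow_pos2)
    show "open ?Y" using open_halfspace_gt[where a = b and b = "r * q"] by (intro open_Int) (auto simp: inner_commute)
    show "?X + ?Y \<subseteq> G \<inter> {x. t + r * q < x \<bullet> b}"
    proof (rule subsetI, elim set_plus_elim)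
      fix v u w assume v: "v = u + w" "u \<in> ?X" "w \<in> ?Y"
      then have "v \<in> A + ball 0 r" by (auto intro: set_plus_intro)
      then show "v \<in> G \<inter> {x. t + r * q < x \<bullet> b}" using v G(2) by (auto simp: inner_add_left)
    qed
  qed (use pos m measure_unit_ball_pos[where 'a='a] A(1) G(1) in \<open>auto intro!: fmeasurable_Int_fmeasurable\<close>)
  moreover have "(a * root ?d (1 - m) + r * root ?d (1 - m)) ^ ?d = (1 - m) * (a + r) ^ ?d"
    using m by (simp add: distrib_right[symmetric] power_mult_distrib real_root_pow_pos2)
  ultimately show ?thesis by simp
qed

text \<open>The part of \<open>A\<close> below \<open>t1\<close> is paired with an oversized cap,
  the part above \<open>t2\<close> with a matching one, and \<tau> is such that both sums end at the
  same hyperplane. If the cap exceeded its share \<open>m1\<close> by \<open>K\<close>, the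
  first-order gain would outweigh the omitted slice of mass \<open>m2 - m1\<close>, the quadratic
  error and \<beta> together.\<close>

lemma cap_frac_increment_le:
  fixes K :: real
  assumes b: "norm b = 1" and m1: "mfrac b t1 = m1" and m2: "mfrac b t2 = m2" "cap_frac b q2 = m2"
    and m: "0 < m1" "m1 < m2" "m2 < 1" and \<tau>: "t1 + r * \<tau> = t2 + r * q2"
    and K: "0 < K" "(a + r) * (m2 - m1) / r + \<beta> + DIM('a) * K\<^sup>2 / m1 < K"
  shows "cap_frac b \<tau> \<le> m1 + K"
proof (rule ccontr)
  assume "\<not> ?thesis"
  then have c: "m1 + K \<le> cap_frac b \<tau>" by simp
  let ?d = "DIM('a)" and ?N = "a + r"
  have b0: "b \<noteq> 0" using b by auto
  have N: "0 < ?N" using pos by simp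
  have Nd: "?N ^ ?d = ?N * ?N ^ (?d - 1)" by (simp add: power_eq_if)
  have "measure lborel (ball (0::'a) 1) * (m1 * ?N ^ ?d + r * ?N ^ (?d - 1) * (K - ?d * K\<^sup>2 / m1)) + measure lborel (ball (0::'a) 1) * ((1 - m2) * ?N ^ ?d) \<le> measure lborel G"
    using measure_G_lower[OF b m1 m(1) _ c] measure_G_upper[OF b m2(1) m(3) m2(2)] m(1) K(1)
      measure_halfspace_split[OF G(1) b0, of "t2 + r * q2"] by (simp add: \<tau>)
  also note G(3)
  finally have "measure lborel (ball (0::'a) 1) * (m1 * ?N ^ ?d + r * ?N ^ (?d - 1) * (K - ?d * K\<^sup>2 / m1) + (1 - m2) * ?N ^ ?d)
    \<le> measure lborel (ball (0::'a) 1) * (?N ^ ?d + \<beta> * r * ?N ^ (?d - 1))" by (simp only: distrib_left)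
  then have "m1 * ?N ^ ?d + r * ?N ^ (?d - 1) * (K - ?d * K\<^sup>2 / m1) + (1 - m2) * ?N ^ ?d \<le> ?N ^ ?d + \<beta> * r * ?N ^ (?d - 1)"
    using measure_unit_ball_pos[where 'a='a] by (simp only: mult_le_cancel_left_pos)
  then have "?N ^ (?d - 1) * (r * (K - ?d * K\<^sup>2 / m1)) \<le> ?N ^ (?d - 1) * (?N * (m2 - m1) + \<beta> * r)"
    unfolding Nd by (simp add: algebra_simps)
  then have "r * (K - ?d * K\<^sup>2 / m1) \<le> ?N * (m2 - m1) + \<beta> * r"
    using N by (simp only: mult_le_cancel_left_pos zero_less_power)
  then have "K - ?d * K\<^sup>2 / m1 \<le> (?N * (m2 - m1) + \<beta> * r) / r"
    using pos by (simp add: pos_le_divide_eq mult.commute)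
  also have "\<dots> = ?N * (m2 - m1) / r + \<beta>" using pos by (simp add: add_divide_distrib)
  finally show False using K(2) by simp
qed

text \<open>By the choice of \<tau>, \<open>t2 - t1 = r * (\<tau> - q1) - r * (q2 - q1)\<close>. The
  bound on \<open>cap_frac b \<tau>\<close> and the slope inequality control
  \<open>\<tau> - q1\<close>. For \<open>K\<close> near \<open>(a + r) * (m2 - m1) / r\<close> and
  small \<open>K / m0\<close> the resulting factor is near \<open>a\<close>, the spacing of
  quantiles in a ball of radius \<open>a\<close>.\<close>

lemma quantile_step:
  fixes K :: real
  assumes b: "norm b = 1" and m1: "mfrac b t1 = m1" "cap_frac b q1 = m1" and m2: "mfrac b t2 = m2" "cap_frac b q2 = m2"
    and m: "m0 \<le> m1" "m1 < m2" "m2 < 1" "m0 \<le> 1 - m1" "0 < m0"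
    and K: "0 < K" "K < m0" "(a + r) * (m2 - m1) / r + \<beta> + DIM('a) * K\<^sup>2 / m0 < K"
  shows "t2 - t1 \<le> (r * K / ((m2 - m1) * (1 - K / m0)) - r) * (q2 - q1)"
proof -
  let ?M = "cap_frac b"
  define \<tau> where "\<tau> = (t2 + r * q2 - t1) / r"
  have \<tau>: "t1 + r * \<tau> = t2 + r * q2" using pos by (simp add: \<tau>_def)
  have t: "t1 < t2" using mfrac_mono[of t2 t1 b] m1 m2 m by (cases "t2 \<le> t1") auto
  have q: "q1 < q2" using cap_frac_mono[of q2 q1 b] m1 m2 m by (cases "q2 \<le> q1") auto
  have \<tau>q: "q2 < \<tau>" using \<tau> t pos by (smt (verit) mult_less_cancel_left_pos)
  have "DIM('a) * K\<^sup>2 / m1 \<le> DIM('a) * K\<^sup>2 / m0" using m by (intro divide_left_mono) auto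
  then have MK: "?M \<tau> \<le> m1 + K"
    using m K by (intro cap_frac_increment_le[OF b m1(1) m2 _ _ _ \<tau>]) auto
  have kap: "0 < 1 - K / m0" using K m by simp
  have r1: "(1 - K / m0) * (1 - m1) \<le> 1 - ?M \<tau>"
  proof -
    have "K * m0 \<le> K * (1 - m1)" using m K by (intro mult_left_mono) auto
    then have "K \<le> (K / m0) * (1 - m1)" using m by (simp add: pos_le_divide_eq)
    then show ?thesis using MK by (simp add: algebra_simps)
  qed
  have "(m2 - m1) * (\<tau> - q2) * ((1 - K / m0) * (1 - m1)) \<le> (m2 - m1) * (\<tau> - q2) * (1 - ?M \<tau>)"
    using r1 m \<tau>q by (intro mult_left_mono) auto
  also have "\<dots> \<le> (?M \<tau> - m2) * (q2 - q1) * (1 - m1)"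
    using cap_frac_slope'[OF b q \<tau>q] m1 m2 by simp
  finally have "(m2 - m1) * (\<tau> - q2) * (1 - K / m0) * (1 - m1) \<le> (?M \<tau> - m2) * (q2 - q1) * (1 - m1)"
    by (simp only: mult.assoc)
  moreover have "0 < 1 - m1" using m by linarith
  ultimately have "(m2 - m1) * (\<tau> - q2) * (1 - K / m0) \<le> (?M \<tau> - m2) * (q2 - q1)"
    by (simp only: mult_le_cancel_right_pos)
  moreover have "(m2 - m1) * (q2 - q1) * (1 - K / m0) \<le> (m2 - m1) * (q2 - q1) * 1"
    using m q K by (intro mult_left_mono) auto
  ultimately have "(m2 - m1) * (\<tau> - q1) * (1 - K / m0) \<le> (?M \<tau> - m1) * (q2 - q1)"
    by (simp add: algebra_simps)
  also have "\<dots> \<le> K * (q2 - q1)" using MK q by (intro mult_right_mono) auto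
  finally have "(\<tau> - q1) * ((m2 - m1) * (1 - K / m0)) \<le> K * (q2 - q1)" by (simp add: mult_ac)
  moreover have D: "0 < (m2 - m1) * (1 - K / m0)" using m kap by simp
  ultimately have "\<tau> - q1 \<le> K * (q2 - q1) / ((m2 - m1) * (1 - K / m0))" by (simp add: pos_le_divide_eq)
  then have "r * (\<tau> - q1) \<le> r * (K * (q2 - q1) / ((m2 - m1) * (1 - K / m0)))" using pos by (intro mult_left_mono) auto
  moreover have "t2 - t1 = r * (\<tau> - q1) - r * (q2 - q1)" using \<tau> by (simp add: algebra_simps)
  ultimately show ?thesis by (simp add: algebra_simps)
qed

text \<open>The step size is a compromise: at least \<open>s * m0\<close>, so that \<beta> is at
  most \<open>s\<close> times the step, and at most twice that, so that the quadratic error is also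
  of relative order \<open>s\<close>.\<close>

lemma quantile_step_uniform:
  fixes s :: real
  assumes b: "norm b = 1" and m1: "mfrac b t1 = m1" "cap_frac b q1 = m1" and m2: "mfrac b t2 = m2" "cap_frac b q2 = m2"
    and m: "m0 \<le> m1" "m1 < m2" "m2 < 1" "m0 \<le> 1 - m1" "0 < m0"
    and s: "0 < s" "(8 * DIM('a) + 8) * s \<le> 1" "\<beta> \<le> s\<^sup>2 * m0"
    and w: "s * m0 \<le> (m2 - m1) * (a + r) / r" "(m2 - m1) * (a + r) / r \<le> 2 * (s * m0)"
  shows "t2 - t1 \<le> (a + (16 * DIM('a) + 14) * s * (a + r)) * (q2 - q1)"
proof -
  define D where "D = real DIM('a)"
  have D: "1 \<le> D" by (simp add: D_def Suc_le_eq)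
  have sD: "(8 * D + 8) * s \<le> 1" using s(2) by (simp add: D_def)
  define w' where "w' = (m2 - m1) * (a + r) / r"
  \<comment> \<open>Relative excess of \<open>K\<close> over \<open>w'\<close>:
    \<open>8 * D * s\<close> absorbs the quadratic error, \<open>s\<close> absorbs \<beta>, and the
    remaining \<open>2 * s\<close> makes the inequality strict.\<close>
  define e where "e = (8 * D + 3) * s"
  have e: "0 \<le> e" "e \<le> 1" using s(1) sD D by (auto simp: e_def algebra_simps)
  define K where "K = w' * (1 + e)"
  have sm: "0 < s * m0" using s m by simp
  have w'0: "0 < w'" using w(1) sm by (simp add: w'_def)
  have K0: "0 < K" using w'0 e by (simp add: K_def)
  have K2: "K \<le> 2 * w'" using w'0 e mult_left_mono[of "1 + e" 2 w'] by (simp add: K_def)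
  have K4: "K \<le> 4 * s * m0" using K2 w(2) by (simp add: w'_def)
  have s16: "16 * s \<le> 1" using sD D s(1) mult_right_mono[of 16 "8 * D + 8" s] by linarith
  have "4 * s * m0 < 1 * m0" using s16 m s by (intro mult_strict_right_mono) auto
  then have Km: "K < m0" using K4 by simp
  have C: "(a + r) * (m2 - m1) / r + \<beta> + DIM('a) * K\<^sup>2 / m0 < K"
  proof -
    have "\<beta> \<le> s * w'"
    proof -
      have "s * (s * m0) \<le> s * w'" using w(1) s by (intro mult_left_mono) (auto simp: w'_def)
      then show ?thesis using s(3) by (simp add: power2_eq_square)
    qed
    moreover have "D * K\<^sup>2 / m0 \<le> 8 * D * s * w'"
    proof -
      have "K\<^sup>2 \<le> (4 * s * m0) * (2 * w')"
        unfolding power2_eq_square using K0 K2 K4 s m by (intro mult_mono) auto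
      then have "D * K\<^sup>2 \<le> D * ((4 * s * m0) * (2 * w'))" using D by (intro mult_left_mono) auto
      then have "D * K\<^sup>2 \<le> (8 * D * s * w') * m0" by (simp add: mult_ac)
      then show ?thesis using m by (simp add: pos_divide_le_eq)
    qed
    moreover have "s * w' + 8 * D * s * w' < e * w'"
      using s w'0 by (simp add: e_def algebra_simps)
    moreover have "(a + r) * (m2 - m1) / r = w'" by (simp add: w'_def mult.commute)
    ultimately show ?thesis by (simp add: K_def D_def[symmetric] algebra_simps)
  qed
  have q: "q1 < q2" using cap_frac_mono[of q2 q1 b] m1 m2 m by (cases "q2 \<le> q1") auto
  have "t2 - t1 \<le> (r * K / ((m2 - m1) * (1 - K / m0)) - r) * (q2 - q1)"
    by (rule quantile_step[OF b m1 m2 m K0 Km C])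
  also have "\<dots> \<le> (a + (16 * D + 14) * s * (a + r)) * (q2 - q1)"
  proof (rule mult_right_mono)
    have dm: "0 < m2 - m1" using m by simp
    have Nr: "r * K / (m2 - m1) = (a + r) * (1 + e)"
      using pos dm by (simp add: K_def w'_def)
    have km: "K / m0 \<le> 4 * s" using K4 m by (simp add: pos_divide_le_eq)
    have k0: "0 < 1 - K / m0" using Km m by simp
    have "1 + e \<le> (1 + (16 * D + 14) * s) * (1 - 4 * s)"
    proof -
      define T where "T = 4 * s * ((16 * D + 14) * s)"
      define u where "u = D * s"
      have "(1 + (16 * D + 14) * s) * (1 - 4 * s) = 1 + 16 * u + 10 * s - T"
        by (simp add: T_def u_def algebra_simps)
      moreover have "(16 * D + 14) * s \<le> 2" using sD s(1) by (simp add: algebra_simps)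
      then have "4 * s * ((16 * D + 14) * s) \<le> 4 * s * 2" using s by (intro mult_left_mono) auto
      then have "T \<le> 8 * s" by (simp add: T_def)
      moreover have "1 * s \<le> D * s" using D s(1) by (intro mult_right_mono) auto
      then have "s \<le> u" by (simp add: u_def)
      moreover have "e = 8 * u + 3 * s" by (simp add: e_def u_def algebra_simps)
      ultimately show ?thesis using s(1) by linarith
    qed
    also have "\<dots> \<le> (1 + (16 * D + 14) * s) * (1 - K / m0)"
      using km D s by (intro mult_left_mono) auto
    finally have "(a + r) * (1 + e) \<le> (a + r) * ((1 + (16 * D + 14) * s) * (1 - K / m0))"
      using pos by (intro mult_left_mono) auto
    then have "r * K / (m2 - m1) / (1 - K / m0) \<le> (a + r) * (1 + (16 * D + 14) * s)"
      using k0 by (simp add: Nr pos_divide_le_eq mult.assoc)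
    then show "r * K / ((m2 - m1) * (1 - K / m0)) - r \<le> a + (16 * D + 14) * s * (a + r)"
      by (simp add: algebra_simps)
  qed (use q in simp)
  finally show ?thesis by (simp add: D_def)
qed

text \<open>Quantile steps are chained from the median upwards, each spreading at most
  \<open>a'\<close> times as much as in the unit ball. The chain stops at level
  \<open>1 - m0\<close>, and the extra \<open>m0\<close> in the bound pays for whatever lies
  beyond.\<close>

lemma tail_le:
  fixes s :: real
  assumes b: "norm b = 1" and t0: "mfrac b t0 = 1 / 2"
    and m0: "0 < m0" "m0 \<le> 1 / 8" and s: "0 < s" "(8 * DIM('a) + 8) * s \<le> 1" "\<beta> \<le> s\<^sup>2 * m0" and \<sigma>: "0 \<le> \<sigma>"
  shows "measure lborel (A \<inter> {x. t0 + (a + (16 * DIM('a) + 14) * s * (a + r)) * \<sigma> < x \<bullet> b})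
    \<le> measure lborel A * (1 - cap_frac b \<sigma> + m0)"
proof -
  define a' where "a' = a + (16 * DIM('a) + 14) * s * (a + r)"
  have a': "0 < a'" unfolding a'_def using pos s by (intro add_pos_pos mult_pos_pos) auto
  let ?w = "s * m0"
  have w: "0 < ?w" using s m0 by simp
  have s16: "16 * s \<le> 1"
  proof -
    have "16 * s \<le> (8 * DIM('a) + 8) * s" using s(1) by (intro mult_right_mono) (auto simp: Suc_le_eq)
    then show ?thesis using s(2) by linarith
  qed
  have wm: "?w \<le> m0" using s16 s m0 by simp
  have b0: "b \<noteq> 0" using b by auto
  have half: "cap_frac b 0 = 1 / 2" using cap_frac_minus[OF b, of 0] by simp
  have ge: "measure lborel (A \<inter> {x. u < x \<bullet> b}) \<le> measure lborel (A \<inter> {x. t < x \<bullet> b})" if "t \<le> u" for t u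
    using that A(1) by (intro measure_mono_fmeasurable) (auto intro!: fmeasurable_Int_fmeasurable)
  have mid: "measure lborel (A \<inter> {x. t0 + a' * \<rho> < x \<bullet> b}) \<le> measure lborel A * (1 - cap_frac b \<rho>)"
    if \<rho>: "1 / 2 + ?w \<le> cap_frac b \<rho>" "cap_frac b \<rho> \<le> 1 - m0" for \<rho>
  proof -
    define X where "X = (cap_frac b \<rho> - 1 / 2) * (a + r) / r"
    have X: "?w \<le> X"
    proof -
      have "?w * 1 \<le> (cap_frac b \<rho> - 1 / 2) * ((a + r) / r)"
        using \<rho> pos w by (intro mult_mono) auto
      then show ?thesis by (simp add: X_def)
    qed
    \<comment> \<open>Rounding down makes \<open>X / n\<close> at least \<open>?w\<close>; it is at
      most twice that because \<open>n\<close> is at least 1.\<close>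
    define n where "n = nat \<lfloor>X / ?w\<rfloor>"
    have fl: "1 \<le> \<lfloor>X / ?w\<rfloor>" using X w by (simp add: le_floor_iff pos_le_divide_eq)
    have n: "1 \<le> n" using fl unfolding n_def by linarith
    have rn: "real n = of_int \<lfloor>X / ?w\<rfloor>" using fl by (simp add: n_def)
    have nX: "real n * ?w \<le> X" "X < (real n + 1) * ?w"
    proof -
      have "real n \<le> X / ?w" "X / ?w < real n + 1" unfolding rn by linarith+
      then show "real n * ?w \<le> X" "X < (real n + 1) * ?w"
        by (simp_all only: pos_le_divide_eq[OF w] pos_divide_less_eq[OF w])
    qed
    define \<zeta> where "\<zeta> = (cap_frac b \<rho> - 1 / 2) / n"
    have \<zeta>: "0 < \<zeta>" using \<rho>(1) w n by (simp add: \<zeta>_def)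
    have \<zeta>X: "\<zeta> * (a + r) / r = X / n" by (simp add: \<zeta>_def X_def)
    have w1: "?w \<le> X / n" using nX n by (simp add: pos_le_divide_eq mult.commute)
    have w2: "X / n \<le> 2 * ?w"
    proof -
      have "(real n + 1) * ?w \<le> (2 * real n) * ?w" using n w by (intro mult_right_mono) auto
      then show ?thesis using nX n by (simp add: pos_divide_le_eq algebra_simps)
    qed
    have n\<zeta>: "1 / 2 + n * \<zeta> = cap_frac b \<rho>" using n by (simp add: \<zeta>_def)
    have "\<exists>t q. mfrac b t = 1 / 2 + i * \<zeta> \<and> cap_frac b q = 1 / 2 + i * \<zeta> \<and> t \<le> t0 + a' * q" if "i \<le> n" for i
      using that
    proof (induction i)
      case 0
      show ?case using t0 half by (intro exI[of _ t0] exI[of _ 0]) simp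
    next
      case (Suc i)
      then obtain t1 q1 where 1: "mfrac b t1 = 1 / 2 + i * \<zeta>" "cap_frac b q1 = 1 / 2 + i * \<zeta>" "t1 \<le> t0 + a' * q1" by auto
      define m1 where "m1 = 1 / 2 + i * \<zeta>"
      define m2 where "m2 = 1 / 2 + Suc i * \<zeta>"
      have "Suc i * \<zeta> \<le> n * \<zeta>" using Suc.prems \<zeta> by (intro mult_right_mono) auto
      then have m2: "m2 \<le> 1 - m0" using n\<zeta> \<rho>(2) by (simp add: m2_def)
      have m12: "m2 - m1 = \<zeta>" by (simp add: m1_def m2_def algebra_simps)
      have m1: "1 / 2 \<le> m1" using \<zeta> by (simp add: m1_def)
      obtain t2 where t2: "mfrac b t2 = m2" using ex_mfrac_eq[OF b0, of m2] m1 m2 m12 \<zeta> m0 by auto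
      obtain q2 where q2: "cap_frac b q2 = m2"
        using ex_cap_frac_eq[OF b, of m2 1] cap_frac_eq_1[OF b, of 1] m1 m2 m12 \<zeta> m0 by auto
      have "t2 - t1 \<le> a' * (q2 - q1)"
        unfolding a'_def
        by (rule quantile_step_uniform[OF b 1(1)[folded m1_def] 1(2)[folded m1_def] t2 q2 _ _ _ _ m0(1) s])
          (use m1 m2 m12 \<zeta> m0 w1 w2 \<zeta>X in auto)
      then have "t2 \<le> t0 + a' * q2" using 1(3) by (simp add: algebra_simps)
      then show ?case using t2 q2 by (auto simp: m2_def)
    qed
    from this[of n] obtain t q where tq: "mfrac b t = cap_frac b \<rho>" "cap_frac b q = cap_frac b \<rho>" "t \<le> t0 + a' * q"
      unfolding n\<zeta> by blast
    have "0 < cap_frac b q" "cap_frac b q < 1" unfolding tq(2) using \<rho> w m0 by linarith+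
    then have "q = \<rho>" by (rule cap_frac_inj[OF b tq(2)])
    then have "t \<le> t0 + a' * \<rho>" using tq(3) by simp
    from ge[OF this] show ?thesis unfolding measure_upper[OF b0] tq(1) .
  qed
  have cap01: "cap_frac b \<sigma> \<le> 1" by (rule cap_frac_bounds)
  have "measure lborel (A \<inter> {x. t0 + a' * \<sigma> < x \<bullet> b}) \<le> measure lborel A * (1 - cap_frac b \<sigma> + m0)"
  proof -
    consider "cap_frac b \<sigma> < 1 / 2 + ?w" | "1 / 2 + ?w \<le> cap_frac b \<sigma>" "cap_frac b \<sigma> \<le> 1 - m0" | "1 - m0 < cap_frac b \<sigma>"
      by linarith
    then show ?thesis
    proof cases
      case 1
      \<comment> \<open>Less than one step above the median: half of \<open>A\<close> lies above
        \<open>t0\<close>, and \<open>?w\<close> is at most \<open>m0\<close>.\<close>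
      have "measure lborel (A \<inter> {x. t0 + a' * \<sigma> < x \<bullet> b}) \<le> measure lborel (A \<inter> {x. t0 < x \<bullet> b})"
        using a' \<sigma> by (intro ge) simp
      also have "\<dots> = measure lborel A * (1 / 2)" using measure_upper[OF b0, of t0] t0 by simp
      also have "\<dots> \<le> measure lborel A * (1 - cap_frac b \<sigma> + m0)"
        using 1 wm measure_A_pos by (intro mult_left_mono) auto
      finally show ?thesis .
    next
      case 2
      have "measure lborel A * (1 - cap_frac b \<sigma>) \<le> measure lborel A * (1 - cap_frac b \<sigma> + m0)"
        using m0 measure_A_pos by (intro mult_left_mono) auto
      then show ?thesis using mid[OF 2] by linarith
    next
      case 3
      obtain \<rho> where \<rho>: "\<rho> \<le> \<sigma>" "cap_frac b \<rho> = 1 - m0"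
        using ex_cap_frac_eq[OF b, of "1 - m0" \<sigma>] 3 m0 by auto
      have "measure lborel (A \<inter> {x. t0 + a' * \<sigma> < x \<bullet> b}) \<le> measure lborel (A \<inter> {x. t0 + a' * \<rho> < x \<bullet> b})"
        using a' \<rho>(1) by (intro ge) simp
      also have "\<dots> \<le> measure lborel A * (1 - cap_frac b \<rho>)"
        by (intro mid) (use \<rho>(2) m0 wm in linarith)+
      also have "\<dots> \<le> measure lborel A * (1 - cap_frac b \<sigma> + m0)"
        using cap01 \<rho> measure_A_pos by (intro mult_left_mono) auto
      finally show ?thesis .
    qed
  qed
  then show ?thesis by (simp add: a'_def)
qed

end

section \<open>Second moments and distance to a ball\<close>

lemma ball_sets_borel [measurable]: "ball (c::'a::euclidean_space) r \<in> sets borel"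
  by simp

text \<open>Truncation at \<open>u\<close> confines the levels to the unit interval. Tail bounds
  with an additive error therefore suffice; over unbounded levels such an error would integrate to
  infinity.\<close>

lemma nn_integral_layer_cake:
  fixes f :: "'a \<Rightarrow> real"
  assumes [measurable]: "f \<in> borel_measurable M" "S \<in> sets M" and M: "sigma_finite_measure M" and u: "0 < u"
  shows "(\<integral>\<^sup>+x. indicator S x * ennreal (min ((f x)\<^sup>2) (u\<^sup>2)) \<partial>M) =
    (\<integral>\<^sup>+\<sigma>. indicator {0..1} \<sigma> * ennreal (2 * \<sigma> * u\<^sup>2) * emeasure M {x \<in> S. u * \<sigma> < \<bar>f x\<bar>} \<partial>lborel)"
proof -
  interpret M: sigma_finite_measure M by fact
  interpret P: pair_sigma_finite M lborel ..
  have [measurable]: "{x \<in> S. u * \<sigma> < \<bar>f x\<bar>} \<in> sets M" for \<sigma>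
  proof -
    have "{x \<in> S. u * \<sigma> < \<bar>f x\<bar>} = S \<inter> {x \<in> space M. u * \<sigma> < \<bar>f x\<bar>}"
      using sets.sets_into_space[OF assms(2)] by auto
    then show ?thesis by simp
  qed
  have eq: "ennreal (min (y\<^sup>2) (u\<^sup>2)) = (\<integral>\<^sup>+\<sigma>. indicator {0..1} \<sigma> * ennreal (2 * \<sigma> * u\<^sup>2) * indicator {z. u * z < \<bar>y\<bar>} \<sigma> \<partial>lborel)" for y :: real
  proof -
    define h where "h = min (\<bar>y\<bar> / u) 1"
    have h: "0 \<le> h" "h \<le> 1" using u by (auto simp: h_def)
    have "(\<integral>\<^sup>+\<sigma>. indicator {0..1} \<sigma> * ennreal (2 * \<sigma> * u\<^sup>2) * indicator {z. u * z < \<bar>y\<bar>} \<sigma> \<partial>lborel)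
      = (\<integral>\<^sup>+\<sigma>. ennreal (2 * \<sigma> * u\<^sup>2) * indicator {0..h} \<sigma> \<partial>lborel)"
    proof (rule nn_integral_cong_AE)
      show "AE \<sigma> in lborel. indicator {0..1} \<sigma> * ennreal (2 * \<sigma> * u\<^sup>2) * indicator {z. u * z < \<bar>y\<bar>} \<sigma> = ennreal (2 * \<sigma> * u\<^sup>2) * indicator {0..h} \<sigma>"
        using AE_lborel_singleton[of h]
      proof eventually_elim
        case (elim \<sigma>)
        have "\<sigma> \<in> {0..1} \<and> u * \<sigma> < \<bar>y\<bar> \<longleftrightarrow> \<sigma> \<in> {0..h}" if "0 \<le> \<sigma>"
        proof -
          have "u * \<sigma> < \<bar>y\<bar> \<longleftrightarrow> \<sigma> < \<bar>y\<bar> / u" using u by (simp add: pos_less_divide_eq mult.commute)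
          then show ?thesis using elim that unfolding h_def by (auto simp: min_def)
        qed
        then show ?case by (cases "0 \<le> \<sigma>") (auto simp: indicator_def)
      qed
    qed
    also have "\<dots> = ennreal (h\<^sup>2 * u\<^sup>2 - 0\<^sup>2 * u\<^sup>2)"
      using h by (intro nn_integral_FTC_Icc) (auto intro!: derivative_eq_intros)
    also have "h\<^sup>2 * u\<^sup>2 - 0\<^sup>2 * u\<^sup>2 = min (y\<^sup>2) (u\<^sup>2)"
    proof -
      have "h * u = min \<bar>y\<bar> u" using u by (auto simp: h_def min_def field_simps)
      then have "h\<^sup>2 * u\<^sup>2 = (min \<bar>y\<bar> u)\<^sup>2" by (simp add: power_mult_distrib[symmetric])
      also have "\<dots> = min (y\<^sup>2) (u\<^sup>2)"
        using u abs_le_square_iff[of y u] by (auto simp: min_def)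
      finally show ?thesis by simp
    qed
    finally show ?thesis ..
  qed
  have "(\<integral>\<^sup>+x. indicator S x * ennreal (min ((f x)\<^sup>2) (u\<^sup>2)) \<partial>M) =
    (\<integral>\<^sup>+x. \<integral>\<^sup>+\<sigma>. indicator S x * (indicator {0..1} \<sigma> * ennreal (2 * \<sigma> * u\<^sup>2) * indicator {z. u * z < \<bar>f x\<bar>} \<sigma>) \<partial>lborel \<partial>M)"
    unfolding eq by (intro nn_integral_cong nn_integral_cmult[symmetric]) measurable
  also have "\<dots> = (\<integral>\<^sup>+\<sigma>. \<integral>\<^sup>+x. indicator S x * (indicator {0..1} \<sigma> * ennreal (2 * \<sigma> * u\<^sup>2) * indicator {z. u * z < \<bar>f x\<bar>} \<sigma>) \<partial>M \<partial>lborel)"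
    by (rule P.Fubini'[symmetric]) measurable
  also have "\<dots> = (\<integral>\<^sup>+\<sigma>. indicator {0..1} \<sigma> * ennreal (2 * \<sigma> * u\<^sup>2) * emeasure M {x \<in> S. u * \<sigma> < \<bar>f x\<bar>} \<partial>lborel)"
  proof (rule nn_integral_cong)
    fix \<sigma> :: real
    have "(\<integral>\<^sup>+x. indicator S x * (indicator {0..1} \<sigma> * ennreal (2 * \<sigma> * u\<^sup>2) * indicator {z. u * z < \<bar>f x\<bar>} \<sigma>) \<partial>M)
      = (\<integral>\<^sup>+x. indicator {0..1} \<sigma> * ennreal (2 * \<sigma> * u\<^sup>2) * indicator {x \<in> S. u * \<sigma> < \<bar>f x\<bar>} x \<partial>M)"
      by (intro nn_integral_cong) (auto simp: indicator_def)
    then show "(\<integral>\<^sup>+x. indicator S x * (indicator {0..1} \<sigma> * ennreal (2 * \<sigma> * u\<^sup>2) * indicator {z. u * z < \<bar>f x\<bar>} \<sigma>) \<partial>M)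
      = indicator {0..1} \<sigma> * ennreal (2 * \<sigma> * u\<^sup>2) * emeasure M {x \<in> S. u * \<sigma> < \<bar>f x\<bar>}"
      by (simp add: nn_integral_cmult_indicator)
  qed
  finally show ?thesis .
qed

lemma nn_integral_lborel_affine:
  fixes c :: "'a::euclidean_space"
  assumes a: "0 < a" and [measurable]: "f \<in> borel_measurable borel"
  shows "(\<integral>\<^sup>+x. f x \<partial>lborel) = ennreal (a ^ DIM('a)) * (\<integral>\<^sup>+x. f (c + a *\<^sub>R x) \<partial>lborel)"
proof -
  have "(\<integral>\<^sup>+x. f x \<partial>lborel) = (\<integral>\<^sup>+x. f x \<partial>density (distr lborel borel (\<lambda>x. c + a *\<^sub>R x)) (\<lambda>_. ennreal (\<bar>a\<bar> ^ DIM('a))))"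
    using lborel_affine[of a c] a by simp
  also have "\<dots> = (\<integral>\<^sup>+x. ennreal (a ^ DIM('a)) * f (c + a *\<^sub>R x) \<partial>lborel)"
    using a by (subst nn_integral_density) (auto simp: nn_integral_distr)
  also have "\<dots> = ennreal (a ^ DIM('a)) * (\<integral>\<^sup>+x. f (c + a *\<^sub>R x) \<partial>lborel)"
    by (rule nn_integral_cmult) measurable
  finally show ?thesis .
qed

lemma measure_ball_Int_halfspace_gt:
  fixes b :: "'a::euclidean_space"
  assumes "b \<noteq> 0"
  shows "measure lborel (ball (0::'a) 1 \<inter> {x. s < x \<bullet> b}) = measure lborel (ball (0::'a) 1) * (1 - cap_frac b s)"
proof -
  have "measure lborel (ball (0::'a) 1 \<inter> {x. x \<bullet> b < s}) = measure lborel (ball (0::'a) 1) * cap_frac b s"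
    using measure_unit_ball_pos[where 'a='a] by (simp add: cap_frac_def)
  then show ?thesis
    using measure_halfspace_split[of "ball (0::'a) 1" b s] assms by (simp add: right_diff_distrib)
qed

lemma ennreal_distrib_nonneg:
  assumes "0 \<le> p" "0 \<le> q" "0 \<le> r" "0 \<le> t"
  shows "ennreal (p * (q * r + t * q)) = ennreal p * (ennreal q * ennreal r + ennreal t * ennreal q)"
  using assms by (simp add: ennreal_mult)

lemma cap_frac_uminus:
  fixes b :: "'a::euclidean_space"
  assumes "norm b = 1"
  shows "cap_frac (- b) s = cap_frac b s"
proof -
  have b0: "b \<noteq> 0" using assms by auto
  have "{x. x \<bullet> - b < s} = {x. - s < x \<bullet> b}" by auto
  then have "cap_frac (- b) s = measure lborel (ball (0::'a) 1 \<inter> {x. - s < x \<bullet> b}) / measure lborel (ball (0::'a) 1)"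
    by (simp add: cap_frac_def)
  also have "\<dots> = 1 - cap_frac b (- s)"
    using measure_unit_ball_pos[where 'a='a] by (simp add: measure_ball_Int_halfspace_gt[OF b0])
  finally show ?thesis using assms by (simp add: cap_frac_minus)
qed

lemma measure_ball_slab:
  fixes b :: "'a::euclidean_space"
  assumes "norm b = 1" "0 \<le> s"
  shows "measure lborel {x \<in> ball (0::'a) 1. s < \<bar>x \<bullet> b\<bar>} = measure lborel (ball (0::'a) 1) * (2 * (1 - cap_frac b s))"
proof -
  have b0: "b \<noteq> 0" using assms by auto
  have "{x \<in> ball (0::'a) 1. s < \<bar>x \<bullet> b\<bar>} = (ball 0 1 \<inter> {x. s < x \<bullet> b}) \<union> (ball 0 1 \<inter> {x. x \<bullet> b < - s})"
    by (auto simp: abs_less_iff split: abs_split)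
  moreover have "measure lborel ((ball (0::'a) 1 \<inter> {x. s < x \<bullet> b}) \<union> (ball 0 1 \<inter> {x. x \<bullet> b < - s}))
    = measure lborel (ball (0::'a) 1 \<inter> {x. s < x \<bullet> b}) + measure lborel (ball (0::'a) 1 \<inter> {x. x \<bullet> b < - s})"
    using assms(2) by (intro measure_Un_AE) (auto intro!: fmeasurable_Int_fmeasurable)
  moreover have "measure lborel (ball (0::'a) 1 \<inter> {x. s < x \<bullet> b}) = measure lborel (ball (0::'a) 1) * (1 - cap_frac b s)"
    using b0 by (rule measure_ball_Int_halfspace_gt)
  moreover have "measure lborel (ball (0::'a) 1 \<inter> {x. x \<bullet> b < - s}) = measure lborel (ball (0::'a) 1) * cap_frac b (- s)"
    using measure_unit_ball_pos[where 'a='a] by (simp add: cap_frac_def)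
  ultimately show ?thesis using assms by (simp add: cap_frac_minus algebra_simps)
qed

text \<open>Puts the moment of the ball into layer-cake form, for a comparison with \<open>A\<close>
  level by level.\<close>

lemma nn_integral_ball_coordinate:
  fixes b :: "'a::euclidean_space"
  assumes b: "norm b = 1"
  shows "(\<integral>\<^sup>+x. indicator (ball (0::'a) 1) x * ennreal ((x \<bullet> b)\<^sup>2) \<partial>lborel)
    = (\<integral>\<^sup>+\<sigma>. indicator {0..1} \<sigma> * ennreal (2 * \<sigma>) * ennreal (measure lborel (ball (0::'a) 1) * (2 * (1 - cap_frac b \<sigma>))) \<partial>lborel)"
proof -
  have "(\<integral>\<^sup>+x. indicator (ball (0::'a) 1) x * ennreal ((x \<bullet> b)\<^sup>2) \<partial>lborel)
    = (\<integral>\<^sup>+x. indicator (ball (0::'a) 1) x * ennreal (min ((x \<bullet> b)\<^sup>2) (1\<^sup>2)) \<partial>lborel)"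
  proof (rule nn_integral_cong)
    fix x :: 'a
    have "(x \<bullet> b)\<^sup>2 \<le> 1" if "norm x < 1"
    proof -
      have "\<bar>x \<bullet> b\<bar> \<le> 1" using Cauchy_Schwarz_ineq2[of x b] b that by simp
      then show ?thesis using abs_le_square_iff[of "x \<bullet> b" 1] by simp
    qed
    then show "indicator (ball (0::'a) 1) x * ennreal ((x \<bullet> b)\<^sup>2) = indicator (ball (0::'a) 1) x * ennreal (min ((x \<bullet> b)\<^sup>2) (1\<^sup>2))"
      by (auto simp: indicator_def min_def)
  qed
  also have "\<dots> = (\<integral>\<^sup>+\<sigma>. indicator {0..1} \<sigma> * ennreal (2 * \<sigma> * 1\<^sup>2) * emeasure lborel {x \<in> ball (0::'a) 1. 1 * \<sigma> < \<bar>x \<bullet> b\<bar>} \<partial>lborel)"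
    by (rule nn_integral_layer_cake) (auto intro: sigma_finite_lborel)
  also have "\<dots> = (\<integral>\<^sup>+\<sigma>. indicator {0..1} \<sigma> * ennreal (2 * \<sigma>) * ennreal (measure lborel (ball (0::'a) 1) * (2 * (1 - cap_frac b \<sigma>))) \<partial>lborel)"
  proof (rule nn_integral_cong)
    fix \<sigma> :: real
    have "{x \<in> ball (0::'a) 1. \<sigma> < \<bar>x \<bullet> b\<bar>} = ball 0 1 \<inter> {x. \<sigma> < \<bar>x \<bullet> b\<bar>}" by auto
    also have "\<dots> \<in> fmeasurable lborel" by (intro fmeasurable_Int_fmeasurable) auto
    finally have "emeasure lborel {x \<in> ball (0::'a) 1. \<sigma> < \<bar>x \<bullet> b\<bar>} = ennreal (measure lborel {x \<in> ball (0::'a) 1. \<sigma> < \<bar>x \<bullet> b\<bar>})"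
      by (rule emeasure_eq_measure2)
    then show "indicator {0..1} \<sigma> * ennreal (2 * \<sigma> * 1\<^sup>2) * emeasure lborel {x \<in> ball (0::'a) 1. 1 * \<sigma> < \<bar>x \<bullet> b\<bar>}
      = indicator {0..1} \<sigma> * ennreal (2 * \<sigma>) * ennreal (measure lborel (ball (0::'a) 1) * (2 * (1 - cap_frac b \<sigma>)))"
      using measure_ball_slab[OF b, of \<sigma>] by (auto simp: indicator_def)
  qed
  finally show ?thesis .
qed

lemma ennreal_mult_plus:
  "0 \<le> p \<Longrightarrow> 0 \<le> x \<Longrightarrow> 0 \<le> y \<Longrightarrow> ennreal p * (ennreal x + ennreal y) = ennreal (p * (x + y))"
  by (simp add: ennreal_mult)

text \<open>Passes the truncation from the squared norm to the squares of the coordinates.\<close>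

lemma min_sum_le:
  fixes y :: "'i \<Rightarrow> real"
  assumes "finite S" "0 \<le> u" "\<And>i. i \<in> S \<Longrightarrow> 0 \<le> y i"
  shows "min (\<Sum>i\<in>S. y i) u \<le> (\<Sum>i\<in>S. min (y i) u)"
  using assms
proof (induction S rule: finite_induct)
  case (insert i S)
  then have "0 \<le> y i" "0 \<le> (\<Sum>i\<in>S. y i)" by (auto intro: sum_nonneg)
  then have "min (y i + (\<Sum>i\<in>S. y i)) u \<le> min (y i) u + min (\<Sum>i\<in>S. y i) u"
    using insert.prems(1) by (auto simp: min_def)
  also have "\<dots> \<le> min (y i) u + (\<Sum>i\<in>S. min (y i) u)" using insert by (intro add_left_mono) auto
  finally show ?case using insert by simp
qed simp

lemma power2_norm_sum_Basis: "(norm (x::'a::euclidean_space))\<^sup>2 = (\<Sum>b\<in>Basis. (x \<bullet> b)\<^sup>2)"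
  unfolding power2_norm_eq_inner by (subst euclidean_inner) (simp add: power2_eq_square)

lemma ball_moment:
  "\<exists>I. 0 \<le> I \<and> I \<le> measure lborel (ball (0::'a::euclidean_space) 1) \<and>
    (\<integral>\<^sup>+x. indicator (ball (0::'a) 1) x * ennreal ((norm x)\<^sup>2) \<partial>lborel) = ennreal I"
proof -
  have "(\<integral>\<^sup>+x. indicator (ball (0::'a) 1) x * ennreal ((norm x)\<^sup>2) \<partial>lborel) \<le> (\<integral>\<^sup>+x. indicator (ball (0::'a) 1) x \<partial>lborel)"
  proof (rule nn_integral_mono)
    fix x :: 'a
    have "(norm x)\<^sup>2 \<le> 1" if "norm x < 1" using that by (simp add: power_le_one)
    then show "indicator (ball (0::'a) 1) x * ennreal ((norm x)\<^sup>2) \<le> indicator (ball (0::'a) 1) x"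
      by (auto simp: indicator_def)
  qed
  also have "\<dots> = ennreal (measure lborel (ball (0::'a) 1))" by (simp add: emeasure_eq_measure2)
  finally have le: "(\<integral>\<^sup>+x. indicator (ball (0::'a) 1) x * ennreal ((norm x)\<^sup>2) \<partial>lborel) \<le> ennreal (measure lborel (ball (0::'a) 1))" .
  then obtain I where I: "0 \<le> I" "(\<integral>\<^sup>+x. indicator (ball (0::'a) 1) x * ennreal ((norm x)\<^sup>2) \<partial>lborel) = ennreal I"
    by (cases "\<integral>\<^sup>+x. indicator (ball (0::'a) 1) x * ennreal ((norm x)\<^sup>2) \<partial>lborel") (auto simp: top_unique)
  then show ?thesis using le by (intro exI[of _ I]) simp
qed

lemma ball_moment_scale:
  fixes c :: "'a::euclidean_space"
  assumes a: "0 < a"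
  shows "(\<integral>\<^sup>+x. indicator (ball c a) x * ennreal ((norm (x - c))\<^sup>2) \<partial>lborel)
    = ennreal (a ^ DIM('a) * a\<^sup>2) * (\<integral>\<^sup>+x. indicator (ball (0::'a) 1) x * ennreal ((norm x)\<^sup>2) \<partial>lborel)"
proof -
  have "(\<integral>\<^sup>+x. indicator (ball c a) x * ennreal ((norm (x - c))\<^sup>2) \<partial>lborel)
    = ennreal (a ^ DIM('a)) * (\<integral>\<^sup>+x. indicator (ball c a) (c + a *\<^sub>R x) * ennreal ((norm (c + a *\<^sub>R x - c))\<^sup>2) \<partial>lborel)"
    by (rule nn_integral_lborel_affine[OF a]) measurable
  also have "(\<integral>\<^sup>+x. indicator (ball c a) (c + a *\<^sub>R x) * ennreal ((norm (c + a *\<^sub>R x - c))\<^sup>2) \<partial>lborel)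
    = (\<integral>\<^sup>+x. ennreal (a\<^sup>2) * (indicator (ball (0::'a) 1) x * ennreal ((norm x)\<^sup>2)) \<partial>lborel)"
  proof (rule nn_integral_cong)
    fix x :: 'a
    have "c + a *\<^sub>R x \<in> ball c a \<longleftrightarrow> x \<in> ball 0 1" using a by (simp add: dist_norm)
    then show "indicator (ball c a) (c + a *\<^sub>R x) * ennreal ((norm (c + a *\<^sub>R x - c))\<^sup>2) = ennreal (a\<^sup>2) * (indicator (ball (0::'a) 1) x * ennreal ((norm x)\<^sup>2))"
      using a by (auto simp: indicator_def power_mult_distrib ennreal_mult)
  qed
  also have "\<dots> = ennreal (a\<^sup>2) * (\<integral>\<^sup>+x. indicator (ball (0::'a) 1) x * ennreal ((norm x)\<^sup>2) \<partial>lborel)"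
    by (rule nn_integral_cmult) measurable
  finally show ?thesis using a by (simp add: ennreal_mult mult.assoc)
qed

text \<open>Bathtub principle: removing volume v from a ball costs second moment of order v squared.\<close>

lemma moment_lower:
  fixes A :: "'a::euclidean_space set"
  assumes A: "A \<in> fmeasurable lborel" "measure lborel A = measure lborel (ball (0::'a) 1) * a ^ DIM('a)"
    and a: "0 < a" "a \<le> u"
    and v: "v = measure lborel (A - ball c a) / measure lborel A"
  shows "(\<integral>\<^sup>+x. indicator (ball c a) x * ennreal ((norm (x - c))\<^sup>2) \<partial>lborel) + ennreal (a\<^sup>2 * v\<^sup>2 / (4 * DIM('a)) * measure lborel A)
    \<le> (\<integral>\<^sup>+x. indicator A x * ennreal (min ((norm (x - c))\<^sup>2) (u\<^sup>2)) \<partial>lborel)"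
proof -
  let ?d = "DIM('a)" and ?B = "ball c a"
  let ?mA = "measure lborel A"
  have [measurable]: "A \<in> sets borel" using A(1) by (auto simp: fmeasurable_def)
  have mA: "0 < ?mA" using A(2) a measure_unit_ball_pos[where 'a='a] by simp
  have mB: "measure lborel ?B = ?mA" using a by (simp add: measure_lborel_ball[of a c] A(2))
  have fB: "?B \<in> fmeasurable lborel" by simp
  have out: "measure lborel (A - ?B) = v * ?mA" using mA by (simp add: v)
  have "measure lborel A = measure lborel (A \<inter> ?B) + measure lborel (A - ?B)"
    using A(1) by (rule measure_Int_Diff) simp
  moreover have "measure lborel ?B = measure lborel (?B \<inter> A) + measure lborel (?B - A)"
    using fB by (rule measure_Int_Diff) simp
  ultimately have inn: "measure lborel (?B - A) = v * ?mA" using mB out by (simp add: Int_commute)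
  have v0: "0 \<le> v" by (simp add: v)
  have v1: "v \<le> 1"
  proof -
    have "measure lborel (A - ?B) \<le> ?mA" using A(1) by (intro measure_mono_fmeasurable) auto
    then show ?thesis using mA by (simp add: v)
  qed
  \<comment> \<open>By Bernoulli the shell outside radius \<open>a * (1 - \<delta>)\<close> holds at
    most the fraction \<open>v / 2\<close> of the ball, so at least half of the missing part
    \<open>?B - A\<close> lies deeper, where the squared distance falls short of
    \<open>a\<^sup>2\<close> by at least \<open>a\<^sup>2 * \<delta>\<close>.\<close>
  define \<delta> where "\<delta> = v / (2 * ?d)"
  have d1: "1 \<le> real ?d" by (simp add: Suc_le_eq)
  have "v \<le> 2 * ?d" using v1 d1 by linarith
  then have \<delta>: "0 \<le> \<delta>" "\<delta> \<le> 1" using v0 d1 by (auto simp: \<delta>_def pos_divide_le_eq)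
  let ?P = "?B - A" and ?R = "(?B - A) \<inter> ball c (a * (1 - \<delta>))"
  have fP: "?P \<in> fmeasurable lborel" using fB by (intro fmeasurable_Diff) auto
  have fR: "?R \<in> fmeasurable lborel" using fP by (intro fmeasurable_Int_fmeasurable) auto
  have R: "v / 2 * ?mA \<le> measure lborel ?R"
  proof -
    have "v * ?mA = measure lborel ?R + measure lborel (?P - ball c (a * (1 - \<delta>)))"
      using measure_Int_Diff[OF fP, of "ball c (a * (1 - \<delta>))"] inn by simp
    moreover have "measure lborel (?P - ball c (a * (1 - \<delta>))) \<le> measure lborel (?B - ball c (a * (1 - \<delta>)))"
      using fB fP by (intro measure_mono_fmeasurable) (auto intro!: fmeasurable_Diff)
    moreover have "measure lborel (?B - ball c (a * (1 - \<delta>))) = ?mA - ?mA * (1 - \<delta>) ^ ?d"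
    proof -
      have "a * (1 - \<delta>) \<le> a * 1" using a \<delta> by (intro mult_left_mono) auto
      then have "measure lborel (?B - ball c (a * (1 - \<delta>))) = measure lborel ?B - measure lborel (ball c (a * (1 - \<delta>)))"
        using fB by (intro measurable_measure_Diff) auto
      moreover have "0 \<le> a * (1 - \<delta>)" using a \<delta> by simp
      ultimately show ?thesis by (simp add: mB measure_lborel_ball[of "a * (1 - \<delta>)" c] A(2) power_mult_distrib)
    qed
    moreover have "?mA - ?mA * (1 - \<delta>) ^ ?d \<le> v / 2 * ?mA"
    proof -
      have "1 + real ?d * (- \<delta>) \<le> (1 + (- \<delta>)) ^ ?d" using \<delta> by (intro Bernoulli_inequality) auto
      moreover have "real ?d * \<delta> = v / 2" using d1 by (simp add: \<delta>_def)
      ultimately have "1 - v / 2 \<le> (1 - \<delta>) ^ ?d" by simp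
      then have "?mA * (1 - v / 2) \<le> ?mA * (1 - \<delta>) ^ ?d" using mA by (intro mult_left_mono) auto
      then show ?thesis by (simp add: algebra_simps)
    qed
    ultimately show ?thesis by linarith
  qed
  let ?w = "\<lambda>x. ennreal ((norm (x - c))\<^sup>2)"
  have Z: "(\<integral>\<^sup>+x. indicator ?P x * ?w x \<partial>lborel) + ennreal (a\<^sup>2 * \<delta>) * emeasure lborel ?R \<le> ennreal (a\<^sup>2) * emeasure lborel ?P"
  proof -
    have "(\<integral>\<^sup>+x. indicator ?P x * ?w x \<partial>lborel) + ennreal (a\<^sup>2 * \<delta>) * emeasure lborel ?R
      = (\<integral>\<^sup>+x. indicator ?P x * ?w x + ennreal (a\<^sup>2 * \<delta>) * indicator ?R x \<partial>lborel)"
      by (subst nn_integral_add, measurable) (simp add: nn_integral_cmult_indicator)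
    also have "\<dots> \<le> (\<integral>\<^sup>+x. ennreal (a\<^sup>2) * indicator ?P x \<partial>lborel)"
    proof (rule nn_integral_mono)
      fix x
      have 1: "(norm (x - c))\<^sup>2 \<le> a\<^sup>2" if "x \<in> ?P"
        using that a by (intro power_mono) (auto simp: dist_norm norm_minus_commute)
      have 2: "(norm (x - c))\<^sup>2 + a\<^sup>2 * \<delta> \<le> a\<^sup>2" if "x \<in> ?R"
      proof -
        have "norm (x - c) \<le> a * (1 - \<delta>)" using that by (auto simp: dist_norm norm_minus_commute)
        then have "(norm (x - c))\<^sup>2 \<le> (a * (1 - \<delta>))\<^sup>2" by (intro power_mono) auto
        also have "\<dots> = a\<^sup>2 * (1 - \<delta>)\<^sup>2" by (simp add: power_mult_distrib)
        also have "\<dots> \<le> a\<^sup>2 * (1 - \<delta>)"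
        proof (rule mult_left_mono)
          have "(1 - \<delta>) * (1 - \<delta>) \<le> (1 - \<delta>) * 1" using \<delta> by (intro mult_left_mono) auto
          then show "(1 - \<delta>)\<^sup>2 \<le> 1 - \<delta>" by (simp add: power2_eq_square)
        qed simp
        finally show ?thesis by (simp add: algebra_simps)
      qed
      show "indicator ?P x * ?w x + ennreal (a\<^sup>2 * \<delta>) * indicator ?R x \<le> ennreal (a\<^sup>2) * indicator ?P x"
      proof (cases "x \<in> ?R")
        case True
        then show ?thesis using 2[OF True] \<delta> by (auto simp: indicator_def ennreal_plus[symmetric] ennreal_leI simp del: ennreal_plus)
      next
        case False
        then show ?thesis using 1 by (auto simp: indicator_def ennreal_leI)
      qed
    qed
    also have "\<dots> = ennreal (a\<^sup>2) * emeasure lborel ?P" by (subst nn_integral_cmult_indicator) auto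
    finally show ?thesis .
  qed
  \<comment> \<open>Outside the ball the truncated integrand is still at least
    \<open>a\<^sup>2\<close>, because \<open>a \<le> u\<close>.\<close>
  have Y: "(\<integral>\<^sup>+x. indicator (A \<inter> ?B) x * ?w x \<partial>lborel) + ennreal (a\<^sup>2) * emeasure lborel (A - ?B)
    \<le> (\<integral>\<^sup>+x. indicator A x * ennreal (min ((norm (x - c))\<^sup>2) (u\<^sup>2)) \<partial>lborel)"
  proof -
    have "(\<integral>\<^sup>+x. indicator (A \<inter> ?B) x * ?w x \<partial>lborel) + ennreal (a\<^sup>2) * emeasure lborel (A - ?B)
      = (\<integral>\<^sup>+x. indicator (A \<inter> ?B) x * ?w x + ennreal (a\<^sup>2) * indicator (A - ?B) x \<partial>lborel)"
      by (subst nn_integral_add, measurable) (simp add: nn_integral_cmult_indicator)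
    also have "\<dots> \<le> (\<integral>\<^sup>+x. indicator A x * ennreal (min ((norm (x - c))\<^sup>2) (u\<^sup>2)) \<partial>lborel)"
    proof (rule nn_integral_mono)
      fix x
      have au: "a\<^sup>2 \<le> u\<^sup>2" using a by (intro power_mono) auto
      have 1: "(norm (x - c))\<^sup>2 \<le> u\<^sup>2" if "x \<in> ?B"
        using that a by (intro power_mono) (auto simp: dist_norm norm_minus_commute)
      have 2: "a\<^sup>2 \<le> (norm (x - c))\<^sup>2" if "x \<notin> ?B"
        using that a by (intro power_mono) (auto simp: dist_norm norm_minus_commute)
      show "indicator (A \<inter> ?B) x * ?w x + ennreal (a\<^sup>2) * indicator (A - ?B) x \<le> indicator A x * ennreal (min ((norm (x - c))\<^sup>2) (u\<^sup>2))"
        using 1 2 au by (cases "x \<in> ?B"; cases "x \<in> A") (auto simp: indicator_def ennreal_leI min_def)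
    qed
    finally show ?thesis .
  qed
  have YZ: "(\<integral>\<^sup>+x. indicator ?B x * ?w x \<partial>lborel) = (\<integral>\<^sup>+x. indicator (A \<inter> ?B) x * ?w x \<partial>lborel) + (\<integral>\<^sup>+x. indicator ?P x * ?w x \<partial>lborel)"
    by (subst nn_integral_add[symmetric], measurable) (auto simp: indicator_def intro!: nn_integral_cong)
  have fO: "A - ?B \<in> fmeasurable lborel" using A(1) by (intro fmeasurable_Diff) auto
  have eq: "emeasure lborel (A - ?B) = emeasure lborel ?P" using fO fP out inn by (simp add: emeasure_eq_measure2)
  have "ennreal (a\<^sup>2 * v\<^sup>2 / (4 * ?d) * ?mA) \<le> ennreal (a\<^sup>2 * \<delta>) * emeasure lborel ?R"
  proof -
    have "a\<^sup>2 * v\<^sup>2 / (4 * ?d) * ?mA = (a\<^sup>2 * \<delta>) * (v / 2 * ?mA)" by (simp add: \<delta>_def power2_eq_square)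
    also have "ennreal \<dots> \<le> ennreal ((a\<^sup>2 * \<delta>) * measure lborel ?R)" using R \<delta> by (intro ennreal_leI mult_left_mono) auto
    also have "\<dots> = ennreal (a\<^sup>2 * \<delta>) * emeasure lborel ?R" using fR \<delta> by (simp add: emeasure_eq_measure2 ennreal_mult)
    finally show ?thesis .
  qed
  then have "(\<integral>\<^sup>+x. indicator ?B x * ?w x \<partial>lborel) + ennreal (a\<^sup>2 * v\<^sup>2 / (4 * ?d) * ?mA)
    \<le> (\<integral>\<^sup>+x. indicator (A \<inter> ?B) x * ?w x \<partial>lborel) + ((\<integral>\<^sup>+x. indicator ?P x * ?w x \<partial>lborel) + ennreal (a\<^sup>2 * \<delta>) * emeasure lborel ?R)"
    unfolding YZ add.assoc by (intro add_left_mono)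
  also have "\<dots> \<le> (\<integral>\<^sup>+x. indicator (A \<inter> ?B) x * ?w x \<partial>lborel) + ennreal (a\<^sup>2) * emeasure lborel (A - ?B)"
    unfolding eq using Z by (rule add_left_mono)
  also note Y
  finally show ?thesis .
qed

context small_BM_deficit
begin

lemma mfrac_uminus:
  assumes "norm b = 1" "mfrac b t = 1 / 2"
  shows "mfrac (- b) (- t) = 1 / 2"
proof -
  have b0: "b \<noteq> 0" using assms by auto
  have "{x. x \<bullet> - b < - t} = {x. t < x \<bullet> b}" by auto
  then have "mfrac (- b) (- t) = measure lborel (A \<inter> {x. t < x \<bullet> b}) / measure lborel A" by (simp add: mfrac_def)
  then show ?thesis using measure_upper[OF b0, of t] assms measure_A_pos by simp
qed

text \<open>The lower tail is the upper tail for \<open>- b\<close> and \<open>- t0\<close>.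
  Starting the quantile chain at the median makes this symmetry available.\<close>

lemma slab_tail_le:
  fixes s :: real
  assumes b: "norm b = 1" and t0: "mfrac b t0 = 1 / 2"
    and m0: "0 < m0" "m0 \<le> 1 / 8" and s: "0 < s" "(8 * DIM('a) + 8) * s \<le> 1" "\<beta> \<le> s\<^sup>2 * m0" and \<sigma>: "0 \<le> \<sigma>"
  shows "measure lborel {x \<in> A. (a + (16 * DIM('a) + 14) * s * (a + r)) * \<sigma> < \<bar>x \<bullet> b - t0\<bar>}
    \<le> measure lborel A * (2 * (1 - cap_frac b \<sigma>) + 2 * m0)"
proof -
  define a' where "a' = a + (16 * DIM('a) + 14) * s * (a + r)"
  have [measurable]: "A \<in> sets borel" using A(1) by (auto simp: fmeasurable_def)
  have up: "measure lborel (A \<inter> {x. t0 + a' * \<sigma> < x \<bullet> b}) \<le> measure lborel A * (1 - cap_frac b \<sigma> + m0)"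
    using tail_le[OF b t0 m0 s \<sigma>] by (simp add: a'_def)
  have "norm (- b) = 1" using b by simp
  from tail_le[OF this mfrac_uminus[OF b t0] m0 s \<sigma>]
  have dn: "measure lborel (A \<inter> {x. - t0 + a' * \<sigma> < x \<bullet> - b}) \<le> measure lborel A * (1 - cap_frac b \<sigma> + m0)"
    by (simp add: a'_def cap_frac_uminus[OF b])
  have "{x \<in> A. a' * \<sigma> < \<bar>x \<bullet> b - t0\<bar>} \<subseteq> (A \<inter> {x. t0 + a' * \<sigma> < x \<bullet> b}) \<union> (A \<inter> {x. - t0 + a' * \<sigma> < x \<bullet> - b})"
    by (auto simp: abs_less_iff split: abs_split)
  then have "measure lborel {x \<in> A. a' * \<sigma> < \<bar>x \<bullet> b - t0\<bar>} \<le> measure lborel ((A \<inter> {x. t0 + a' * \<sigma> < x \<bullet> b}) \<union> (A \<inter> {x. - t0 + a' * \<sigma> < x \<bullet> - b}))"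
    using A(1) by (intro measure_mono_fmeasurable) (auto intro!: fmeasurable.Un fmeasurable_Int_fmeasurable)
  also have "\<dots> \<le> measure lborel (A \<inter> {x. t0 + a' * \<sigma> < x \<bullet> b}) + measure lborel (A \<inter> {x. - t0 + a' * \<sigma> < x \<bullet> - b})"
    by (rule measure_Un_le) auto
  also have "\<dots> \<le> measure lborel A * (1 - cap_frac b \<sigma> + m0) + measure lborel A * (1 - cap_frac b \<sigma> + m0)"
    using up dn by linarith
  finally show ?thesis by (simp add: a'_def algebra_simps)
qed

text \<open>The tail bounds inserted into the layer-cake formula: up to the dilation
  \<open>a'\<close>, the set \<open>A\<close> has at most the coordinate moment of a ball, plus the
  error \<open>2 * m0\<close> integrated against the weight \<open>2 * \<sigma>\<close> of total
  mass 1.\<close>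

lemma coordinate_moment_le:
  fixes s :: real
  assumes b: "norm b = 1" and t0: "mfrac b t0 = 1 / 2"
    and m0: "0 < m0" "m0 \<le> 1 / 8" and s: "0 < s" "(8 * DIM('a) + 8) * s \<le> 1" "\<beta> \<le> s\<^sup>2 * m0"
    and a': "a' = a + (16 * DIM('a) + 14) * s * (a + r)"
  shows "(\<integral>\<^sup>+x. indicator A x * ennreal (min ((x \<bullet> b - t0)\<^sup>2) (a'\<^sup>2)) \<partial>lborel)
    \<le> ennreal (a'\<^sup>2 * a ^ DIM('a)) * ((\<integral>\<^sup>+x. indicator (ball (0::'a) 1) x * ennreal ((x \<bullet> b)\<^sup>2) \<partial>lborel) + ennreal (2 * m0 * measure lborel (ball (0::'a) 1)))"
proof -
  let ?w = "measure lborel (ball (0::'a) 1)" and ?d = "DIM('a)"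
  have [measurable]: "A \<in> sets borel" using A(1) by (auto simp: fmeasurable_def)
  have a'pos: "0 < a'" unfolding a' using pos s by (intro add_pos_pos mult_pos_pos) auto
  have Mm[measurable]: "cap_frac b \<in> borel_measurable borel"
    by (rule borel_measurable_continuous_onI) (simp add: isCont_cap_frac[OF b] continuous_at_imp_continuous_on)
  have "(\<integral>\<^sup>+x. indicator A x * ennreal (min ((x \<bullet> b - t0)\<^sup>2) (a'\<^sup>2)) \<partial>lborel)
    = (\<integral>\<^sup>+\<sigma>. indicator {0..1} \<sigma> * ennreal (2 * \<sigma> * a'\<^sup>2) * emeasure lborel {x \<in> A. a' * \<sigma> < \<bar>x \<bullet> b - t0\<bar>} \<partial>lborel)"
    by (rule nn_integral_layer_cake) (use a'pos in \<open>auto intro: sigma_finite_lborel\<close>)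
  also have "\<dots> \<le> (\<integral>\<^sup>+\<sigma>. ennreal (a'\<^sup>2 * a ^ ?d) * (indicator {0..1} \<sigma> * ennreal (2 * \<sigma>) * ennreal (?w * (2 * (1 - cap_frac b \<sigma>)))
      + ennreal (2 * m0 * ?w) * (ennreal (2 * \<sigma>) * indicator {0..1} \<sigma>)) \<partial>lborel)"
  proof (rule nn_integral_mono)
    fix \<sigma> :: real
    show "indicator {0..1} \<sigma> * ennreal (2 * \<sigma> * a'\<^sup>2) * emeasure lborel {x \<in> A. a' * \<sigma> < \<bar>x \<bullet> b - t0\<bar>}
      \<le> ennreal (a'\<^sup>2 * a ^ ?d) * (indicator {0..1} \<sigma> * ennreal (2 * \<sigma>) * ennreal (?w * (2 * (1 - cap_frac b \<sigma>)))
      + ennreal (2 * m0 * ?w) * (ennreal (2 * \<sigma>) * indicator {0..1} \<sigma>))"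
    proof (cases "\<sigma> \<in> {0..1}")
      case True
      then have \<sigma>: "0 \<le> \<sigma>" by simp
      have "{x \<in> A. a' * \<sigma> < \<bar>x \<bullet> b - t0\<bar>} = A \<inter> {x. a' * \<sigma> < \<bar>x \<bullet> b - t0\<bar>}" by auto
      also have "\<dots> \<in> fmeasurable lborel" using A(1) by (intro fmeasurable_Int_fmeasurable) auto
      finally have "emeasure lborel {x \<in> A. a' * \<sigma> < \<bar>x \<bullet> b - t0\<bar>} = ennreal (measure lborel {x \<in> A. a' * \<sigma> < \<bar>x \<bullet> b - t0\<bar>})"
        by (rule emeasure_eq_measure2)
      also have "\<dots> \<le> ennreal (?w * a ^ ?d * (2 * (1 - cap_frac b \<sigma>) + 2 * m0))"
        using slab_tail_le[OF b t0 m0 s \<sigma>, folded a'] A(2) by (intro ennreal_leI) simp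
      finally have "ennreal (2 * \<sigma> * a'\<^sup>2) * emeasure lborel {x \<in> A. a' * \<sigma> < \<bar>x \<bullet> b - t0\<bar>}
        \<le> ennreal (2 * \<sigma> * a'\<^sup>2) * ennreal (?w * a ^ ?d * (2 * (1 - cap_frac b \<sigma>) + 2 * m0))"
        by (rule mult_left_mono) simp
      also have "\<dots> = ennreal (2 * \<sigma> * a'\<^sup>2 * (?w * a ^ ?d * (2 * (1 - cap_frac b \<sigma>) + 2 * m0)))"
        using \<sigma> by (intro ennreal_mult'[symmetric]) simp
      also have "2 * \<sigma> * a'\<^sup>2 * (?w * a ^ ?d * (2 * (1 - cap_frac b \<sigma>) + 2 * m0))
        = a'\<^sup>2 * a ^ ?d * (2 * \<sigma> * (?w * (2 * (1 - cap_frac b \<sigma>))) + 2 * m0 * ?w * (2 * \<sigma>))"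
        by (simp add: algebra_simps)
      also have "ennreal \<dots> = ennreal (a'\<^sup>2 * a ^ ?d) * (ennreal (2 * \<sigma>) * ennreal (?w * (2 * (1 - cap_frac b \<sigma>))) + ennreal (2 * m0 * ?w) * ennreal (2 * \<sigma>))"
        using \<sigma> m0 cap_frac_bounds(2)[of b \<sigma>] pos(1) by (intro ennreal_distrib_nonneg) auto
      finally show ?thesis using True by (simp add: mult.assoc)
    qed simp
  qed
  also have "\<dots> = (\<integral>\<^sup>+\<sigma>. ennreal (a'\<^sup>2 * a ^ ?d) * (indicator {0..1} \<sigma> * ennreal (2 * \<sigma>) * ennreal (?w * (2 * (1 - cap_frac b \<sigma>)))) \<partial>lborel)
      + (\<integral>\<^sup>+\<sigma>. ennreal (a'\<^sup>2 * a ^ ?d) * (ennreal (2 * m0 * ?w) * (ennreal (2 * \<sigma>) * indicator {0..1} \<sigma>)) \<partial>lborel)"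
    unfolding distrib_left by (rule nn_integral_add) measurable
  also have "(\<integral>\<^sup>+\<sigma>. ennreal (a'\<^sup>2 * a ^ ?d) * (indicator {0..1} \<sigma> * ennreal (2 * \<sigma>) * ennreal (?w * (2 * (1 - cap_frac b \<sigma>)))) \<partial>lborel)
    = ennreal (a'\<^sup>2 * a ^ ?d) * (\<integral>\<^sup>+\<sigma>. indicator {0..1} \<sigma> * ennreal (2 * \<sigma>) * ennreal (?w * (2 * (1 - cap_frac b \<sigma>))) \<partial>lborel)"
    by (rule nn_integral_cmult) measurable
  also have "(\<integral>\<^sup>+\<sigma>. ennreal (a'\<^sup>2 * a ^ ?d) * (ennreal (2 * m0 * ?w) * (ennreal (2 * \<sigma>) * indicator {0..1} \<sigma>)) \<partial>lborel)
    = ennreal (a'\<^sup>2 * a ^ ?d) * (\<integral>\<^sup>+\<sigma>. ennreal (2 * m0 * ?w) * (ennreal (2 * \<sigma>) * indicator {0..1} \<sigma>) \<partial>lborel)"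
    by (rule nn_integral_cmult) measurable
  also have "(\<integral>\<^sup>+\<sigma>. ennreal (2 * m0 * ?w) * (ennreal (2 * \<sigma>) * indicator {0..1} \<sigma>) \<partial>lborel)
    = ennreal (2 * m0 * ?w) * (\<integral>\<^sup>+\<sigma>. ennreal (2 * \<sigma>) * indicator {0..1} \<sigma> \<partial>lborel)"
    by (rule nn_integral_cmult) measurable
  also have "(\<integral>\<^sup>+\<sigma>. ennreal (2 * \<sigma>) * indicator {0..1} \<sigma> \<partial>lborel) = ennreal (1\<^sup>2 - 0\<^sup>2)"
    by (intro nn_integral_FTC_Icc) (auto intro!: derivative_eq_intros)
  finally show ?thesis by (simp add: nn_integral_ball_coordinate[OF b] distrib_left)
qed

text \<open>About the point \<open>c\<close> of coordinate medians, the truncated moment of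
  \<open>A\<close> exceeds that of the ball by a relative error of order \<open>s\<close>, and the
  bathtub bound turns this excess into \<open>v\<^sup>2\<close>. The coordinate bound is used with
  \<open>m0 = s\<close>, which balances the discarded tails against the dilation and is the origin
  of the cube in \<open>\<beta> \<le> s ^ 3\<close>.\<close>

theorem ball_deviation:
  fixes s :: real
  assumes ra: "r \<le> a" and s: "0 < s" "(8 * DIM('a) + 8) * s \<le> 1" "\<beta> \<le> s ^ 3"
  shows "\<exists>c. (measure lborel (A - ball c a) / measure lborel A)\<^sup>2 \<le> 4 * DIM('a) * (242 * DIM('a) + 168) * s"
proof -
  let ?d = "DIM('a)" and ?w = "measure lborel (ball (0::'a) 1)" and ?mA = "measure lborel A"
  have d1: "1 \<le> real ?d" by (simp add: Suc_le_eq)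
  have w: "0 < ?w" by (rule measure_unit_ball_pos)
  have [measurable]: "A \<in> sets borel" using A(1) by (auto simp: fmeasurable_def)
  have "\<exists>t. \<forall>b\<in>Basis. mfrac b (t b) = 1 / 2"
    by (intro bchoice ballI ex_mfrac_eq) auto
  then obtain t where t: "\<And>b. b \<in> Basis \<Longrightarrow> mfrac b (t b) = 1 / 2" by blast
  define c where "c = (\<Sum>b\<in>Basis. t b *\<^sub>R b)"
  have cb: "c \<bullet> b = t b" if "b \<in> Basis" for b using that by (simp add: c_def)
  \<comment> \<open>\<open>r \<le> a\<close> bounds the dilation by \<open>1 + \<kappa>\<close>. The
    bound on \<open>s\<close> gives \<open>\<kappa> \<le> 4\<close>, hence
    \<open>\<kappa> * \<kappa> \<le> 4 * \<kappa>\<close> and the numbers 6 and 25 below.\<close>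
  define \<kappa> where "\<kappa> = (32 * real ?d + 28) * s"
  define a' where "a' = a + (16 * ?d + 14) * s * (a + r)"
  have s8: "s \<le> 1 / 8"
  proof -
    have "8 * s \<le> (8 * ?d + 8) * s" using s(1) by (intro mult_right_mono) auto
    then show ?thesis using s(2) by linarith
  qed
  have \<kappa>: "0 \<le> \<kappa>" "\<kappa> \<le> 4" using s d1 by (auto simp: \<kappa>_def algebra_simps)
  have aa': "a \<le> a'" unfolding a'_def using s pos by simp
  have a'2: "a' \<le> a * (1 + \<kappa>)"
  proof -
    have "(16 * ?d + 14) * s * (a + r) \<le> (16 * ?d + 14) * s * (2 * a)" using ra s by (intro mult_left_mono) auto
    then show ?thesis by (simp add: a'_def \<kappa>_def algebra_simps)
  qed
  have a'sq: "a'\<^sup>2 \<le> a\<^sup>2 * (1 + 6 * \<kappa>)" "a'\<^sup>2 \<le> a\<^sup>2 * 25"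
  proof -
    have "a'\<^sup>2 \<le> (a * (1 + \<kappa>))\<^sup>2" using a'2 aa' pos by (intro power_mono) auto
    also have "\<dots> = a\<^sup>2 * (1 + 2 * \<kappa> + \<kappa> * \<kappa>)" by (simp add: power2_eq_square algebra_simps)
    finally have *: "a'\<^sup>2 \<le> a\<^sup>2 * (1 + 2 * \<kappa> + \<kappa> * \<kappa>)" .
    have "\<kappa> * \<kappa> \<le> 4 * \<kappa>" using \<kappa> by (intro mult_right_mono) auto
    then have "a\<^sup>2 * (1 + 2 * \<kappa> + \<kappa> * \<kappa>) \<le> a\<^sup>2 * (1 + 6 * \<kappa>)" by (intro mult_left_mono) auto
    then show "a'\<^sup>2 \<le> a\<^sup>2 * (1 + 6 * \<kappa>)" using * by linarith
    also have "\<dots> \<le> a\<^sup>2 * 25" using \<kappa> by (intro mult_left_mono) auto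
    finally show "a'\<^sup>2 \<le> a\<^sup>2 * 25" .
  qed
  obtain I where I: "0 \<le> I" "I \<le> ?w" "(\<integral>\<^sup>+x. indicator (ball (0::'a) 1) x * ennreal ((norm x)\<^sup>2) \<partial>lborel) = ennreal I"
    using ball_moment[where 'a='a] by blast
  define v where "v = measure lborel (A - ball c a) / ?mA"
  have "(\<integral>\<^sup>+x. indicator A x * ennreal (min ((norm (x - c))\<^sup>2) (a'\<^sup>2)) \<partial>lborel)
    \<le> (\<integral>\<^sup>+x. (\<Sum>b\<in>Basis. indicator A x * ennreal (min ((x \<bullet> b - t b)\<^sup>2) (a'\<^sup>2))) \<partial>lborel)"
  proof (rule nn_integral_mono)
    fix x :: 'a
    have "(norm (x - c))\<^sup>2 = (\<Sum>b\<in>Basis. (x \<bullet> b - t b)\<^sup>2)"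
      unfolding power2_norm_sum_Basis by (intro sum.cong) (auto simp: inner_diff_left cb)
    then have "min ((norm (x - c))\<^sup>2) (a'\<^sup>2) \<le> (\<Sum>b\<in>Basis. min ((x \<bullet> b - t b)\<^sup>2) (a'\<^sup>2))"
      using min_sum_le[of Basis "a'\<^sup>2" "\<lambda>b. (x \<bullet> b - t b)\<^sup>2"] by simp
    then have "ennreal (min ((norm (x - c))\<^sup>2) (a'\<^sup>2)) \<le> (\<Sum>b\<in>Basis. ennreal (min ((x \<bullet> b - t b)\<^sup>2) (a'\<^sup>2)))"
      by (subst sum_ennreal) (auto intro: ennreal_leI)
    then show "indicator A x * ennreal (min ((norm (x - c))\<^sup>2) (a'\<^sup>2)) \<le> (\<Sum>b\<in>Basis. indicator A x * ennreal (min ((x \<bullet> b - t b)\<^sup>2) (a'\<^sup>2)))"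
      by (auto simp: indicator_def)
  qed
  also have "\<dots> = (\<Sum>b\<in>Basis. (\<integral>\<^sup>+x. indicator A x * ennreal (min ((x \<bullet> b - t b)\<^sup>2) (a'\<^sup>2)) \<partial>lborel))"
    by (rule nn_integral_sum) measurable
  also have "\<dots> \<le> (\<Sum>b\<in>Basis. ennreal (a'\<^sup>2 * a ^ ?d) * ((\<integral>\<^sup>+x. indicator (ball (0::'a) 1) x * ennreal ((x \<bullet> b)\<^sup>2) \<partial>lborel) + ennreal (2 * s * ?w)))"
    using s s8 by (intro sum_mono coordinate_moment_le) (auto simp: t a'_def power2_eq_square power3_eq_cube)
  also have "\<dots> = ennreal (a'\<^sup>2 * a ^ ?d) * ((\<Sum>b\<in>Basis. \<integral>\<^sup>+x. indicator (ball (0::'a) 1) x * ennreal ((x \<bullet> b)\<^sup>2) \<partial>lborel) + of_nat ?d * ennreal (2 * s * ?w))"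
    by (simp only: sum_distrib_left[symmetric] sum.distrib sum_constant)
  also have "(\<Sum>b\<in>Basis. \<integral>\<^sup>+x. indicator (ball (0::'a) 1) x * ennreal ((x \<bullet> b)\<^sup>2) \<partial>lborel) = ennreal I"
  proof -
    have "(\<Sum>b\<in>Basis. \<integral>\<^sup>+x. indicator (ball (0::'a) 1) x * ennreal ((x \<bullet> b)\<^sup>2) \<partial>lborel)
      = (\<integral>\<^sup>+x. (\<Sum>b\<in>Basis. indicator (ball (0::'a) 1) x * ennreal ((x \<bullet> b)\<^sup>2)) \<partial>lborel)"
      by (rule nn_integral_sum[symmetric]) measurable
    also have "\<dots> = (\<integral>\<^sup>+x. indicator (ball (0::'a) 1) x * ennreal ((norm x)\<^sup>2) \<partial>lborel)"
      by (intro nn_integral_cong) (simp add: sum_distrib_left[symmetric] power2_norm_sum_Basis sum_ennreal)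
    finally show ?thesis using I by simp
  qed
  also have "of_nat ?d * ennreal (2 * s * ?w) = ennreal (?d * (2 * s * ?w))"
    using s by (simp add: ennreal_mult ennreal_of_nat_eq_real_of_nat)
  also have "ennreal (a'\<^sup>2 * a ^ ?d) * (ennreal I + ennreal (?d * (2 * s * ?w))) = ennreal (a'\<^sup>2 * a ^ ?d * (I + ?d * (2 * s * ?w)))"
    using I s pos by (intro ennreal_mult_plus) auto
  finally have upper: "(\<integral>\<^sup>+x. indicator A x * ennreal (min ((norm (x - c))\<^sup>2) (a'\<^sup>2)) \<partial>lborel) \<le> ennreal (a'\<^sup>2 * a ^ ?d * (I + ?d * (2 * s * ?w)))" .
  have "ennreal (a ^ ?d * a\<^sup>2 * I + a\<^sup>2 * v\<^sup>2 / (4 * ?d) * ?mA) = ennreal (a ^ ?d * a\<^sup>2) * ennreal I + ennreal (a\<^sup>2 * v\<^sup>2 / (4 * ?d) * ?mA)"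
    using I pos by (simp add: ennreal_mult ennreal_plus)
  also have "\<dots> \<le> ennreal (a'\<^sup>2 * a ^ ?d * (I + ?d * (2 * s * ?w)))"
    using moment_lower[OF A pos(1) aa' v_def] upper unfolding ball_moment_scale[OF pos(1)] I(3) by (rule order_trans)
  finally have "a ^ ?d * a\<^sup>2 * I + a\<^sup>2 * v\<^sup>2 / (4 * ?d) * ?mA \<le> a'\<^sup>2 * a ^ ?d * (I + ?d * (2 * s * ?w))"
    using I s pos by (subst (asm) ennreal_le_iff) auto
  also have "a'\<^sup>2 * a ^ ?d * (I + ?d * (2 * s * ?w)) = a ^ ?d * (a'\<^sup>2 * I + a'\<^sup>2 * (?d * (2 * s * ?w)))"
    by (simp add: algebra_simps)
  also have "\<dots> \<le> a ^ ?d * (a\<^sup>2 * (1 + 6 * \<kappa>) * I + a\<^sup>2 * 25 * (?d * (2 * s * ?w)))"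
    using a'sq I s pos by (intro mult_left_mono add_mono mult_right_mono) auto
  finally have "a\<^sup>2 * v\<^sup>2 / (4 * ?d) * ?mA \<le> a ^ ?d * a\<^sup>2 * (6 * \<kappa> * I + 50 * ?d * s * ?w)"
    by (simp add: algebra_simps)
  also have "\<dots> \<le> a ^ ?d * a\<^sup>2 * (6 * \<kappa> * ?w + 50 * ?d * s * ?w)"
    using I \<kappa> pos by (intro mult_left_mono add_right_mono) auto
  also have "\<dots> = a\<^sup>2 * (6 * \<kappa> + 50 * ?d * s) * ?mA" by (simp add: A(2) algebra_simps)
  finally have "a\<^sup>2 * (v\<^sup>2 / (4 * ?d)) * ?mA \<le> a\<^sup>2 * (6 * \<kappa> + 50 * ?d * s) * ?mA" by simp
  then have "v\<^sup>2 / (4 * ?d) \<le> 6 * \<kappa> + 50 * ?d * s"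
    using pos measure_A_pos by (simp only: mult_le_cancel_right_pos mult_le_cancel_left_pos zero_less_power)
  then have "v\<^sup>2 \<le> (6 * \<kappa> + 50 * ?d * s) * (4 * ?d)" using d1 by (simp only: pos_divide_le_eq)
  also have "\<dots> = 4 * ?d * (242 * ?d + 168) * s" by (simp add: \<kappa>_def algebra_simps)
  finally show ?thesis unfolding v_def by blast
qed

end

section \<open>From the deficit of a truncated paraboloid to a Brunn-Minkowski deficit\<close>

text \<open>It vanishes from \<rho> on, the difference of the two radii, and after division by
  \<open>2 * k\<close> its slope is exactly the one granted to the kernel.\<close>

definition parab :: "real \<Rightarrow> real \<Rightarrow> ennreal" where
  "parab \<rho> t = ennreal (max 0 (\<rho>\<^sup>2 - t\<^sup>2))"

lemma parab_measurable [measurable]: "parab \<rho> \<in> borel_measurable borel"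
  unfolding parab_def[abs_def] by measurable

lemma parab_ge:
  assumes "0 \<le> t" "t \<le> u"
  shows "ennreal (\<rho>\<^sup>2 - u\<^sup>2) \<le> parab \<rho> t"
proof -
  have "t\<^sup>2 \<le> u\<^sup>2" using assms by (intro power_mono) auto
  then show ?thesis unfolding parab_def by (intro ennreal_leI) auto
qed

lemma measurable_emeasure_Int_ball [measurable]:
  fixes E :: "'a::euclidean_space set"
  assumes [measurable]: "E \<in> sets borel"
  shows "(\<lambda>y. emeasure lborel (E \<inter> ball y s)) \<in> borel_measurable borel"
proof -
  have "emeasure lborel (E \<inter> ball y s) = (\<integral>\<^sup>+x. indicator E x * indicator {t. t < s} (dist y x) \<partial>lborel)" for y
  proof -
    have "emeasure lborel (E \<inter> ball y s) = (\<integral>\<^sup>+x. indicator (E \<inter> ball y s) x \<partial>lborel)"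
      by (rule nn_integral_indicator[symmetric]) auto
    also have "\<dots> = (\<integral>\<^sup>+x. indicator E x * indicator {t. t < s} (dist y x) \<partial>lborel)"
      by (intro nn_integral_cong) (auto simp: indicator_def)
    finally show ?thesis .
  qed
  then show ?thesis by simp
qed

text \<open>\<eta> is the length scale at which boundaries are resolved, and \<open>D\<close> bounds
  the interaction of \<open>E\<close> with the outside of \<open>F\<close>. The numbers 1/4 and 1/32
  keep \<open>\<rho> - 4 * \<eta>\<close> at least 1/8.\<close>

locale small_deficit =
  fixes E F :: "'a::euclidean_space set" and \<rho> \<eta> D :: real
  assumes E: "E \<in> fmeasurable lborel" and F: "F \<in> fmeasurable lborel" and EF: "E \<subseteq> F"
    and \<rho>: "1 / 4 \<le> \<rho>" "\<rho> \<le> 3 / 4" and \<eta>: "0 < \<eta>" "\<eta> \<le> 1 / 32" and D: "0 \<le> D"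
    and deficit: "en (parab \<rho>) E (- F) \<le> ennreal D"
begin

lemma sets_EF [measurable]: "E \<in> sets borel" "F \<in> sets borel"
  using E F by (auto simp: fmeasurable_def)

text \<open>The product of \<open>\<rho> * \<eta>\<close>, a lower bound for the paraboloid at
  distance \<open>2 * \<eta>\<close> inside its rim, and the volume of the complement of
  \<open>F\<close> that a core point may see there, a quarter of \<eta> times the volume of a ball
  of radius \<eta>.\<close>

definition \<tau> :: real where "\<tau> = measure lborel (ball (0::'a) 1) * \<eta> ^ (DIM('a) + 2) * \<rho> / 4"

definition out :: "'a \<Rightarrow> ennreal" where
  "out x = (\<integral>\<^sup>+y. indicator (- F) y * parab \<rho> (norm (x - y)) \<partial>lborel)"

lemma out_measurable [measurable]: "out \<in> borel_measurable borel"
  unfolding out_def[abs_def] by measurable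

definition core :: "'a set" where "core = {x \<in> E. out x \<le> ennreal \<tau>}"

lemma \<tau>_pos: "0 < \<tau>" unfolding \<tau>_def using \<rho> \<eta> measure_unit_ball_pos[where 'a='a] by simp

lemma core_sets [measurable]: "core \<in> sets borel"
  unfolding core_def by measurable

lemma core_subset: "core \<subseteq> E" by (auto simp: core_def)

lemma core_fmeasurable: "core \<in> fmeasurable lborel"
  using core_subset E by (intro fmeasurableI2[OF E]) auto

text \<open>Markov's inequality for \<open>out\<close>, whose integral over \<open>E\<close> is the
  interaction bounded by \<open>D\<close>.\<close>

lemma measure_E_minus_core: "\<tau> * measure lborel (E - core) \<le> D"
proof -
  have fm: "E - core \<in> fmeasurable lborel" using E by (intro fmeasurable_Diff) auto
  have "ennreal \<tau> * emeasure lborel (E - core) = (\<integral>\<^sup>+x. ennreal \<tau> * indicator (E - core) x \<partial>lborel)"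
    by (subst nn_integral_cmult_indicator) auto
  also have "\<dots> \<le> (\<integral>\<^sup>+x. indicator E x * out x \<partial>lborel)"
    by (intro nn_integral_mono) (auto simp: indicator_def core_def)
  also have "\<dots> = (\<integral>\<^sup>+x. \<integral>\<^sup>+y. indicator E x * (indicator (- F) y * parab \<rho> (norm (x - y))) \<partial>lborel \<partial>lborel)"
    unfolding out_def by (intro nn_integral_cong nn_integral_cmult[symmetric]) measurable
  also have "\<dots> = (\<integral>\<^sup>+y. \<integral>\<^sup>+x. indicator E x * (indicator (- F) y * parab \<rho> (norm (x - y))) \<partial>lborel \<partial>lborel)"
    by (rule lborel_pair.Fubini'[symmetric]) measurable
  also have "\<dots> = en (parab \<rho>) E (- F)" by (simp add: en_def mult.assoc)
  also note deficit
  finally have "ennreal (\<tau> * measure lborel (E - core)) \<le> ennreal D"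
    using fm \<tau>_pos by (simp add: emeasure_eq_measure2 ennreal_mult)
  then show ?thesis using D by simp
qed

text \<open>The margin \<open>4 * \<eta>\<close> puts the ball of radius \<open>2 * \<eta>\<close>
  about any point of \<open>nbhd\<close> at least \<open>2 * \<eta>\<close> inside the rim of the
  paraboloid of some core point.\<close>

definition nbhd :: "'a set" where "nbhd = core + ball 0 (\<rho> - 4 * \<eta>)"

lemma nbhd_open: "open nbhd" unfolding nbhd_def by (rule open_plus_ball)

lemma nbhd_sets [measurable]: "nbhd \<in> sets borel" using nbhd_open by auto

text \<open>On that ball the paraboloid is at least \<open>\<rho> * \<eta>\<close>, while the core
  point sees at most \<tau> of the complement. The radius is \<open>2 * \<eta>\<close> because the
  double count below covers all points within \<eta> of a common point by one such ball.\<close>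

lemma emeasure_ball_minus_F_le:
  assumes "y \<in> nbhd"
  shows "emeasure lborel (ball y (2 * \<eta>) - F) \<le> ennreal (measure lborel (ball (0::'a) 1) * \<eta> ^ (DIM('a) + 1) / 4)"
proof -
  let ?w = "measure lborel (ball (0::'a) 1)"
  obtain x z where xz: "y = x + z" "x \<in> core" "z \<in> ball 0 (\<rho> - 4 * \<eta>)"
    using assms unfolding nbhd_def by (rule set_plus_elim)
  have pe: "0 < \<rho> * \<eta>" using \<rho> \<eta> by simp
  have "ennreal (\<rho> * \<eta>) * emeasure lborel (ball y (2 * \<eta>) - F) = (\<integral>\<^sup>+u. ennreal (\<rho> * \<eta>) * indicator (ball y (2 * \<eta>) - F) u \<partial>lborel)"
    by (subst nn_integral_cmult_indicator) auto
  also have "\<dots> \<le> out x"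
    unfolding out_def
  proof (rule nn_integral_mono)
    fix u
    show "ennreal (\<rho> * \<eta>) * indicator (ball y (2 * \<eta>) - F) u \<le> indicator (- F) u * parab \<rho> (norm (x - u))"
    proof (cases "u \<in> ball y (2 * \<eta>) - F")
      case True
      have "dist x u \<le> dist x y + dist y u" by (rule dist_triangle)
      moreover have "dist x y = norm z" by (simp add: xz dist_norm)
      ultimately have n: "norm (x - u) \<le> \<rho> - 2 * \<eta>" using True xz(3) by (auto simp: dist_norm)
      have "\<rho> * \<eta> \<le> \<rho>\<^sup>2 - (\<rho> - 2 * \<eta>)\<^sup>2"
      proof -
        have "\<rho>\<^sup>2 - (\<rho> - 2 * \<eta>)\<^sup>2 = \<rho> * \<eta> + \<eta> * (3 * \<rho> - 4 * \<eta>)" by (simp add: power2_eq_square algebra_simps)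
        moreover have "0 \<le> \<eta> * (3 * \<rho> - 4 * \<eta>)" using \<rho> \<eta> by (intro mult_nonneg_nonneg) auto
        ultimately show ?thesis by linarith
      qed
      then have "ennreal (\<rho> * \<eta>) \<le> ennreal (\<rho>\<^sup>2 - (\<rho> - 2 * \<eta>)\<^sup>2)" by (rule ennreal_leI)
      also have "\<dots> \<le> parab \<rho> (norm (x - u))" using n by (intro parab_ge) auto
      finally show ?thesis using True by simp
    qed simp
  qed
  also have "\<dots> \<le> ennreal \<tau>" using xz(2) by (simp add: core_def)
  also have "\<tau> = (\<rho> * \<eta>) * (?w * \<eta> ^ (DIM('a) + 1) / 4)" by (simp add: \<tau>_def)
  also have "ennreal \<dots> = ennreal (\<rho> * \<eta>) * ennreal (?w * \<eta> ^ (DIM('a) + 1) / 4)"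
    using pe \<eta> by (intro ennreal_mult) auto
  finally show ?thesis using pe by (subst (asm) ennreal_mult_le_mult_iff) auto
qed

text \<open>Points of \<open>nbhd\<close> outside \<open>F\<close> that have much of
  \<open>E\<close> next to them. Each contributes to the interaction near the top of the paraboloid,
  where it is at least 1/32, so the deficit itself makes them rare.\<close>

definition thick :: "'a set" where
  "thick = {y \<in> nbhd - F. ennreal (measure lborel (ball (0::'a) 1) * \<eta> ^ DIM('a) / 4) \<le> emeasure lborel (E \<inter> ball y \<eta>)}"

lemma thick_sets [measurable]: "thick \<in> sets borel"
  unfolding thick_def by measurable

lemma emeasure_thick_le:
  "ennreal (measure lborel (ball (0::'a) 1) * \<eta> ^ DIM('a) / 128) * emeasure lborel thick \<le> ennreal D"
proof -
  let ?w = "measure lborel (ball (0::'a) 1)"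
  have "ennreal (?w * \<eta> ^ DIM('a) / 128) * emeasure lborel thick = (\<integral>\<^sup>+y. ennreal (?w * \<eta> ^ DIM('a) / 128) * indicator thick y \<partial>lborel)"
    by (subst nn_integral_cmult_indicator) auto
  also have "\<dots> \<le> en (parab \<rho>) E (- F)"
    unfolding en_def
  proof (rule nn_integral_mono)
    fix y
    show "ennreal (?w * \<eta> ^ DIM('a) / 128) * indicator thick y \<le> (\<integral>\<^sup>+x. indicator E x * indicator (- F) y * parab \<rho> (norm (x - y)) \<partial>lborel)"
    proof (cases "y \<in> thick")
      case True
      have "ennreal (?w * \<eta> ^ DIM('a) / 128) = ennreal (1 / 32) * ennreal (?w * \<eta> ^ DIM('a) / 4)"
        using \<eta> by (subst ennreal_mult[symmetric]) auto
      also have "\<dots> \<le> ennreal (1 / 32) * emeasure lborel (E \<inter> ball y \<eta>)"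
        using True by (intro mult_left_mono) (auto simp: thick_def)
      also have "\<dots> = (\<integral>\<^sup>+x. ennreal (1 / 32) * indicator (E \<inter> ball y \<eta>) x \<partial>lborel)"
        by (subst nn_integral_cmult_indicator) auto
      also have "\<dots> \<le> (\<integral>\<^sup>+x. indicator E x * indicator (- F) y * parab \<rho> (norm (x - y)) \<partial>lborel)"
      proof (rule nn_integral_mono)
        fix x
        show "ennreal (1 / 32) * indicator (E \<inter> ball y \<eta>) x \<le> indicator E x * indicator (- F) y * parab \<rho> (norm (x - y))"
        proof (cases "x \<in> E \<inter> ball y \<eta>")
          case True': True
          have "1 / 32 \<le> \<rho>\<^sup>2 - \<eta>\<^sup>2"
          proof -
            have "(1 / 4)\<^sup>2 \<le> \<rho>\<^sup>2" "\<eta>\<^sup>2 \<le> (1 / 32)\<^sup>2" using \<rho> \<eta> by (intro power_mono; simp)+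
            then show ?thesis by (simp add: power2_eq_square)
          qed
          then have "ennreal (1 / 32) \<le> ennreal (\<rho>\<^sup>2 - \<eta>\<^sup>2)" by (rule ennreal_leI)
          also have "\<dots> \<le> parab \<rho> (norm (x - y))"
            using True' by (intro parab_ge) (auto simp: dist_norm norm_minus_commute)
          finally show ?thesis using True True' by (simp add: thick_def)
        qed simp
      qed
      finally show ?thesis using True by simp
    qed simp
  qed
  also note deficit
  finally show ?thesis .
qed

text \<open>In the ball of radius \<eta> about such a point, \<open>E\<close> and the complement of
  \<open>F\<close> take up at most a quarter each, so \<open>F - E\<close> takes up half. Conversely
  a point of \<open>F - E\<close> has only volume of order \<eta>^(d+1) of such points within
  \<eta>. Double counting the pairs wins a factor \<eta> over the measure of
  \<open>F - E\<close>.\<close>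

lemma emeasure_thin_le:
  "ennreal (measure lborel (ball (0::'a) 1) * \<eta> ^ DIM('a) / 2) * emeasure lborel (nbhd - F - thick)
    \<le> ennreal (measure lborel (ball (0::'a) 1) * \<eta> ^ (DIM('a) + 1) / 4) * emeasure lborel (F - E)"
proof -
  let ?w = "measure lborel (ball (0::'a) 1)"
  let ?Q = "nbhd - F - thick"
  have [measurable]: "?Q \<in> sets borel" by measurable
  have "ennreal (?w * \<eta> ^ DIM('a) / 2) * emeasure lborel ?Q = (\<integral>\<^sup>+y. ennreal (?w * \<eta> ^ DIM('a) / 2) * indicator ?Q y \<partial>lborel)"
    by (subst nn_integral_cmult_indicator) auto
  also have "\<dots> \<le> (\<integral>\<^sup>+y. \<integral>\<^sup>+z. indicator ?Q y * (indicator (F - E) z * indicator {t. t < \<eta>} (dist y z)) \<partial>lborel \<partial>lborel)"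
  proof (rule nn_integral_mono)
    fix y
    show "ennreal (?w * \<eta> ^ DIM('a) / 2) * indicator ?Q y \<le> (\<integral>\<^sup>+z. indicator ?Q y * (indicator (F - E) z * indicator {t. t < \<eta>} (dist y z)) \<partial>lborel)"
    proof (cases "y \<in> ?Q")
      case True
      have f1: "E \<inter> ball y \<eta> \<in> fmeasurable lborel" using E by (intro fmeasurable_Int_fmeasurable) auto
      have f2: "ball y (2 * \<eta>) - F \<in> fmeasurable lborel" by (intro fmeasurable_Diff) auto
      have f3: "(F - E) \<inter> ball y \<eta> \<in> fmeasurable lborel" using F by (intro fmeasurable_Int_fmeasurable fmeasurable_Diff) auto
      have "measure lborel (ball y \<eta>) \<le> measure lborel ((E \<inter> ball y \<eta>) \<union> (((F - E) \<inter> ball y \<eta>) \<union> (ball y (2 * \<eta>) - F)))"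
      proof (rule measure_mono_fmeasurable)
        have "ball y \<eta> \<subseteq> ball y (2 * \<eta>)" using \<eta> by (intro subset_ball) auto
        then show "ball y \<eta> \<subseteq> (E \<inter> ball y \<eta>) \<union> (((F - E) \<inter> ball y \<eta>) \<union> (ball y (2 * \<eta>) - F))" by blast
      qed (use f1 f2 f3 in \<open>auto intro!: fmeasurable.Un\<close>)
      also have "\<dots> \<le> measure lborel (E \<inter> ball y \<eta>) + measure lborel (((F - E) \<inter> ball y \<eta>) \<union> (ball y (2 * \<eta>) - F))"
        by (rule measure_Un_le) auto
      also have "measure lborel (((F - E) \<inter> ball y \<eta>) \<union> (ball y (2 * \<eta>) - F)) \<le> measure lborel ((F - E) \<inter> ball y \<eta>) + measure lborel (ball y (2 * \<eta>) - F)"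
        by (rule measure_Un_le) auto
      finally have sum: "?w * \<eta> ^ DIM('a) \<le> measure lborel (E \<inter> ball y \<eta>) + (measure lborel ((F - E) \<inter> ball y \<eta>) + measure lborel (ball y (2 * \<eta>) - F))"
        using \<eta> by (simp add: measure_lborel_ball[of \<eta> y])
      have "emeasure lborel (E \<inter> ball y \<eta>) < ennreal (?w * \<eta> ^ DIM('a) / 4)"
        using True by (auto simp: thick_def not_le)
      then have s1: "measure lborel (E \<inter> ball y \<eta>) < ?w * \<eta> ^ DIM('a) / 4"
        using f1 by (simp add: emeasure_eq_measure2 ennreal_less_iff)
      have s2: "measure lborel (ball y (2 * \<eta>) - F) \<le> ?w * \<eta> ^ DIM('a) / 4"
      proof -
        have "ennreal (measure lborel (ball y (2 * \<eta>) - F)) \<le> ennreal (?w * \<eta> ^ (DIM('a) + 1) / 4)"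
          using emeasure_ball_minus_F_le[of y] True f2 by (simp add: emeasure_eq_measure2)
        then have "measure lborel (ball y (2 * \<eta>) - F) \<le> ?w * \<eta> ^ (DIM('a) + 1) / 4"
          using \<eta> by (subst (asm) ennreal_le_iff) auto
        also have "\<eta> ^ (DIM('a) + 1) \<le> \<eta> ^ DIM('a)" using \<eta> by (intro power_decreasing) auto
        then have "?w * \<eta> ^ (DIM('a) + 1) / 4 \<le> ?w * \<eta> ^ DIM('a) / 4" by (intro divide_right_mono mult_left_mono) auto
        finally show ?thesis .
      qed
      have "?w * \<eta> ^ DIM('a) / 2 \<le> measure lborel ((F - E) \<inter> ball y \<eta>)" using sum s1 s2 by simp
      then have "ennreal (?w * \<eta> ^ DIM('a) / 2) \<le> emeasure lborel ((F - E) \<inter> ball y \<eta>)"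
        using f3 by (simp add: emeasure_eq_measure2 ennreal_leI)
      also have "\<dots> = (\<integral>\<^sup>+z. indicator ((F - E) \<inter> ball y \<eta>) z \<partial>lborel)"
        by (rule nn_integral_indicator[symmetric]) auto
      also have "\<dots> = (\<integral>\<^sup>+z. indicator ?Q y * (indicator (F - E) z * indicator {t. t < \<eta>} (dist y z)) \<partial>lborel)"
        using True by (intro nn_integral_cong) (auto simp: indicator_def)
      finally show ?thesis using True by simp
    qed simp
  qed
  also have "\<dots> = (\<integral>\<^sup>+z. \<integral>\<^sup>+y. indicator ?Q y * (indicator (F - E) z * indicator {t. t < \<eta>} (dist y z)) \<partial>lborel \<partial>lborel)"
    by (rule lborel_pair.Fubini') measurable
  also have "\<dots> \<le> (\<integral>\<^sup>+z. ennreal (?w * \<eta> ^ (DIM('a) + 1) / 4) * indicator (F - E) z \<partial>lborel)"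
  proof (rule nn_integral_mono)
    fix z
    have "(\<integral>\<^sup>+y. indicator ?Q y * (indicator (F - E) z * indicator {t. t < \<eta>} (dist y z)) \<partial>lborel)
      = (\<integral>\<^sup>+y. indicator (F - E) z * indicator (?Q \<inter> ball z \<eta>) y \<partial>lborel)"
      by (intro nn_integral_cong) (auto simp: indicator_def dist_commute)
    also have "\<dots> = indicator (F - E) z * emeasure lborel (?Q \<inter> ball z \<eta>)"
      by (intro nn_integral_cmult_indicator) auto
    also have "\<dots> \<le> indicator (F - E) z * ennreal (?w * \<eta> ^ (DIM('a) + 1) / 4)"
    proof (rule mult_left_mono)
      show "emeasure lborel (?Q \<inter> ball z \<eta>) \<le> ennreal (?w * \<eta> ^ (DIM('a) + 1) / 4)"
      proof (cases "?Q \<inter> ball z \<eta> = {}")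
        case False
        then obtain y where y: "y \<in> ?Q" "y \<in> ball z \<eta>" by blast
        have "?Q \<inter> ball z \<eta> \<subseteq> ball y (2 * \<eta>) - F"
        proof
          fix u assume u: "u \<in> ?Q \<inter> ball z \<eta>"
          have "dist y u \<le> dist z y + dist z u" by (metis dist_commute dist_triangle)
          then show "u \<in> ball y (2 * \<eta>) - F" using u y by auto
        qed
        then have "emeasure lborel (?Q \<inter> ball z \<eta>) \<le> emeasure lborel (ball y (2 * \<eta>) - F)"
          by (intro emeasure_mono) auto
        also have "\<dots> \<le> ennreal (?w * \<eta> ^ (DIM('a) + 1) / 4)" using y by (intro emeasure_ball_minus_F_le) auto
        finally show ?thesis .
      qed simp
    qed simp
    finally show "(\<integral>\<^sup>+y. indicator ?Q y * (indicator (F - E) z * indicator {t. t < \<eta>} (dist y z)) \<partial>lborel)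
      \<le> ennreal (?w * \<eta> ^ (DIM('a) + 1) / 4) * indicator (F - E) z" by (simp add: mult.commute)
  qed
  also have "\<dots> = ennreal (?w * \<eta> ^ (DIM('a) + 1) / 4) * emeasure lborel (F - E)"
    by (subst nn_integral_cmult_indicator) auto
  finally show ?thesis .
qed

lemma ennreal_bound_from_mult:
  assumes "0 < p" "0 \<le> q" "ennreal p * x \<le> ennreal q"
  shows "x \<le> ennreal (q / p)"
proof -
  have "ennreal p * x \<le> ennreal p * ennreal (q / p)"
    using assms by (subst ennreal_mult[symmetric]) auto
  then show ?thesis using assms(1) by (subst (asm) ennreal_mult_le_mult_iff) auto
qed

lemma nbhd_measure:
  "nbhd \<in> fmeasurable lborel"
  "measure lborel nbhd \<le> measure lborel F + 128 * D / (measure lborel (ball (0::'a) 1) * \<eta> ^ DIM('a)) + \<eta> / 2 * measure lborel (F - E)"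
proof -
  let ?w = "measure lborel (ball (0::'a) 1)"
  have w: "0 < ?w" by (rule measure_unit_ball_pos)
  have fFE: "F - E \<in> fmeasurable lborel" using F by (intro fmeasurable_Diff) auto
  have 1: "emeasure lborel thick \<le> ennreal (D / (?w * \<eta> ^ DIM('a) / 128))"
    using emeasure_thick_le w \<eta> D by (intro ennreal_bound_from_mult) auto
  have "ennreal (?w * \<eta> ^ DIM('a) / 2) * emeasure lborel (nbhd - F - thick) \<le> ennreal (?w * \<eta> ^ (DIM('a) + 1) / 4 * measure lborel (F - E))"
    using emeasure_thin_le unfolding emeasure_eq_measure2[OF fFE] by (subst ennreal_mult) (use \<eta> in auto)
  then have "emeasure lborel (nbhd - F - thick) \<le> ennreal (?w * \<eta> ^ (DIM('a) + 1) / 4 * measure lborel (F - E) / (?w * \<eta> ^ DIM('a) / 2))"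
    using w \<eta> by (intro ennreal_bound_from_mult) auto
  also have "?w * \<eta> ^ (DIM('a) + 1) / 4 * measure lborel (F - E) / (?w * \<eta> ^ DIM('a) / 2) = \<eta> / 2 * measure lborel (F - E)"
    using w \<eta> by (simp add: field_simps)
  finally have 2: "emeasure lborel (nbhd - F - thick) \<le> ennreal (\<eta> / 2 * measure lborel (F - E))" .
  have "emeasure lborel nbhd \<le> emeasure lborel (F \<union> (thick \<union> (nbhd - F - thick)))" by (intro emeasure_mono) auto
  also have "\<dots> \<le> emeasure lborel F + emeasure lborel (thick \<union> (nbhd - F - thick))" by (rule emeasure_subadditive) auto
  also have "emeasure lborel (thick \<union> (nbhd - F - thick)) \<le> emeasure lborel thick + emeasure lborel (nbhd - F - thick)"
    by (rule emeasure_subadditive) auto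
  also have "\<dots> \<le> ennreal (D / (?w * \<eta> ^ DIM('a) / 128)) + ennreal (\<eta> / 2 * measure lborel (F - E))"
    using 1 2 by (rule add_mono)
  finally have "emeasure lborel nbhd \<le> emeasure lborel F + (ennreal (D / (?w * \<eta> ^ DIM('a) / 128)) + ennreal (\<eta> / 2 * measure lborel (F - E)))"
    by (simp add: add_left_mono)
  also have "\<dots> = ennreal (measure lborel F + (D / (?w * \<eta> ^ DIM('a) / 128) + \<eta> / 2 * measure lborel (F - E)))"
    using F D w \<eta> by (simp add: emeasure_eq_measure2)
  finally have le: "emeasure lborel nbhd \<le> ennreal (measure lborel F + (D / (?w * \<eta> ^ DIM('a) / 128) + \<eta> / 2 * measure lborel (F - E)))" .
  have "emeasure lborel nbhd < \<infinity>" using le_less_trans[OF le ennreal_less_top] by simp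
  then show f: "nbhd \<in> fmeasurable lborel" by (intro fmeasurableI) auto
  have "0 \<le> measure lborel F + (D / (?w * \<eta> ^ DIM('a) / 128) + \<eta> / 2 * measure lborel (F - E))"
    using D w \<eta> by (intro add_nonneg_nonneg) auto
  then have "measure lborel nbhd \<le> measure lborel F + (D / (?w * \<eta> ^ DIM('a) / 128) + \<eta> / 2 * measure lborel (F - E))"
    using le unfolding emeasure_eq_measure2[OF f] by (simp only: ennreal_le_iff)
  then show "measure lborel nbhd \<le> measure lborel F + 128 * D / (?w * \<eta> ^ DIM('a)) + \<eta> / 2 * measure lborel (F - E)"
    by simp
qed

end

lemma power_sum_le_64: "0 \<le> x \<Longrightarrow> 0 \<le> y \<Longrightarrow> (x + y) ^ 6 \<le> 64 * (x ^ 6 + y ^ 6)" for x y :: real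
proof -
  assume xy: "0 \<le> x" "0 \<le> y"
  have "(x + y) ^ 6 \<le> (2 * max x y) ^ 6" using xy by (intro power_mono) auto
  also have "\<dots> = 64 * (max x y) ^ 6" by (simp add: power_mult_distrib)
  also have "(max x y) ^ 6 \<le> x ^ 6 + y ^ 6" using xy by (auto simp: max_def)
  finally show ?thesis by simp
qed

text \<open>The constants are fixed before the sets and must not depend on \<open>e\<close>. Every
  loss is brought to the form constant times \<eta> times e^(d-1), after which \<beta> can be taken
  as a multiple of \<eta>.\<close>

theorem small_deficit_near_ball:
  "\<exists>C \<eta>0. 0 \<le> C \<and> 0 < \<eta>0 \<and> (\<forall>(E::'a::euclidean_space set) F e \<rho> \<eta>.
    small_deficit E F \<rho> \<eta> (\<eta> ^ (DIM('a) + 3) * e ^ (DIM('a) - 1)) \<longrightarrow>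
    measure lborel E = measure lborel (ball (0::'a) 1) * e ^ DIM('a) \<longrightarrow>
    measure lborel F = measure lborel (ball (0::'a) 1) * (e + \<rho>) ^ DIM('a) \<longrightarrow> 1 \<le> e \<longrightarrow> \<eta> \<le> \<eta>0 \<longrightarrow>
    (\<exists>c. (measure lborel (E - ball c e) / measure lborel E) ^ 6 \<le> C * \<eta>))"
proof -
  let ?d = "DIM('a)" and ?w = "measure lborel (ball (0::'a) 1)"
  have w: "0 < ?w" by (rule measure_unit_ball_pos)
  have d1: "1 \<le> real ?d" by (simp add: Suc_le_eq)
  \<comment> \<open>\<open>c3\<close> bounds the loss of radius from \<open>E\<close> to its core;
    \<open>K1\<close> collects the three errors in the measure of \<open>nbhd\<close>;
    \<open>C4\<close> passes from \<open>e\<close> to \<open>a + r\<close> at the cost of powers of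
    2 and compensates \<open>r \<ge> 1 / 8\<close> by the factor 8; \<open>C5\<close> comes from
    \<open>ball_deviation\<close>.\<close>
  define c3 where "c3 = 16 / ?w\<^sup>2"
  define K1 where "K1 = ?d * (c3 + 4) * 2 ^ (?d - 1) + 128 / ?w\<^sup>2 + ?d * 2 ^ (?d - 1)"
  define C4 where "C4 = 8 * (K1 * 2 ^ (?d - 1))"
  define C5 where "C5 = real (4 * ?d * (242 * ?d + 168))"
  \<comment> \<open>The first bound keeps \<open>e - a\<close> below 1/4, the second makes the cube
    root of \<beta> small enough for \<open>ball_deviation\<close>.\<close>
  define \<eta>0 where "\<eta>0 = min (1 / (4 * c3)) ((1 / (8 * ?d + 8)) ^ 3 / C4)"
  have c3: "0 < c3" using w by (simp add: c3_def)
  have K1: "0 < K1" using c3 d1 w unfolding K1_def by (intro add_pos_pos mult_pos_pos divide_pos_pos) auto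
  have C4: "0 < C4" using K1 by (simp add: C4_def)
  have \<eta>0: "0 < \<eta>0" using c3 C4 by (auto simp: \<eta>0_def)
  show ?thesis
  proof (rule exI[of _ "64 * (c3 ^ 6 + C5 ^ 3 * C4)"], rule exI[of _ \<eta>0], intro conjI allI impI \<eta>0)
    show "0 \<le> 64 * (c3 ^ 6 + C5 ^ 3 * C4)" using c3 C4 by (simp add: C5_def)
    fix E F :: "'a set" and e \<rho> \<eta> :: real
    assume sd: "small_deficit E F \<rho> \<eta> (\<eta> ^ (?d + 3) * e ^ (?d - 1))"
      and mE: "measure lborel E = ?w * e ^ ?d" and mF: "measure lborel F = ?w * (e + \<rho>) ^ ?d"
      and e: "1 \<le> e" and \<eta>\<eta>0: "\<eta> \<le> \<eta>0"
    interpret small_deficit E F \<rho> \<eta> "\<eta> ^ (?d + 3) * e ^ (?d - 1)" by fact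
    let ?e1 = "e ^ (?d - 1)"
    have e1: "0 < ?e1" using e by simp
    have ed: "e ^ ?d = e * ?e1" by (simp add: power_eq_if)
    have c3\<eta>: "c3 * \<eta> \<le> 1 / 4"
    proof -
      have "\<eta> \<le> 1 / (4 * c3)" using \<eta>\<eta>0 by (simp add: \<eta>0_def)
      then have "c3 * \<eta> \<le> c3 * (1 / (4 * c3))" using c3 by (intro mult_left_mono) auto
      then show ?thesis using c3 by simp
    qed
    have lost: "measure lborel (E - core) \<le> ?w * (c3 * \<eta> * ?e1)"
    proof -
      have "measure lborel (E - core) \<le> \<eta> ^ (?d + 3) * ?e1 / \<tau>"
        using measure_E_minus_core \<tau>_pos by (simp add: pos_le_divide_eq mult.commute)
      also have "\<dots> = 4 * \<eta> * ?e1 / (?w * \<rho>)"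
      proof -
        have "\<eta> ^ (?d + 3) = \<eta> ^ (?d + 2) * \<eta>" by (simp add: numeral_3_eq_3)
        then show ?thesis using \<eta> w \<rho> by (simp add: \<tau>_def field_simps)
      qed
      also have "\<dots> \<le> 4 * \<eta> * ?e1 / (?w * (1 / 4))"
        using \<eta> e1 w \<rho> by (intro divide_left_mono mult_left_mono) auto
      also have "\<dots> = ?w * (c3 * \<eta> * ?e1)" using w by (simp add: c3_def power2_eq_square)
      finally show ?thesis .
    qed
    have core_le: "measure lborel core \<le> measure lborel E"
      using core_subset E by (intro measure_mono_fmeasurable) auto
    have split: "measure lborel E = measure lborel core + measure lborel (E - core)"
      using measure_Int_Diff[OF E, of core] core_subset by (simp add: Int_absorb1)
    define a where "a = root ?d (measure lborel core / ?w)"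
    have a0: "0 \<le> a" using w by (simp add: a_def)
    have ad: "a ^ ?d = measure lborel core / ?w" using w by (simp add: a_def real_root_pow_pos2)
    have mcore: "measure lborel core = ?w * a ^ ?d" using w by (simp add: ad)
    have "?w * a ^ ?d \<le> ?w * e ^ ?d" using core_le mE mcore by simp
    then have "a ^ ?d \<le> e ^ ?d" using w by simp
    then have ae: "a \<le> e" using power_strict_mono[of e a ?d] e by (meson DIM_positive not_le order_trans zero_le_one)
    \<comment> \<open>A volume loss of surface size is a loss of radius of order \<eta>, uniformly
      in \<open>e\<close>, since \<open>e ^ ?d - a ^ ?d\<close> is at least
      \<open>(e - a) * ?e1\<close>.\<close>
    have ea: "e - a \<le> c3 * \<eta>"
    proof -
      have "a ^ ?d = a * a ^ (?d - 1)" by (simp add: power_eq_if)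
      also have "\<dots> \<le> a * ?e1" using a0 ae by (intro mult_left_mono power_mono) auto
      finally have 1: "a ^ ?d \<le> a * ?e1" .
      have "?w * (e ^ ?d - a ^ ?d) \<le> ?w * (c3 * \<eta> * ?e1)" using split lost mE mcore by (simp add: right_diff_distrib)
      then have "e ^ ?d - a ^ ?d \<le> c3 * \<eta> * ?e1" using w by simp
      then have "(e - a) * ?e1 \<le> c3 * \<eta> * ?e1" using 1 by (simp add: ed left_diff_distrib)
      then show ?thesis using e1 by simp
    qed
    have a34: "3 / 4 \<le> a" using ea c3\<eta> e by linarith
    define r where "r = \<rho> - 4 * \<eta>"
    have r: "1 / 8 \<le> r" "r \<le> 3 / 4" using \<rho> \<eta> by (auto simp: r_def)
    let ?N = "a + r"
    have "e - a \<le> 1 / 4" using ea c3\<eta> by (rule order_trans)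
    then have N: "e \<le> 2 * ?N" using e r(1) by (simp add: distrib_left)
    define \<beta> where "\<beta> = C4 * \<eta>"
    have \<beta>: "0 < \<beta>" using C4 \<eta> by (simp add: \<beta>_def)
    have e\<rho>: "(e + \<rho>) ^ (?d - 1) \<le> 2 ^ (?d - 1) * ?e1"
    proof -
      have "(e + \<rho>) ^ (?d - 1) \<le> (2 * e) ^ (?d - 1)" using e \<rho> by (intro power_mono) auto
      then show ?thesis by (simp add: power_mult_distrib)
    qed
    have FE: "measure lborel (F - E) \<le> ?w * (?d * 2 ^ (?d - 1) * ?e1)"
    proof -
      have "measure lborel (F - E) = ?w * ((e + \<rho>) ^ ?d - e ^ ?d)"
        using measurable_measure_Diff[OF F _ EF] E mE mF by (auto simp: right_diff_distrib)
      also have "(e + \<rho>) ^ ?d - e ^ ?d \<le> ?d * (e + \<rho>) ^ (?d - 1) * \<rho>"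
        using power_tangent_le[of e "e + \<rho>" ?d] e \<rho> by (simp add: algebra_simps)
      also have "\<dots> \<le> ?d * (2 ^ (?d - 1) * ?e1) * 1" using e\<rho> \<rho> e by (intro mult_mono mult_left_mono) auto
      finally show ?thesis using w by (simp add: mult.assoc)
    qed
    have G: "measure lborel nbhd \<le> ?w * (?N ^ ?d + \<beta> * r * ?N ^ (?d - 1))"
    proof -
      have 1: "128 * (\<eta> ^ (?d + 3) * ?e1) / (?w * \<eta> ^ ?d) \<le> ?w * (128 / ?w\<^sup>2 * (\<eta> * ?e1))"
      proof -
        have "128 * (\<eta> ^ (?d + 3) * ?e1) / (?w * \<eta> ^ ?d) = 128 * \<eta> ^ 3 * ?e1 / ?w"
          using \<eta> by (simp add: power_add)
        also have "\<dots> \<le> 128 * \<eta> * ?e1 / ?w"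
        proof -
          have "\<eta> ^ 3 \<le> \<eta> ^ 1" using \<eta> by (intro power_decreasing) auto
          then show ?thesis using w e1 by (intro divide_right_mono mult_right_mono mult_left_mono) auto
        qed
        also have "\<dots> = ?w * (128 / ?w\<^sup>2 * (\<eta> * ?e1))" using w by (simp add: power2_eq_square)
        finally show ?thesis .
      qed
      have 2: "\<eta> / 2 * measure lborel (F - E) \<le> ?w * (?d * 2 ^ (?d - 1) * (\<eta> * ?e1))"
      proof -
        have "\<eta> / 2 * measure lborel (F - E) \<le> \<eta> * measure lborel (F - E)" using \<eta> by (intro mult_right_mono) auto
        also have "\<dots> \<le> \<eta> * (?w * (?d * 2 ^ (?d - 1) * ?e1))" using \<eta> FE by (intro mult_left_mono) auto
        finally show ?thesis by (simp add: mult_ac)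
      qed
      have 3: "(e + \<rho>) ^ ?d \<le> ?N ^ ?d + ?d * (c3 + 4) * 2 ^ (?d - 1) * (\<eta> * ?e1)"
      proof -
        have "(e + \<rho>) ^ ?d + ?d * (e + \<rho>) ^ (?d - 1) * (?N - (e + \<rho>)) \<le> ?N ^ ?d"
          using a0 r e \<rho> by (intro power_tangent_le) auto
        then have "(e + \<rho>) ^ ?d \<le> ?N ^ ?d + ?d * (e + \<rho>) ^ (?d - 1) * ((e + \<rho>) - ?N)" by (simp add: algebra_simps)
        also have "?d * (e + \<rho>) ^ (?d - 1) * ((e + \<rho>) - ?N) \<le> ?d * (2 ^ (?d - 1) * ?e1) * ((c3 + 4) * \<eta>)"
        proof (rule mult_mono)
          show "(e + \<rho>) - ?N \<le> (c3 + 4) * \<eta>" using ea by (simp add: r_def algebra_simps)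
          show "0 \<le> (e + \<rho>) - ?N" using ae \<eta> by (simp add: r_def)
        qed (use e\<rho> e in auto)
        finally show ?thesis by (simp add: mult_ac)
      qed
      have "measure lborel nbhd \<le> ?w * (?N ^ ?d + ?d * (c3 + 4) * 2 ^ (?d - 1) * (\<eta> * ?e1))
        + ?w * (128 / ?w\<^sup>2 * (\<eta> * ?e1)) + ?w * (?d * 2 ^ (?d - 1) * (\<eta> * ?e1))"
        using nbhd_measure(2) 1 2 mult_left_mono[OF 3, of ?w] w unfolding mF by linarith
      also have "\<dots> = ?w * (?N ^ ?d + K1 * \<eta> * ?e1)" by (simp add: K1_def algebra_simps)
      also have "\<dots> \<le> ?w * (?N ^ ?d + K1 * \<eta> * (2 ^ (?d - 1) * ?N ^ (?d - 1)))"
      proof -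
        have "?e1 \<le> (2 * ?N) ^ (?d - 1)" using N e by (intro power_mono) auto
        then have "?e1 \<le> 2 ^ (?d - 1) * ?N ^ (?d - 1)" by (simp only: power_mult_distrib)
        then show ?thesis using w K1 \<eta> by (intro mult_left_mono add_left_mono) auto
      qed
      also have "\<dots> = ?w * (?N ^ ?d + \<beta> * (1 / 8) * ?N ^ (?d - 1))" by (simp add: \<beta>_def C4_def mult_ac)
      also have "\<dots> \<le> ?w * (?N ^ ?d + \<beta> * r * ?N ^ (?d - 1))"
        using w \<beta> r a0 by (intro mult_left_mono add_left_mono mult_right_mono) auto
      finally show ?thesis .
    qed
    interpret B: small_BM_deficit core nbhd a r \<beta>
      using core_fmeasurable mcore nbhd_measure(1) G a34 r \<beta> by unfold_locales (auto simp: nbhd_def r_def)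
    define s where "s = root 3 \<beta>"
    have s3: "s ^ 3 = \<beta>" "0 < s" using \<beta> by (auto simp: s_def)
    have s8: "(8 * ?d + 8) * s \<le> 1"
    proof -
      have "\<eta> \<le> (1 / (8 * ?d + 8)) ^ 3 / C4" using \<eta>\<eta>0 by (simp add: \<eta>0_def)
      then have "s ^ 3 \<le> (1 / (8 * ?d + 8)) ^ 3" using C4 by (simp add: s3 \<beta>_def pos_le_divide_eq mult.commute)
      then have "s \<le> 1 / (8 * ?d + 8)"
        using power_strict_mono[of "1 / (8 * real ?d + 8)" s 3] by (simp add: not_le) (meson not_le zero_less_numeral divide_nonneg_nonneg zero_le_one add_nonneg_nonneg of_nat_0_le_iff mult_nonneg_nonneg zero_le_numeral)
      then show ?thesis by (simp add: pos_le_divide_eq mult.commute add_pos_nonneg)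
    qed
    obtain c where c: "(measure lborel (core - ball c a) / measure lborel core)\<^sup>2 \<le> C5 * s"
      using B.ball_deviation[of s] r a34 s3 s8 unfolding C5_def by auto
    define v where "v = measure lborel (core - ball c a) / measure lborel core"
    have v0: "0 \<le> v" by (simp add: v_def)
    have v6: "v ^ 6 \<le> C5 ^ 3 * C4 * \<eta>"
    proof -
      have "(v\<^sup>2) ^ 3 \<le> (C5 * s) ^ 3" using c by (intro power_mono) (auto simp: v_def)
      then show ?thesis by (simp add: power_mult_distrib s3 \<beta>_def power_mult[symmetric] mult.assoc)
    qed
    have "measure lborel (E - ball c e) / measure lborel E \<le> c3 * \<eta> + v"
    proof -
      have "E - ball c e \<subseteq> (E - core) \<union> (core - ball c a)" using ae subset_ball[of a e c] by auto
      then have "measure lborel (E - ball c e) \<le> measure lborel ((E - core) \<union> (core - ball c a))"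
        using E core_fmeasurable by (intro measure_mono_fmeasurable) (auto intro!: fmeasurable.Un fmeasurable_Diff)
      also have "\<dots> \<le> measure lborel (E - core) + measure lborel (core - ball c a)" by (rule measure_Un_le) auto
      also have "measure lborel (core - ball c a) = v * measure lborel core" using B.measure_A_pos by (simp add: v_def)
      also have "\<dots> \<le> v * measure lborel E" using core_le v0 by (rule mult_left_mono)
      also have "measure lborel (E - core) \<le> c3 * \<eta> * measure lborel E"
      proof -
        have "1 * ?e1 \<le> e * ?e1" using e e1 by (intro mult_right_mono) auto
        then have "?w * (c3 * \<eta> * ?e1) \<le> ?w * (c3 * \<eta> * e ^ ?d)"
          using w c3 \<eta> unfolding ed by (intro mult_left_mono) auto
        then show ?thesis using lost unfolding mE by (simp add: mult_ac)
      qed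
      finally have "measure lborel (E - ball c e) \<le> (c3 * \<eta> + v) * measure lborel E" by (simp add: distrib_right)
      moreover have "0 < measure lborel E" using mE w e by simp
      ultimately show ?thesis by (simp add: pos_divide_le_eq)
    qed
    then have "(measure lborel (E - ball c e) / measure lborel E) ^ 6 \<le> (c3 * \<eta> + v) ^ 6"
      by (intro power_mono) auto
    also have "\<dots> \<le> 64 * ((c3 * \<eta>) ^ 6 + v ^ 6)" using c3 \<eta> v0 by (intro power_sum_le_64) auto
    also have "\<dots> \<le> 64 * (c3 ^ 6 * \<eta> + C5 ^ 3 * C4 * \<eta>)"
    proof -
      have "\<eta> ^ 6 \<le> \<eta> ^ 1" using \<eta> by (intro power_decreasing) auto
      then have "c3 ^ 6 * \<eta> ^ 6 \<le> c3 ^ 6 * \<eta>" using c3 by (intro mult_left_mono) auto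
      then show ?thesis using v6 by (simp add: power_mult_distrib)
    qed
    finally have "(measure lborel (E - ball c e) / measure lborel E) ^ 6 \<le> 64 * (c3 ^ 6 + C5 ^ 3 * C4) * \<eta>"
      by (simp add: algebra_simps)
    then show "\<exists>c. (measure lborel (E - ball c e) / measure lborel E) ^ 6 \<le> 64 * (c3 ^ 6 + C5 ^ 3 * C4) * \<eta>" by blast
  qed
qed

section \<open>Splitting off a truncated paraboloid from the kernel\<close>

text \<open>The exceptional null set is covered by an open \<open>U\<close> of measure at most
  \<open>e\<close>, and \<open>f\<close> is lowered by \<open>L + 1\<close> times the measure of
  \<open>U\<close> swept so far and by \<open>e * x\<close>. Near exceptional points the first
  correction beats the Lipschitz growth; elsewhere the derivative decides, with slack
  \<open>e\<close>. The total correction is of order \<open>e\<close>.\<close>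

lemma Lipschitz_AE_nonpos_derivative_decreasing:
  fixes f :: "real \<Rightarrow> real"
  assumes lip: "\<And>x y. x \<in> {a..b} \<Longrightarrow> y \<in> {a..b} \<Longrightarrow> \<bar>f x - f y\<bar> \<le> L * \<bar>x - y\<bar>" and L: "0 \<le> L"
    and AE: "AE x in lborel. x \<in> {a..b} \<longrightarrow> (\<exists>D. (f has_real_derivative D) (at x) \<and> D \<le> 0)"
    and st: "a \<le> s" "s \<le> t" "t \<le> b"
  shows "f t \<le> f s"
proof (rule field_le_epsilon)
  fix e0 :: real assume "0 < e0"
  define e where "e = e0 / (L + 1 + (t - s))"
  have den: "0 < L + 1 + (t - s)" using L st by simp
  have e: "0 < e" "e * (L + 1 + (t - s)) = e0" using \<open>0 < e0\<close> den by (auto simp: e_def)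
  obtain N where N: "N \<in> null_sets lborel" "{x \<in> space lborel. \<not> (x \<in> {a..b} \<longrightarrow> (\<exists>D. (f has_real_derivative D) (at x) \<and> D \<le> 0))} \<subseteq> N"
    using AE by (auto elim: AE_E3 simp: eventually_ae_filter)
  have NB: "N \<in> sets borel" using N(1) by (auto simp: null_sets_def)
  obtain U where U: "open U" "N \<subseteq> U" "emeasure lborel (U - N) < ennreal e"
    using outer_regular_lborel[OF NB e(1)] by blast
  have [measurable]: "U \<in> sets borel" using U by auto
  have "emeasure lborel U = emeasure lborel (U - N)"
    using N by (intro emeasure_Diff_null_set[symmetric]) auto
  then have Ue: "emeasure lborel U < ennreal e" using U by simp
  then have fU: "U \<in> fmeasurable lborel" by (intro fmeasurableI) (auto intro: less_trans)
  have mU: "measure lborel U \<le> e"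
    using Ue fU e by (simp add: emeasure_eq_measure2 ennreal_less_iff)
  define m where "m x = measure lborel (U \<inter> {s..x})" for x
  have fm: "U \<inter> {s..x} \<in> fmeasurable lborel" for x using fU by (intro fmeasurable_Int_fmeasurable) auto
  have m_mono: "m x \<le> m y" if "x \<le> y" for x y
    unfolding m_def using that fm by (intro measure_mono_fmeasurable) auto
  have m_incr: "m y - m x = y - x" if "s \<le> x" "x \<le> y" "{x..y} \<subseteq> U" for x y
  proof -
    have "U \<inter> {s..y} = (U \<inter> {s..x}) \<union> {x<..y}" using that by auto
    then have "m y = measure lborel ((U \<inter> {s..x}) \<union> {x<..y})" by (simp add: m_def)
    also have "\<dots> = m x + measure lborel {x<..y}"
      unfolding m_def by (intro measure_Un_AE) (use fm that in \<open>auto simp: fmeasurable_def\<close>)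
    finally show ?thesis using that by simp
  qed
  define h where "h x = f x - (L + 1) * m x - e * x" for x
  \<comment> \<open>Shaped for bisection: comparing \<open>h\<close> at each point with its
    neighbours on both sides yields the comparison of the endpoints.\<close>
  have "s \<le> s \<and> t \<le> t \<longrightarrow> h t \<le> h s"
  proof (rule Bolzano[of s t "\<lambda>u v. s \<le> u \<and> v \<le> t \<longrightarrow> h v \<le> h u"])
    fix x assume x: "s \<le> x" "x \<le> t"
    have xab: "x \<in> {a..b}" using x st by auto
    have "\<exists>d>0. \<forall>y. \<bar>y - x\<bar> < d \<longrightarrow> s \<le> y \<longrightarrow> y \<le> t \<longrightarrow> (x \<le> y \<longrightarrow> h y \<le> h x) \<and> (y \<le> x \<longrightarrow> h x \<le> h y)"
    proof (cases "x \<in> N")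
      case True
      then obtain d where d: "0 < d" "ball x d \<subseteq> U" using U openE by blast
      show ?thesis
      proof (intro exI[of _ d] conjI d(1) allI impI)
        fix y assume y: "\<bar>y - x\<bar> < d" "s \<le> y" "y \<le> t"
        have yab: "y \<in> {a..b}" using y st by auto
        { assume "x \<le> y"
          then have "{x..y} \<subseteq> ball x d" using y by (auto simp: dist_real_def)
          then have mi: "m y - m x = y - x" using x d \<open>x \<le> y\<close> by (intro m_incr) auto
          moreover have "f y - f x \<le> L * (y - x)" using lip[OF yab xab] \<open>x \<le> y\<close> abs_ge_self[of "f y - f x"] by simp
          moreover have "(L + 1) * (m y - m x) = L * (y - x) + (y - x)" by (simp add: mi distrib_right)
          moreover have "e * x \<le> e * y" using e \<open>x \<le> y\<close> by simp
          ultimately show "h y \<le> h x" using \<open>x \<le> y\<close> by (simp add: h_def algebra_simps) }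
        { assume "y \<le> x"
          then have "{y..x} \<subseteq> ball x d" using y by (auto simp: dist_real_def)
          then have mi: "m x - m y = x - y" using y d \<open>y \<le> x\<close> by (intro m_incr) auto
          moreover have "f x - f y \<le> L * (x - y)" using lip[OF xab yab] \<open>y \<le> x\<close> abs_ge_self[of "f x - f y"] by simp
          moreover have "(L + 1) * (m x - m y) = L * (x - y) + (x - y)" by (simp add: mi distrib_right)
          moreover have "e * y \<le> e * x" using e \<open>y \<le> x\<close> by simp
          ultimately show "h x \<le> h y" using \<open>y \<le> x\<close> by (simp add: h_def algebra_simps) }
      qed
    next
      case False
      then obtain D where D: "(f has_real_derivative D) (at x)" "D \<le> 0" using N(2) xab by auto
      then obtain d where d: "0 < d" "\<And>y. \<bar>y - x\<bar> < d \<Longrightarrow> \<bar>f y - f x - D * (y - x)\<bar> \<le> e * \<bar>y - x\<bar>"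
        using e(1) unfolding has_field_derivative_def has_derivative_at_alt by (auto simp: mult.commute)
      show ?thesis
      proof (intro exI[of _ d] conjI d(1) allI impI)
        fix y assume y: "\<bar>y - x\<bar> < d" "s \<le> y" "y \<le> t"
        { assume "x \<le> y"
          have "f y - f x \<le> D * (y - x) + e * (y - x)" using d(2)[OF y(1)] \<open>x \<le> y\<close> by (auto simp: abs_le_iff)
          moreover have "D * (y - x) \<le> 0" using D(2) \<open>x \<le> y\<close> by (intro mult_nonpos_nonneg) auto
          moreover have "(L + 1) * m x \<le> (L + 1) * m y" using m_mono[OF \<open>x \<le> y\<close>] L by (intro mult_left_mono) auto
          ultimately show "h y \<le> h x" by (simp add: h_def algebra_simps) }
        { assume "y \<le> x"
          have "f x - f y \<le> D * (x - y) + e * (x - y)" using d(2)[OF y(1)] \<open>y \<le> x\<close> by (simp add: abs_le_iff algebra_simps)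
          moreover have "D * (x - y) \<le> 0" using D(2) \<open>y \<le> x\<close> by (intro mult_nonpos_nonneg) auto
          moreover have "(L + 1) * m y \<le> (L + 1) * m x" using m_mono[OF \<open>y \<le> x\<close>] L by (intro mult_left_mono) auto
          ultimately show "h x \<le> h y" by (simp add: h_def algebra_simps) }
      qed
    qed
    then obtain d where d: "0 < d" "\<And>y. \<bar>y - x\<bar> < d \<Longrightarrow> s \<le> y \<Longrightarrow> y \<le> t \<Longrightarrow> (x \<le> y \<longrightarrow> h y \<le> h x) \<and> (y \<le> x \<longrightarrow> h x \<le> h y)"
      by blast
    show "\<exists>d>0. \<forall>u v. u \<le> x \<and> x \<le> v \<and> v - u < d \<longrightarrow> s \<le> u \<and> v \<le> t \<longrightarrow> h v \<le> h u"
    proof (intro exI[of _ d] conjI d(1) allI impI)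
      fix u v assume uv: "u \<le> x \<and> x \<le> v \<and> v - u < d" "s \<le> u \<and> v \<le> t"
      have "h v \<le> h x" using d(2)[of v] uv by auto
      moreover have "h x \<le> h u" using d(2)[of u] uv by auto
      ultimately show "h v \<le> h u" by linarith
    qed
  qed (use st in auto)
  then have "f t - (L + 1) * m t - e * t \<le> f s - (L + 1) * m s - e * s" by (simp add: h_def)
  moreover have "(L + 1) * m t \<le> (L + 1) * e"
  proof -
    have "m t \<le> measure lborel U" unfolding m_def using fU by (intro measure_mono_fmeasurable) auto
    then show ?thesis using mU L by (intro mult_left_mono) auto
  qed
  moreover have "0 \<le> (L + 1) * m s" using L by (simp add: m_def)
  ultimately have "f t \<le> f s + e * (L + 1 + (t - s))" by (simp add: algebra_simps)
  then show "f t \<le> f s + e0" by (simp add: e(2))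
qed

section \<open>Borel versions of sets and the energy as an extended integral\<close>

lemma ex_borel_version:
  assumes "S \<in> sets lebesgue"
  shows "\<exists>B\<in>sets borel. B \<subseteq> S \<and> (AE x in lebesgue. x \<in> S \<longleftrightarrow> x \<in> B)"
proof (intro bexI conjI)
  let ?B = "main_part lborel S"
  show "?B \<in> sets borel" using main_part_sets[OF assms] by simp
  have un: "?B \<union> null_part lborel S = S" using main_part_null_part_Un[OF assms] .
  then show "?B \<subseteq> S" by blast
  obtain N where N: "N \<in> null_sets lborel" "null_part lborel S \<subseteq> N" using null_part[OF assms] by blast
  have "AE x in lborel. x \<notin> N" using N(1) by (rule AE_not_in)
  then have "AE x in lebesgue. x \<notin> N" by (rule AE_completion)
  then show "AE x in lebesgue. x \<in> S \<longleftrightarrow> x \<in> ?B"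
    by eventually_elim (use un N(2) in blast)
qed

lemma measure_lebesgue_borel_version:
  assumes "S \<in> sets lebesgue" "B \<in> sets borel" "AE x in lebesgue. x \<in> S \<longleftrightarrow> x \<in> B"
  shows "measure lebesgue S = measure lborel B" "emeasure lebesgue S = emeasure lborel B"
proof -
  have B: "B \<in> sets lebesgue" using assms(2) by auto
  have "measure lebesgue S = measure lebesgue B" by (rule measure_eq_AE[OF assms(3,1) B])
  then show "measure lebesgue S = measure lborel B" using assms(2) by simp
  have "emeasure lebesgue S = emeasure lebesgue B" by (rule emeasure_eq_AE[OF assms(3,1) B])
  then show "emeasure lebesgue S = emeasure lborel B" using assms(2) by simp
qed

text \<open>The bridge from the Bochner integrals over Lebesgue sets to \<open>en\<close>. The
  argument \<open>max 0 t\<close> extends the kernel continuously, hence measurably, to the whole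
  line.\<close>

lemma energy_eq_en:
  fixes E F E1 F1 :: "'a::euclidean_space set"
  assumes J: "continuous_on {0..} J" "\<And>t. 0 \<le> t \<Longrightarrow> 0 \<le> J t \<and> J t \<le> k"
    and E: "E \<in> sets lebesgue" "E1 \<in> fmeasurable lborel" "AE x in lebesgue. x \<in> E \<longleftrightarrow> x \<in> E1"
    and F: "F \<in> sets lebesgue" "F1 \<in> fmeasurable lborel" "AE x in lebesgue. x \<in> F \<longleftrightarrow> x \<in> F1"
  shows "en (\<lambda>t. ennreal (J (max 0 t))) E1 F1 = ennreal (energy J E F)" "0 \<le> energy J E F"
proof -
  define Jm where "Jm t = J (max 0 t)" for t
  have cont: "continuous_on UNIV Jm"
    unfolding Jm_def by (intro continuous_on_compose2[OF J(1)] continuous_intros) auto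
  have Jm[measurable]: "Jm \<in> borel_measurable borel" using cont by (rule borel_measurable_continuous_onI)
  have Jb: "0 \<le> Jm t" "Jm t \<le> k" for t using J(2)[of "max 0 t"] by (auto simp: Jm_def)
  have Jn: "J (norm z) = Jm (norm z)" for z :: 'a by (simp add: Jm_def)
  have [measurable]: "E1 \<in> sets borel" "F1 \<in> sets borel" using E F by (auto simp: fmeasurable_def)
  have [measurable]: "E \<in> sets lebesgue" "F \<in> sets lebesgue" by fact+
  define inner where "inner y = (\<integral>x. indicator E1 x * Jm (norm (x - y)) \<partial>lborel)" for y :: 'a
  have 1: "(LINT x:E|lebesgue. J (norm (x - y))) = inner y" for y
  proof -
    have m: "(\<lambda>x. Jm (norm (x - y))) \<in> borel_measurable lebesgue"
      by (rule measurable_completion) measurable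
    have "(LINT x:E|lebesgue. J (norm (x - y))) = (\<integral>x. indicator E x * Jm (norm (x - y)) \<partial>lebesgue)"
      by (simp add: set_lebesgue_integral_def Jn)
    also have "\<dots> = (\<integral>x. indicator E1 x * Jm (norm (x - y)) \<partial>lebesgue)"
    proof (rule integral_cong_AE)
      show "AE x in lebesgue. indicator E x * Jm (norm (x - y)) = indicator E1 x * Jm (norm (x - y))"
        using E(3) by eventually_elim (auto simp: indicator_def)
      show "(\<lambda>x. indicator E x * Jm (norm (x - y))) \<in> borel_measurable lebesgue"
        using m E(1) by (intro borel_measurable_times borel_measurable_indicator)
      show "(\<lambda>x. indicator E1 x * Jm (norm (x - y))) \<in> borel_measurable lebesgue"
        by (rule measurable_completion) measurable
    qed
    also have "\<dots> = inner y" unfolding inner_def by (rule integral_completion) measurable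
    finally show ?thesis .
  qed
  have im[measurable]: "inner \<in> borel_measurable borel"
    unfolding inner_def[abs_def] by measurable
  have "energy J E F = (\<integral>y. indicator F y * inner y \<partial>lebesgue)"
    unfolding energy_def 1 by (simp add: set_lebesgue_integral_def)
  also have "\<dots> = (\<integral>y. indicator F1 y * inner y \<partial>lebesgue)"
  proof (rule integral_cong_AE)
    show "AE y in lebesgue. indicator F y * inner y = indicator F1 y * inner y"
      using F(3) by eventually_elim (auto simp: indicator_def)
    have "inner \<in> borel_measurable lebesgue" by (rule measurable_completion) measurable
    then show "(\<lambda>y. indicator F y * inner y) \<in> borel_measurable lebesgue"
      using F(1) by (intro borel_measurable_times borel_measurable_indicator)
    show "(\<lambda>y. indicator F1 y * inner y) \<in> borel_measurable lebesgue"
      by (rule measurable_completion) measurable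
  qed
  also have "\<dots> = (\<integral>y. indicator F1 y * inner y \<partial>lborel)" by (rule integral_completion) measurable
  finally have en1: "energy J E F = (\<integral>y. indicator F1 y * inner y \<partial>lborel)" .
  have int_ind: "integrable lborel (\<lambda>x. indicator S x * (c :: real))" if "S \<in> fmeasurable lborel" for S :: "'a set" and c
    using that by (intro integrable_mult_left) (simp add: fmeasurable_def)
  have int1: "integrable lborel (\<lambda>x. indicator E1 x * Jm (norm (x - y)))" for y
  proof (rule Bochner_Integration.integrable_bound[OF int_ind[OF E(2), of k]])
    show "AE x in lborel. norm (indicator E1 x * Jm (norm (x - y))) \<le> norm (indicator E1 x * k)"
      using Jb by (auto simp: indicator_def intro!: AE_I2) (meson abs_ge_self order_trans)
  qed measurable
  have i0: "0 \<le> inner y" for y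
    unfolding inner_def using Jb by (intro integral_nonneg_AE) (auto simp: indicator_def)
  define B where "B = (\<integral>x. indicator E1 x * k \<partial>lborel)"
  have ib: "inner y \<le> B" for y
    unfolding inner_def B_def using Jb by (intro integral_mono int1 int_ind E(2)) (auto simp: indicator_def)
  have int2: "integrable lborel (\<lambda>y. indicator F1 y * inner y)"
  proof (rule Bochner_Integration.integrable_bound[OF int_ind[OF F(2), of B]])
    show "AE y in lborel. norm (indicator F1 y * inner y) \<le> norm (indicator F1 y * B)"
    proof (rule AE_I2)
      fix y show "norm (indicator F1 y * inner y) \<le> norm (indicator F1 y * B)"
        using i0[of y] ib[of y] by (auto simp: indicator_def)
    qed
  qed measurable
  show "0 \<le> energy J E F" unfolding en1 using i0 by (intro integral_nonneg_AE) (auto simp: indicator_def)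
  have "ennreal (energy J E F) = (\<integral>\<^sup>+y. ennreal (indicator F1 y * inner y) \<partial>lborel)"
    unfolding en1 using int2 i0 by (intro nn_integral_eq_integral[symmetric]) (auto simp: indicator_def)
  also have "\<dots> = (\<integral>\<^sup>+y. \<integral>\<^sup>+x. indicator E1 x * indicator F1 y * ennreal (J (max 0 (norm (x - y)))) \<partial>lborel \<partial>lborel)"
  proof (rule nn_integral_cong)
    fix y :: 'a
    have "ennreal (inner y) = (\<integral>\<^sup>+x. ennreal (indicator E1 x * Jm (norm (x - y))) \<partial>lborel)"
      unfolding inner_def using int1 Jb by (intro nn_integral_eq_integral[symmetric]) (auto simp: indicator_def)
    then have "ennreal (indicator F1 y * inner y) = indicator F1 y * (\<integral>\<^sup>+x. ennreal (indicator E1 x * Jm (norm (x - y))) \<partial>lborel)"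
      by (auto simp: indicator_def)
    also have "\<dots> = (\<integral>\<^sup>+x. indicator F1 y * ennreal (indicator E1 x * Jm (norm (x - y))) \<partial>lborel)"
      by (rule nn_integral_cmult[symmetric]) measurable
    also have "\<dots> = (\<integral>\<^sup>+x. indicator E1 x * indicator F1 y * ennreal (J (max 0 (norm (x - y)))) \<partial>lborel)"
      by (intro nn_integral_cong) (auto simp: indicator_def Jm_def)
    finally show "ennreal (indicator F1 y * inner y) = (\<integral>\<^sup>+x. indicator E1 x * indicator F1 y * ennreal (J (max 0 (norm (x - y)))) \<partial>lborel)" .
  qed
  finally show "en (\<lambda>t. ennreal (J (max 0 t))) E1 F1 = ennreal (energy J E F)" by (simp add: en_def)
qed

lemma en_add:
  assumes [measurable]: "f \<in> borel_measurable borel" "g \<in> borel_measurable borel" "A \<in> sets borel" "C \<in> sets borel"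
    and h: "\<And>t. 0 \<le> t \<Longrightarrow> h t = f t + g t"
  shows "en h A C = en f A C + en g A C"
proof -
  have "en h A C = (\<integral>\<^sup>+y. \<integral>\<^sup>+x. indicator A x * indicator C y * f (norm (x - y)) + indicator A x * indicator C y * g (norm (x - y)) \<partial>lborel \<partial>lborel)"
    unfolding en_def by (intro nn_integral_cong) (simp add: h distrib_left)
  also have "\<dots> = (\<integral>\<^sup>+y. (\<integral>\<^sup>+x. indicator A x * indicator C y * f (norm (x - y)) \<partial>lborel) + (\<integral>\<^sup>+x. indicator A x * indicator C y * g (norm (x - y)) \<partial>lborel) \<partial>lborel)"
    by (intro nn_integral_cong nn_integral_add) measurable
  also have "\<dots> = en f A C + en g A C"
    unfolding en_def by (rule nn_integral_add) measurable
  finally show ?thesis .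
qed

lemma en_cmult:
  assumes [measurable]: "f \<in> borel_measurable borel" "A \<in> sets borel" "C \<in> sets borel"
  shows "en (\<lambda>t. c * f t) A C = c * en f A C"
proof -
  have "en (\<lambda>t. c * f t) A C = (\<integral>\<^sup>+y. \<integral>\<^sup>+x. c * (indicator A x * indicator C y * f (norm (x - y))) \<partial>lborel \<partial>lborel)"
    unfolding en_def by (intro nn_integral_cong) (simp add: mult_ac)
  also have "\<dots> = (\<integral>\<^sup>+y. c * (\<integral>\<^sup>+x. indicator A x * indicator C y * f (norm (x - y)) \<partial>lborel) \<partial>lborel)"
    by (intro nn_integral_cong nn_integral_cmult) measurable
  also have "\<dots> = c * en f A C"
    unfolding en_def by (rule nn_integral_cmult) measurable
  finally show ?thesis .
qed

lemma en_UNIV: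
  fixes A :: "'a::euclidean_space set"
  assumes [measurable]: "f \<in> borel_measurable borel" "A \<in> sets borel"
  shows "en f A UNIV = emeasure lborel A * (\<integral>\<^sup>+x. f (norm (x :: 'a)) \<partial>lborel)"
proof -
  have "en f A UNIV = en f UNIV A" by (rule en_swap) auto
  also have "\<dots> = (\<integral>\<^sup>+y. indicator A y * (\<integral>\<^sup>+x. f (norm (x - y)) \<partial>lborel) \<partial>lborel)"
    unfolding en_def by (intro nn_integral_cong) (simp add: nn_integral_cmult)
  also have "\<dots> = (\<integral>\<^sup>+y. (\<integral>\<^sup>+x. f (norm (x :: 'a)) \<partial>lborel) * indicator A y \<partial>lborel)"
    by (simp add: nn_integral_radial_translate[OF assms(1)] mult.commute)
  also have "\<dots> = emeasure lborel A * (\<integral>\<^sup>+x. f (norm (x :: 'a)) \<partial>lborel)"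
    by (subst nn_integral_cmult_indicator) (auto simp: mult.commute)
  finally show ?thesis .
qed

lemma en_Compl:
  assumes [measurable]: "f \<in> borel_measurable borel" "A \<in> sets borel" "C \<in> sets borel"
  shows "en f A UNIV = en f A C + en f A (- C)"
proof -
  have "en f A UNIV = (\<integral>\<^sup>+y. (\<integral>\<^sup>+x. indicator A x * indicator C y * f (norm (x - y)) \<partial>lborel) + (\<integral>\<^sup>+x. indicator A x * indicator (- C) y * f (norm (x - y)) \<partial>lborel) \<partial>lborel)"
    unfolding en_def by (intro nn_integral_cong) (auto simp: indicator_def)
  also have "\<dots> = en f A C + en f A (- C)"
    unfolding en_def by (rule nn_integral_add) measurable
  finally show ?thesis .
qed

text \<open>Seen from the ball of radius \<open>e\<close>, the paraboloid reaches only a distance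
  \<rho>, so nothing is lost by restricting the second variable to the larger ball.\<close>

lemma en_parab_balls:
  assumes "0 \<le> \<rho>"
  shows "en (parab \<rho>) (ball (0::'a::euclidean_space) e) (ball 0 (e + \<rho>)) = en (parab \<rho>) (ball (0::'a) e) UNIV"
  unfolding en_def
proof (intro nn_integral_cong)
  fix y x :: 'a
  have "parab \<rho> (norm (x - y)) = 0" if "norm x < e" "\<not> norm y < e + \<rho>"
  proof -
    have "norm y \<le> norm x + norm (x - y)" by (metis norm_triangle_sub norm_minus_commute)
    then have "\<rho> \<le> norm (x - y)" using that by linarith
    then have "\<rho>\<^sup>2 \<le> (norm (x - y))\<^sup>2" using assms by (intro power_mono) auto
    then show ?thesis by (simp add: parab_def)
  qed
  then show "indicator (ball 0 e) x * indicator (ball 0 (e + \<rho>)) y * parab \<rho> (norm (x - y)) = indicator (ball 0 e) x * indicator UNIV y * parab \<rho> (norm (x - y))"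
    by (auto simp: indicator_def)
qed

text \<open>Riesz is applied to the remainder only. For the paraboloid the balls realize its full
  integral against the first set, which depends on the measure of that set alone; its deficit is
  therefore exactly the interaction of \<open>E1\<close> with the complement of
  \<open>F1\<close>.\<close>

lemma parab_deficit_le:
  fixes E1 F1 :: "'a::euclidean_space set"
  assumes E1: "E1 \<in> fmeasurable lborel" "measure lborel (ball (0::'a) e) = measure lborel E1"
    and F1: "F1 \<in> fmeasurable lborel" "measure lborel (ball (0::'a) (e + \<rho>)) = measure lborel F1" and \<rho>: "0 \<le> \<rho>"
    and c: "0 \<le> c"
    and Jm[measurable]: "Jm \<in> borel_measurable borel" and J0: "\<And>t. 0 \<le> t \<Longrightarrow> 0 \<le> Jm t \<and> Jm t \<le> k" and J1: "\<And>t. 1 < t \<Longrightarrow> Jm t = 0"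
    and anti: "\<And>s t. 0 \<le> s \<Longrightarrow> s \<le> t \<Longrightarrow> Jm t - c * max 0 (\<rho>\<^sup>2 - t\<^sup>2) \<le> Jm s - c * max 0 (\<rho>\<^sup>2 - s\<^sup>2)"
  shows "en (\<lambda>t. ennreal (Jm t)) E1 F1 + ennreal c * en (parab \<rho>) E1 (- F1) \<le> en (\<lambda>t. ennreal (Jm t)) (ball (0::'a) e) (ball 0 (e + \<rho>))"
proof -
  have [measurable]: "E1 \<in> sets borel" "F1 \<in> sets borel" using E1 F1 by (auto simp: fmeasurable_def)
  define j1 where "j1 t = ennreal (Jm t - c * max 0 (\<rho>\<^sup>2 - t\<^sup>2))" for t
  have [measurable]: "j1 \<in> borel_measurable borel" unfolding j1_def[abs_def] by measurable
  have nn: "0 \<le> Jm t - c * max 0 (\<rho>\<^sup>2 - t\<^sup>2)" if "0 \<le> t" for t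
  proof -
    \<comment> \<open>At \<open>u\<close> both the kernel and the paraboloid vanish, and a
      decreasing function that is 0 far out is nonnegative before.\<close>
    define u where "u = max (t + 2) \<rho>"
    have "t \<le> u" "1 < u" "\<rho> \<le> u" using that by (auto simp: u_def)
    then have "\<rho>\<^sup>2 \<le> u\<^sup>2" using \<rho> by (intro power_mono) auto
    then have "Jm u - c * max 0 (\<rho>\<^sup>2 - u\<^sup>2) = 0" using J1[OF \<open>1 < u\<close>] by simp
    then show ?thesis using anti[OF that \<open>t \<le> u\<close>] by simp
  qed
  have split: "ennreal (Jm t) = ennreal c * parab \<rho> t + j1 t" if "0 \<le> t" for t
  proof -
    have "ennreal c * parab \<rho> t + j1 t = ennreal (c * max 0 (\<rho>\<^sup>2 - t\<^sup>2)) + ennreal (Jm t - c * max 0 (\<rho>\<^sup>2 - t\<^sup>2))"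
      using c by (simp add: parab_def j1_def ennreal_mult)
    also have "\<dots> = ennreal (Jm t)" using nn[OF that] c by (subst ennreal_plus[symmetric]) auto
    finally show ?thesis ..
  qed
  have anti1: "antimono_on {0..} j1"
    using anti by (auto simp: monotone_on_def j1_def intro!: ennreal_leI)
  have "(\<integral>\<^sup>+x. j1 (norm (x :: 'a)) \<partial>lborel) \<le> (\<integral>\<^sup>+x. ennreal k * indicator (cball (0::'a) 1) x \<partial>lborel)"
  proof (rule nn_integral_mono)
    fix x :: 'a
    have "0 \<le> c * max 0 (\<rho>\<^sup>2 - (norm x)\<^sup>2)" using c by simp
    then have "j1 (norm x) \<le> ennreal (Jm (norm x))" unfolding j1_def by (intro ennreal_leI) simp
    also have "\<dots> \<le> ennreal k * indicator (cball 0 1) x"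
      using J0[of "norm x"] J1[of "norm x"] by (cases "norm x \<le> 1") (auto simp: indicator_def intro: ennreal_leI)
    finally show "j1 (norm x) \<le> ennreal k * indicator (cball 0 1) x" .
  qed
  also have "\<dots> = ennreal k * emeasure lborel (cball (0::'a) 1)" by (rule nn_integral_cmult_indicator) simp
  also have "\<dots> < \<infinity>" using emeasure_lborel_cball_finite[of "0::'a" 1] by (simp add: ennreal_mult_less_top)
  finally obtain K where K: "(\<integral>\<^sup>+x. j1 (norm (x :: 'a)) \<partial>lborel) = ennreal K" "0 \<le> K"
    by (cases "\<integral>\<^sup>+x. j1 (norm (x :: 'a)) \<partial>lborel") auto
  have Riesz: "en j1 E1 F1 \<le> en j1 (ball (0::'a) e) (ball 0 (e + \<rho>))"
    by (rule Riesz_rearrangement_radial[OF E1 F1 _ anti1 K]) measurable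
  have eqm: "emeasure lborel (ball (0::'a) e) = emeasure lborel E1"
    using E1 by (simp add: emeasure_eq_measure2)
  have P: "en (parab \<rho>) (ball (0::'a) e) (ball 0 (e + \<rho>)) = en (parab \<rho>) E1 F1 + en (parab \<rho>) E1 (- F1)"
  proof -
    have "en (parab \<rho>) (ball (0::'a) e) (ball 0 (e + \<rho>)) = en (parab \<rho>) E1 UNIV"
      using en_parab_balls[OF \<rho>, of e, where 'a='a] by (simp add: en_UNIV eqm)
    also have "\<dots> = en (parab \<rho>) E1 F1 + en (parab \<rho>) E1 (- F1)" by (rule en_Compl) auto
    finally show ?thesis .
  qed
  have dec: "en (\<lambda>t. ennreal (Jm t)) A C = ennreal c * en (parab \<rho>) A C + en j1 A C"
    if [measurable]: "A \<in> sets borel" "C \<in> sets borel" for A C :: "'a set"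
  proof -
    have "en (\<lambda>t. ennreal (Jm t)) A C = en (\<lambda>t. ennreal c * parab \<rho> t) A C + en j1 A C"
      by (rule en_add) (auto simp: split)
    then show ?thesis by (simp add: en_cmult)
  qed
  have "en (\<lambda>t. ennreal (Jm t)) E1 F1 + ennreal c * en (parab \<rho>) E1 (- F1)
    = ennreal c * (en (parab \<rho>) E1 F1 + en (parab \<rho>) E1 (- F1)) + en j1 E1 F1"
    by (simp add: dec distrib_left add_ac)
  also have "\<dots> \<le> ennreal c * en (parab \<rho>) (ball (0::'a) e) (ball 0 (e + \<rho>)) + en j1 (ball (0::'a) e) (ball 0 (e + \<rho>))"
    unfolding P using Riesz by (rule add_left_mono)
  also have "\<dots> = en (\<lambda>t. ennreal (Jm t)) (ball (0::'a) e) (ball 0 (e + \<rho>))" by (simp add: dec)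
  finally show ?thesis .
qed

text \<open>The best choice of \<eta> is the p-th root of \<open>Q\<close>. For \<open>Q = 0\<close>
  this is not positive, but then every small \<eta> is admissible and \<open>x\<close> must be
  0.\<close>

lemma power_transfer:
  fixes x C \<eta>1 Q :: real
  assumes x: "0 \<le> x" and C: "0 \<le> C" and Q: "0 \<le> Q" "Q < \<eta>1 ^ p" and p: "0 < p" and \<eta>1: "0 < \<eta>1"
    and h: "\<And>\<eta>. 0 < \<eta> \<Longrightarrow> \<eta> \<le> \<eta>1 \<Longrightarrow> Q \<le> \<eta> ^ p \<Longrightarrow> x ^ n \<le> C * \<eta>"
  shows "x ^ (n * p) \<le> C ^ p * Q"
proof (cases "Q = 0")
  case False
  define \<eta> where "\<eta> = root p Q"
  have \<eta>: "0 < \<eta>" "\<eta> ^ p = Q" using False Q p by (auto simp: \<eta>_def)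
  have "\<eta> \<le> \<eta>1"
    using power_strict_mono[of \<eta>1 \<eta> p] \<eta> \<eta>1 Q p by (cases "\<eta> \<le> \<eta>1") auto
  then have "x ^ n \<le> C * \<eta>" using \<eta> by (intro h) auto
  then have "(x ^ n) ^ p \<le> (C * \<eta>) ^ p" using x by (intro power_mono) auto
  then show ?thesis by (simp add: power_mult power_mult_distrib \<eta>)
next
  case True
  have "x ^ n \<le> 0"
  proof (rule ccontr)
    assume "\<not> ?thesis"
    then have xn: "0 < x ^ n" by simp
    define \<eta> where "\<eta> = min \<eta>1 (x ^ n / (2 * (C + 1)))"
    have \<eta>: "0 < \<eta>" "\<eta> \<le> \<eta>1" "\<eta> \<le> x ^ n / (2 * (C + 1))" using xn \<eta>1 C by (auto simp: \<eta>_def)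
    have "x ^ n \<le> C * \<eta>" using \<eta> True by (intro h) auto
    also have "\<dots> \<le> (C + 1) * (x ^ n / (2 * (C + 1)))" using \<eta> C by (intro mult_mono) auto
    also have "\<dots> = x ^ n / 2" using C by (simp add: field_simps)
    finally show False using xn by simp
  qed
  then have "x ^ n = 0" using zero_le_power[OF x, of n] by linarith
  then have "x ^ (n * p) = 0" using p by (simp only: power_mult zero_power)
  then show ?thesis using True by (simp only: mult_zero_right order_refl)
qed

text \<open>Sets of equal measure have one-sided differences of equal measure, so the factor 1/2 in
  the asymmetry cancels against the two halves of the symmetric difference.\<close>

lemma asymmetry_bounds:
  fixes E :: "'a::euclidean_space set"
  assumes E: "E \<in> lmeasurable" "0 < leb E" and e: "0 \<le> e" "leb E = leb (ball (0::'a) 1) * e ^ DIM('a)"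
  shows "0 \<le> asymmetry E" "asymmetry E \<le> leb (E - ball c e) / leb E" "asymmetry E \<le> 1"
proof -
  let ?X = "{leb ((E - ball x0 r) \<union> (ball x0 r - E)) / leb E | x0 r. r ^ DIM('a) = leb E / leb (ball (0::'a) 1) \<and> r \<ge> 0}"
  have w: "0 < leb (ball (0::'a) 1)" using measure_unit_ball_pos[where 'a='a] by simp
  have er: "e ^ DIM('a) = leb E / leb (ball (0::'a) 1)" using w e by simp
  have bdd: "bdd_below ?X" by (rule bdd_belowI[of _ 0]) auto
  have mem: "leb ((E - ball c e) \<union> (ball c e - E)) / leb E \<in> ?X" for c using er e by blast
  have "0 \<le> Inf ?X" using mem[of 0] by (intro cInf_greatest) auto
  then show "0 \<le> asymmetry E" by (simp add: asymmetry_def)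
  have le: "asymmetry E \<le> leb (E - ball c e) / leb E" for c
  proof -
    have B: "ball c e \<in> lmeasurable" by simp
    have mB: "leb (ball c e) = leb E" using e measure_lborel_ball[OF e(1), of c] by simp
    have "leb E = leb (E \<inter> ball c e) + leb (E - ball c e)" using E B by (intro measure_Int_Diff) auto
    moreover have "leb (ball c e) = leb (ball c e \<inter> E) + leb (ball c e - E)" using E B by (intro measure_Int_Diff) auto
    ultimately have eq: "leb (ball c e - E) = leb (E - ball c e)" using mB by (simp add: Int_commute)
    have "leb ((E - ball c e) \<union> (ball c e - E)) \<le> leb (E - ball c e) + leb (ball c e - E)"
      using E B by (intro measure_Un_le) auto
    then have "leb ((E - ball c e) \<union> (ball c e - E)) / leb E \<le> (2 * leb (E - ball c e)) / leb E"
      using E(2) eq by (intro divide_right_mono) auto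
    then have "leb ((E - ball c e) \<union> (ball c e - E)) / leb E \<le> 2 * (leb (E - ball c e) / leb E)" by simp
    moreover have "Inf ?X \<le> leb ((E - ball c e) \<union> (ball c e - E)) / leb E" by (rule cInf_lower[OF mem bdd])
    ultimately show ?thesis unfolding asymmetry_def by linarith
  qed
  show "asymmetry E \<le> leb (E - ball c e) / leb E" by (rule le)
  have "leb (E - ball 0 e) \<le> leb E" using E by (intro measure_mono_fmeasurable) auto
  then show "asymmetry E \<le> 1" using le[of 0] E(2) by (simp add: divide_le_eq_1 order_trans)
qed

text \<open>Up to \<rho> the difference is \<open>J u + u\<^sup>2 / (2 * k)\<close> minus a
  constant, and the derivative bound holds on that range because \<open>\<rho> \<le> 3 / 4\<close>;
  from \<rho> on it is \<open>J\<close> itself. Both pieces decrease and agree at \<rho>.\<close>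

lemma kernel_minus_parab_decreasing:
  fixes J :: "real \<Rightarrow> real"
  assumes k: "0 < k" and anti: "antimono_on {0..} J" and lip: "L-lipschitz_on {0..} J"
    and AE: "AE r in lborel. r \<in> {0..3/4} \<longrightarrow> (\<exists>D. (J has_real_derivative D) (at r) \<and> - D \<ge> r / k)"
    and \<rho>: "0 \<le> \<rho>" "\<rho> \<le> 3 / 4" and st: "0 \<le> s" "s \<le> t"
  shows "J t - 1 / (2 * k) * max 0 (\<rho>\<^sup>2 - t\<^sup>2) \<le> J s - 1 / (2 * k) * max 0 (\<rho>\<^sup>2 - s\<^sup>2)"
proof -
  define g where "g r = J r + r\<^sup>2 / (2 * k)" for r
  have L: "0 \<le> L" using lip by (rule lipschitz_on_nonneg)
  have g: "g v \<le> g u" if "0 \<le> u" "u \<le> v" "v \<le> 3 / 4" for u v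
  proof (rule Lipschitz_AE_nonpos_derivative_decreasing[where f = g and a = 0 and b = "3/4" and L = "L + 1 / k" and s = u and t = v])
    fix x y :: real assume xy: "x \<in> {0..3/4}" "y \<in> {0..3/4}"
    have "\<bar>J x - J y\<bar> \<le> L * \<bar>x - y\<bar>" using lipschitz_onD[OF lip, of x y] xy by (auto simp: dist_real_def)
    moreover have "\<bar>x\<^sup>2 / (2 * k) - y\<^sup>2 / (2 * k)\<bar> \<le> 1 / k * \<bar>x - y\<bar>"
    proof -
      have "x\<^sup>2 - y\<^sup>2 = (x - y) * (x + y)" by (simp add: power2_eq_square algebra_simps)
      then have "x\<^sup>2 / (2 * k) - y\<^sup>2 / (2 * k) = (x - y) * ((x + y) / (2 * k))"
        by (simp add: diff_divide_distrib[symmetric])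
      then have "\<bar>x\<^sup>2 / (2 * k) - y\<^sup>2 / (2 * k)\<bar> = \<bar>x - y\<bar> * ((x + y) / (2 * k))"
        using xy k by (simp add: abs_mult)
      also have "\<dots> \<le> \<bar>x - y\<bar> * (2 / (2 * k))" using xy k by (intro mult_left_mono divide_right_mono) auto
      finally show ?thesis by simp
    qed
    ultimately show "\<bar>g x - g y\<bar> \<le> (L + 1 / k) * \<bar>x - y\<bar>"
      unfolding g_def distrib_right by linarith
  next
    show "AE x in lborel. x \<in> {0..3/4} \<longrightarrow> (\<exists>D. (g has_real_derivative D) (at x) \<and> D \<le> 0)"
      using AE
    proof eventually_elim
      case (elim x)
      show ?case
      proof
        assume "x \<in> {0..3/4}"
        then obtain D where D: "(J has_real_derivative D) (at x)" "x / k \<le> - D" using elim by auto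
        have "(g has_real_derivative (D + x / k)) (at x)"
          unfolding g_def[abs_def] using k by (auto intro!: derivative_eq_intros D(1))
        then show "\<exists>D. (g has_real_derivative D) (at x) \<and> D \<le> 0" using D(2) by (intro exI[of _ "D + x / k"]) auto
      qed
    qed
  qed (use that L k in auto)
  have J: "J v \<le> J u" if "0 \<le> u" "u \<le> v" for u v
    using monotone_onD[OF anti, of u v] that by auto
  have in_\<rho>: "J u - 1 / (2 * k) * max 0 (\<rho>\<^sup>2 - u\<^sup>2) = g u - \<rho>\<^sup>2 / (2 * k)" if "0 \<le> u" "u \<le> \<rho>" for u
  proof -
    have "u\<^sup>2 \<le> \<rho>\<^sup>2" using that by (intro power_mono) auto
    then show ?thesis by (simp add: g_def diff_divide_distrib)
  qed
  have out_\<rho>: "J u - 1 / (2 * k) * max 0 (\<rho>\<^sup>2 - u\<^sup>2) = J u" if "\<rho> \<le> u" for u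
  proof -
    have "\<rho>\<^sup>2 \<le> u\<^sup>2" using that \<rho> by (intro power_mono) auto
    then show ?thesis by simp
  qed
  consider "t \<le> \<rho>" | "s \<le> \<rho>" "\<rho> \<le> t" | "\<rho> \<le> s" by linarith
  then show ?thesis
  proof cases
    case 1
    then show ?thesis using g[of s t] st \<rho> in_\<rho>[of s] in_\<rho>[of t] by simp
  next
    case 2
    have "J t \<le> J \<rho>" using J[of \<rho> t] 2 \<rho> by simp
    also have "\<dots> = g \<rho> - \<rho>\<^sup>2 / (2 * k)" by (simp add: g_def)
    also have "\<dots> \<le> g s - \<rho>\<^sup>2 / (2 * k)" using g[of s \<rho>] 2 st \<rho> by simp
    finally show ?thesis using out_\<rho>[of t] in_\<rho>[of s] 2 st by simp
  next
    case 3
    then show ?thesis using J[of s t] st k out_\<rho>[of s] out_\<rho>[of t] by simp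
  qed
qed

theorem theorem1p3:
  fixes k :: real
  assumes "k > 0"
  shows "\<exists>C::real. \<forall>J::real \<Rightarrow> real.
     ((\<forall>r\<ge>0. 0 \<le> J r \<and> J r \<le> k)
      \<and> antimono_on {0..} J
      \<and> (\<exists>L. L-lipschitz_on {0..} J)
      \<and> closure {r. r \<ge> 0 \<and> J r \<noteq> 0} \<subseteq> {0..1}
      \<and> ((\<lambda>x::'a::euclidean_space. J (norm x)) has_integral 1) UNIV
      \<and> (AE r in lborel. r \<in> {0..3/4} \<longrightarrow>
            (\<exists>D. (J has_real_derivative D) (at r) \<and> - D \<ge> r / k)))
     \<longrightarrow> (\<forall>E F :: 'a set.
          E \<in> sets lebesgue \<and> F \<in> sets lebesgue \<and>
          emeasure lebesgue E < \<infinity> \<and> emeasure lebesgue F < \<infinity> \<and> E \<subseteq> F \<and>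
          1/4 \<le> (leb F / leb (ball (0::'a) 1)) powr (1 / real DIM('a))
                 - (leb E / leb (ball (0::'a) 1)) powr (1 / real DIM('a)) \<and>
          (leb F / leb (ball (0::'a) 1)) powr (1 / real DIM('a))
                 - (leb E / leb (ball (0::'a) 1)) powr (1 / real DIM('a)) \<le> 3/4 \<and>
          leb E \<ge> 2 * leb (ball (0::'a) 1)
          \<longrightarrow> leb E powr (1 - 1 / real DIM('a)) * asymmetry E ^ (8 * (DIM('a) + 2))
              \<le> C * deficit J E F)"
proof -
  let ?d = "DIM('a)" and ?w = "measure lborel (ball (0::'a) 1)"
  have w: "0 < ?w" by (rule measure_unit_ball_pos)
  have lw: "leb (ball (0::'a) 1) = ?w" by simp
  obtain C6 \<eta>0 where C6: "0 \<le> C6" and \<eta>0: "0 < \<eta>0" and near: "\<And>(E::'a set) F e \<rho> \<eta>.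
    small_deficit E F \<rho> \<eta> (\<eta> ^ (?d + 3) * e ^ (?d - 1)) \<Longrightarrow> measure lborel E = ?w * e ^ ?d \<Longrightarrow>
    measure lborel F = ?w * (e + \<rho>) ^ ?d \<Longrightarrow> 1 \<le> e \<Longrightarrow> \<eta> \<le> \<eta>0 \<Longrightarrow>
    (\<exists>c. (measure lborel (E - ball c e) / measure lborel E) ^ 6 \<le> C6 * \<eta>)"
    using small_deficit_near_ball[where 'a='a] by blast
  \<comment> \<open>1/32 is the limit for \<eta> in \<open>small_deficit\<close>.\<close>
  define \<eta>1 where "\<eta>1 = min \<eta>0 (1 / 32)"
  have \<eta>1: "0 < \<eta>1" using \<eta>0 by (simp add: \<eta>1_def)
  define C where "C = ?w powr (1 - 1 / ?d) * (2 * k) * (1 / \<eta>1 ^ (?d + 3) + C6 ^ (?d + 3))"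
  show ?thesis
  proof (intro exI[of _ C] allI impI, elim conjE exE)
    fix J :: "real \<Rightarrow> real" and E F :: "'a set" and L
    assume Jk: "\<forall>r\<ge>0. 0 \<le> J r \<and> J r \<le> k" and anti: "antimono_on {0..} J" and lip: "L-lipschitz_on {0..} J"
      and spt: "closure {r. r \<ge> 0 \<and> J r \<noteq> 0} \<subseteq> {0..1}"
      and AE: "AE r in lborel. r \<in> {0..3/4} \<longrightarrow> (\<exists>D. (J has_real_derivative D) (at r) \<and> - D \<ge> r / k)"
      and E: "E \<in> sets lebesgue" and F: "F \<in> sets lebesgue" and fE: "emeasure lebesgue E < \<infinity>" and fF: "emeasure lebesgue F < \<infinity>"
      and EF: "E \<subseteq> F"
      and \<rho>1: "1/4 \<le> (leb F / leb (ball (0::'a) 1)) powr (1 / real ?d) - (leb E / leb (ball (0::'a) 1)) powr (1 / real ?d)"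
      and \<rho>2: "(leb F / leb (ball (0::'a) 1)) powr (1 / real ?d) - (leb E / leb (ball (0::'a) 1)) powr (1 / real ?d) \<le> 3/4"
      and big: "leb E \<ge> 2 * leb (ball (0::'a) 1)"
    define e where "e = (leb E / ?w) powr (1 / real ?d)"
    define \<rho> where "\<rho> = (leb F / ?w) powr (1 / real ?d) - e"
    have \<rho>: "1 / 4 \<le> \<rho>" "\<rho> \<le> 3 / 4" using \<rho>1 \<rho>2 by (simp_all add: \<rho>_def e_def)
    have pw: "(x powr (1 / real ?d)) ^ ?d = x" if "0 \<le> x" for x
      using that by (cases "x = 0") (auto simp: powr_realpow[symmetric] powr_powr)
    have e0: "0 \<le> e" by (simp add: e_def)
    have ed: "e ^ ?d = leb E / ?w" unfolding e_def using w by (intro pw) auto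
    have mE: "leb E = ?w * e ^ ?d" using w by (simp add: ed)
    have mF: "leb F = ?w * (e + \<rho>) ^ ?d"
    proof -
      have "(e + \<rho>) ^ ?d = leb F / ?w" unfolding \<rho>_def using w by (simp add: pw)
      then show ?thesis using w by simp
    qed
    have e1: "1 \<le> e"
    proof (rule ccontr)
      assume "\<not> 1 \<le> e"
      then have "e ^ ?d \<le> 1" using e0 by (intro power_le_one) auto
      moreover have "2 \<le> e ^ ?d" using big w by (simp add: ed pos_le_divide_eq)
      ultimately show False by simp
    qed
    have E0: "0 < leb E" using big w unfolding lw by linarith
    obtain B where B: "B \<in> sets borel" "B \<subseteq> E" "AE x in lebesgue. x \<in> E \<longleftrightarrow> x \<in> B" using ex_borel_version[OF E] by blast
    obtain F1 where F1: "F1 \<in> sets borel" "F1 \<subseteq> F" "AE x in lebesgue. x \<in> F \<longleftrightarrow> x \<in> F1" using ex_borel_version[OF F] by blast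
    \<comment> \<open>Intersecting with \<open>F1\<close> restores the inclusion, which Borel
      versions chosen separately need not respect.\<close>
    define E1 where "E1 = B \<inter> F1"
    have E1: "E1 \<in> sets borel" "E1 \<subseteq> F1" "AE x in lebesgue. x \<in> E \<longleftrightarrow> x \<in> E1"
    proof -
      show "E1 \<in> sets borel" "E1 \<subseteq> F1" using B F1 by (auto simp: E1_def)
      show "AE x in lebesgue. x \<in> E \<longleftrightarrow> x \<in> E1" using B(3) F1(3) by eventually_elim (use EF in \<open>auto simp: E1_def\<close>)
    qed
    have fE1: "E1 \<in> fmeasurable lborel" "measure lborel E1 = leb E"
      using measure_lebesgue_borel_version[OF E E1(1,3)] fE E1(1) by (auto simp: fmeasurable_def)
    have fF1: "F1 \<in> fmeasurable lborel" "measure lborel F1 = leb F"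
      using measure_lebesgue_borel_version[OF F F1(1,3)] fF F1(1) by (auto simp: fmeasurable_def)
    define BE where "BE = ball (0::'a) e"
    define BF where "BF = ball (0::'a) (e + \<rho>)"
    have sE: "sym_ball E = BE" by (simp add: sym_ball_def BE_def e_def)
    have sF: "sym_ball F = BF" by (simp add: sym_ball_def BF_def \<rho>_def)
    have bE: "measure lborel BE = measure lborel E1" unfolding BE_def using measure_lborel_ball[OF e0, of "0::'a"] by (simp add: fE1 mE)
    have bF: "measure lborel BF = measure lborel F1"
      unfolding BF_def using measure_lborel_ball[of "e + \<rho>" "0::'a"] e0 \<rho> by (simp add: fF1 mF)
    have contJ: "continuous_on {0..} J" using lip by (rule lipschitz_on_continuous_on)
    have Jk': "0 \<le> J t \<and> J t \<le> k" if "0 \<le> t" for t using Jk that by blast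
    define Jm where "Jm t = J (max 0 t)" for t
    note en1 = energy_eq_en[OF contJ Jk' E fE1(1) E1(3) F fF1(1) F1(3)]
    have BEs: "BE \<in> sets lebesgue" "BF \<in> sets lebesgue" "BE \<in> fmeasurable lborel" "BF \<in> fmeasurable lborel"
      by (simp_all add: BE_def BF_def)
    note en2 = energy_eq_en[OF contJ Jk' BEs(1,3) _ BEs(2,4)]
    have "continuous_on UNIV Jm"
      unfolding Jm_def by (intro continuous_on_compose2[OF contJ] continuous_intros) auto
    then have Jmm: "Jm \<in> borel_measurable borel" by (rule borel_measurable_continuous_onI)
    have Jk_m: "0 \<le> Jm t \<and> Jm t \<le> k" if "0 \<le> t" for t using Jk'[OF that] that by (simp add: Jm_def)
    have J1: "Jm t = 0" if "1 < t" for t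
    proof (rule ccontr)
      assume "Jm t \<noteq> 0"
      then have "t \<in> {r. r \<ge> 0 \<and> J r \<noteq> 0}" using that by (simp add: Jm_def)
      then have "t \<in> {0..1}" using subset_trans[OF closure_subset spt] by (rule rev_subsetD)
      then show False using that by simp
    qed
    have pd: "en (\<lambda>t. ennreal (Jm t)) E1 F1 + ennreal (1 / (2 * k)) * en (parab \<rho>) E1 (- F1) \<le> en (\<lambda>t. ennreal (Jm t)) BE BF"
      unfolding BE_def BF_def
    proof (rule parab_deficit_le)
      show "measure lborel (ball (0::'a) e) = measure lborel E1" "measure lborel (ball (0::'a) (e + \<rho>)) = measure lborel F1"
        using bE bF by (simp_all add: BE_def BF_def)
      fix s t :: real assume "0 \<le> s" "s \<le> t"
      then show "Jm t - 1 / (2 * k) * max 0 (\<rho>\<^sup>2 - t\<^sup>2) \<le> Jm s - 1 / (2 * k) * max 0 (\<rho>\<^sup>2 - s\<^sup>2)"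
        using kernel_minus_parab_decreasing[OF assms anti lip AE, of \<rho> s t] \<rho> by (simp add: Jm_def)
    qed (use fE1 fF1 \<rho> assms Jmm J1 Jk_m in auto)
    define \<delta> where "\<delta> = deficit J E F"
    define X where "X = en (parab \<rho>) E1 (- F1)"
    have "ennreal (energy J E F) + ennreal (1 / (2 * k)) * X \<le> ennreal (energy J BE BF)"
      using pd en1 en2 by (simp add: Jm_def X_def)
    \<comment> \<open>The sign of \<delta> comes first: only for a nonnegative \<delta> does
      \<open>ennreal\<close> turn the difference of the energies into a sum that can be
      cancelled.\<close>
    moreover have "ennreal (energy J BE BF) = ennreal (energy J E F) + ennreal \<delta>" "0 \<le> \<delta>"
    proof -
      have "ennreal (energy J E F) \<le> ennreal (energy J BE BF)" using calculation by (meson le_iff_add order_trans)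
      then have "energy J E F \<le> energy J BE BF" using en2 by (simp add: ennreal_le_iff)
      then show "0 \<le> \<delta>" by (simp add: \<delta>_def deficit_def sE sF)
      then show "ennreal (energy J BE BF) = ennreal (energy J E F) + ennreal \<delta>"
        using en1 by (simp add: ennreal_plus[symmetric] \<delta>_def deficit_def sE sF del: ennreal_plus)
    qed
    ultimately have X: "ennreal (1 / (2 * k)) * X \<le> ennreal \<delta>" and \<delta>0: "0 \<le> \<delta>"
      by (auto simp: ennreal_add_left_cancel_le)
    have X2: "X \<le> ennreal (2 * k * \<delta>)"
    proof -
      have "X = ennreal (2 * k) * (ennreal (1 / (2 * k)) * X)"
        using assms by (simp add: mult.assoc[symmetric] ennreal_mult[symmetric])
      also have "\<dots> \<le> ennreal (2 * k) * ennreal \<delta>" using X by (rule mult_left_mono) simp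
      also have "\<dots> = ennreal (2 * k * \<delta>)" using assms \<delta>0 by (simp add: ennreal_mult)
      finally show ?thesis .
    qed
    let ?e1 = "e ^ (?d - 1)" and ?\<alpha> = "asymmetry E"
    have e1p: "0 < ?e1" using e1 by simp
    have lmE: "E \<in> lmeasurable" using E fE by (simp add: fmeasurable_def)
    note asym = asymmetry_bounds[OF lmE E0 e0, unfolded lw, OF mE]
    \<comment> \<open>The bound on the paraboloid interaction per unit of surface; it is
      \<open>\<eta> ^ (?d + 3)\<close> when \<eta> is chosen optimally.\<close>
    define Q where "Q = 2 * k * \<delta> / ?e1"
    have Q0: "0 \<le> Q" using assms \<delta>0 e1p by (simp add: Q_def)
    have Qe: "Q * ?e1 = 2 * k * \<delta>" by (rule iffD1[OF nonzero_eq_divide_eq[OF less_imp_neq[OF e1p, symmetric]] Q_def])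
    have step: "?\<alpha> ^ 6 \<le> C6 * \<eta>" if \<eta>: "0 < \<eta>" "\<eta> \<le> \<eta>1" "Q \<le> \<eta> ^ (?d + 3)" for \<eta>
    proof -
      have "small_deficit E1 F1 \<rho> \<eta> (\<eta> ^ (?d + 3) * ?e1)"
      proof
        have "2 * k * \<delta> \<le> \<eta> ^ (?d + 3) * ?e1" using \<eta>(3) e1p unfolding Qe[symmetric] by (intro mult_right_mono) auto
        then show "en (parab \<rho>) E1 (- F1) \<le> ennreal (\<eta> ^ (?d + 3) * ?e1)"
          using X2 unfolding X_def by (meson ennreal_leI order_trans)
      qed (use fE1 fF1 E1 \<rho> \<eta> e1p in \<open>auto simp: \<eta>1_def\<close>)
      then obtain c where c: "(measure lborel (E1 - ball c e) / measure lborel E1) ^ 6 \<le> C6 * \<eta>"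
        using near[of E1 F1 \<rho> \<eta> e] \<eta>(2) e1 by (auto simp: fE1 fF1 mE mF \<eta>1_def)
      have "leb (E - ball c e) = measure lborel (E1 - ball c e)"
      proof (rule measure_lebesgue_borel_version(1))
        show "E - ball c e \<in> sets lebesgue" using E by auto
        show "E1 - ball c e \<in> sets borel" using E1(1) by auto
        show "AE x in lebesgue. x \<in> E - ball c e \<longleftrightarrow> x \<in> E1 - ball c e" using E1(3) by eventually_elim auto
      qed
      then have "?\<alpha> \<le> measure lborel (E1 - ball c e) / measure lborel E1" using asym(2)[of c] by (simp add: fE1)
      then have "?\<alpha> ^ 6 \<le> (measure lborel (E1 - ball c e) / measure lborel E1) ^ 6" using asym(1) by (intro power_mono) auto
      then show ?thesis using c by linarith
    qed
    \<comment> \<open>For small \<open>Q\<close> the estimate of the sixth power is raised to the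
      power \<open>?d + 3\<close>; for large \<open>Q\<close> it is enough that the asymmetry is at
      most 1. The exponents 6 (d + 3) and 8 (d + 2) coincide for d = 1.\<close>
    have main: "?\<alpha> ^ (8 * (?d + 2)) \<le> (1 / \<eta>1 ^ (?d + 3) + C6 ^ (?d + 3)) * Q"
    proof (cases "Q < \<eta>1 ^ (?d + 3)")
      case True
      have "?\<alpha> ^ (6 * (?d + 3)) \<le> C6 ^ (?d + 3) * Q"
        by (rule power_transfer[OF asym(1) C6 Q0 True _ \<eta>1 step]) auto
      moreover have "?\<alpha> ^ (8 * (?d + 2)) \<le> ?\<alpha> ^ (6 * (?d + 3))"
        using asym(1,3) by (intro power_decreasing) (auto simp: Suc_le_eq)
      moreover have "0 \<le> 1 / \<eta>1 ^ (?d + 3) * Q" using Q0 \<eta>1 by simp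
      ultimately show ?thesis by (simp add: distrib_right)
    next
      case False
      have "?\<alpha> ^ (8 * (?d + 2)) \<le> 1" using asym(1,3) by (intro power_le_one) auto
      also have "1 \<le> 1 / \<eta>1 ^ (?d + 3) * Q" using False \<eta>1 by (simp add: pos_le_divide_eq)
      also have "\<dots> \<le> (1 / \<eta>1 ^ (?d + 3) + C6 ^ (?d + 3)) * Q" using Q0 C6 by (intro mult_right_mono) auto
      finally show ?thesis .
    qed
    have "leb E powr (1 - 1 / real ?d) = ?w powr (1 - 1 / real ?d) * ?e1"
    proof -
      have "(e ^ ?d) powr (1 - 1 / real ?d) = ?e1"
      proof -
        have "(e ^ ?d) powr (1 - 1 / real ?d) = e powr (real ?d * (1 - 1 / real ?d))"
          using e1 by (simp add: powr_realpow[symmetric] powr_powr)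
        also have "real ?d * (1 - 1 / real ?d) = real (?d - 1)" by (simp add: right_diff_distrib of_nat_diff)
        also have "e powr real (?d - 1) = ?e1" using e1 by (intro powr_realpow) simp
        finally show ?thesis .
      qed
      moreover have "leb E powr (1 - 1 / real ?d) = ?w powr (1 - 1 / real ?d) * (e ^ ?d) powr (1 - 1 / real ?d)"
        unfolding mE by (rule powr_mult)
      ultimately show ?thesis by (simp only:)
    qed
    then have "leb E powr (1 - 1 / real ?d) * ?\<alpha> ^ (8 * (?d + 2)) = ?w powr (1 - 1 / real ?d) * ?e1 * ?\<alpha> ^ (8 * (?d + 2))" by simp
    also have "\<dots> \<le> ?w powr (1 - 1 / real ?d) * ?e1 * ((1 / \<eta>1 ^ (?d + 3) + C6 ^ (?d + 3)) * Q)"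
      using main e1p by (intro mult_left_mono mult_nonneg_nonneg powr_ge_zero) (auto intro: less_imp_le)
    also have "\<dots> = ?w powr (1 - 1 / real ?d) * (1 / \<eta>1 ^ (?d + 3) + C6 ^ (?d + 3)) * (Q * ?e1)" by (simp only: mult_ac)
    also have "\<dots> = C * deficit J E F" unfolding Qe C_def \<delta>_def by (simp only: mult_ac)
    finally show "leb E powr (1 - 1 / real ?d) * ?\<alpha> ^ (8 * (?d + 2)) \<le> C * deficit J E F" .
  qed
qed

end
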